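(* Let $p$ be a prime, let $q$ and $r$ be powers of $p$ (with $r=1$ allowed), let $F=\mathbb{F}_q((t))$, and let $$G_2=\left\{\begin{pmatrix}1&y^r&z\\0&1&y\\0&0&1\end{pmatrix} : y,z\in F\right\}.$$ If $r\neq 2$, then any arithmetic lattice in $G_2$ is automorphism rigid in $G_2$.
   Context: $F^-=\mathbb{F}_q[t^{-1}]\subset F$. A subgroup $\Gamma$ of a closed subgroup $G\subset \mathrm{GL}(n,F)$ is arithmetic if it is commensurable with $\mathrm{GL}(n,F^-)\cap G$ (the intersection has finite index in both). A lattice is a discrete subgroup $\Gamma$ of $G$ with $G/\Gamma$ compact; arithmetic subgroups of $G_2$ are lattices. A virtual automorphism of a topological group $G$ is an isomorphism (of topological groups) $\Lambda\colon G'\to G''$ between finite-index open subgroups $G',G''$ of $G$ (discrete groups carry the discrete topology). A discrete subgroup $\Gamma$ of $G$ is automorphism rigid in $G$ if for every virtual automorphism $\lambda\colon \Gamma_1\to\Gamma_2$ of $\Gamma$ there are a virtual automorphism $\Lambda\colon G'\to G''$ of $G$ and a finite-index subgroup $\Gamma_1'$ of $\Gamma_1$ with $\Gamma_1'\subset G'$ and $\Lambda|_{\Gamma_1'}=\lambda|_{\Gamma_1'}$. *)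

theory Defs
  imports
    "HOL-Analysis.Analysis"
    "HOL-Computational_Algebra.Computational_Algebra"
    "HOL-Number_Theory.Residues"
    "HOL-Algebra.Left_Coset"
begin

subsection \<open>Topological groups, finite index, virtual automorphisms\<close>

text \<open>A topological group is given by a group structure \<open>G\<close> and a topology \<open>T\<close> with
  \<open>topspace T = carrier G\<close>.\<close>

definition finite_index_subgroup :: "'a set \<Rightarrow> ('a, 'b) monoid_scheme \<Rightarrow> bool" where
  "finite_index_subgroup H G \<longleftrightarrow> subgroup H G \<and> finite (rcosets\<^bsub>G\<^esub> H)"

definition commensurable :: "('a, 'b) monoid_scheme \<Rightarrow> 'a set \<Rightarrow> 'a set \<Rightarrow> bool" where
  "commensurable G H K \<longleftrightarrow>
     finite_index_subgroup (H \<inter> K) (G\<lparr>carrier := H\<rparr>) \<and>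
     finite_index_subgroup (H \<inter> K) (G\<lparr>carrier := K\<rparr>)"

definition virtual_automorphism ::
  "('a, 'b) monoid_scheme \<Rightarrow> 'a topology \<Rightarrow> 'a set \<Rightarrow> 'a set \<Rightarrow> ('a \<Rightarrow> 'a) \<Rightarrow> bool" where
  "virtual_automorphism G T G' G'' \<Lambda> \<longleftrightarrow>
     finite_index_subgroup G' G \<and> openin T G' \<and>
     finite_index_subgroup G'' G \<and> openin T G'' \<and>
     \<Lambda> \<in> iso (G\<lparr>carrier := G'\<rparr>) (G\<lparr>carrier := G''\<rparr>) \<and>
     homeomorphic_map (subtopology T G') (subtopology T G'') \<Lambda>"

definition discrete_subgroup :: "'a set \<Rightarrow> ('a, 'b) monoid_scheme \<Rightarrow> 'a topology \<Rightarrow> bool" where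
  "discrete_subgroup \<Gamma> G T \<longleftrightarrow>
     subgroup \<Gamma> G \<and> subtopology T \<Gamma> = discrete_topology \<Gamma>"

definition automorphism_rigid ::
  "'a set \<Rightarrow> ('a, 'b) monoid_scheme \<Rightarrow> 'a topology \<Rightarrow> bool" where
  "automorphism_rigid \<Gamma> G T \<longleftrightarrow>
     discrete_subgroup \<Gamma> G T \<and>
     (\<forall>\<Gamma>\<^sub>1 \<Gamma>\<^sub>2 \<phi>.
        virtual_automorphism (G\<lparr>carrier := \<Gamma>\<rparr>) (discrete_topology \<Gamma>) \<Gamma>\<^sub>1 \<Gamma>\<^sub>2 \<phi> \<longrightarrow>
        (\<exists>G' G'' \<Lambda> \<Gamma>\<^sub>1'.
           virtual_automorphism G T G' G'' \<Lambda> \<and>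
           finite_index_subgroup \<Gamma>\<^sub>1' (G\<lparr>carrier := \<Gamma>\<^sub>1\<rparr>) \<and>
           \<Gamma>\<^sub>1' \<subseteq> G' \<and>
           (\<forall>x\<in>\<Gamma>\<^sub>1'. \<Lambda> x = \<phi> x)))"


subsection \<open>Lattices\<close>

text \<open>The quotient topology on the space \<open>G/\<Gamma>\<close> of left cosets.\<close>

definition coset_topology ::
  "('a, 'b) monoid_scheme \<Rightarrow> 'a topology \<Rightarrow> 'a set \<Rightarrow> 'a set topology" where
  "coset_topology G T \<Gamma> =
     topology (\<lambda>U. U \<subseteq> lcosets\<^bsub>G\<^esub> \<Gamma> \<and> openin T {g \<in> carrier G. g <#\<^bsub>G\<^esub> \<Gamma> \<in> U})"

definition lattice_in :: "'a set \<Rightarrow> ('a, 'b) monoid_scheme \<Rightarrow> 'a topology \<Rightarrow> bool" where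
  "lattice_in \<Gamma> G T \<longleftrightarrow> discrete_subgroup \<Gamma> G T \<and> compact_space (coset_topology G T \<Gamma>)"

lemma openin_coset_topology:
  "openin (coset_topology G T \<Gamma>) U \<longleftrightarrow>
     U \<subseteq> lcosets\<^bsub>G\<^esub> \<Gamma> \<and> openin T {g \<in> carrier G. g <#\<^bsub>G\<^esub> \<Gamma> \<in> U}"
proof -
  let ?P = "\<lambda>U. U \<subseteq> lcosets\<^bsub>G\<^esub> \<Gamma> \<and> openin T {g \<in> carrier G. g <#\<^bsub>G\<^esub> \<Gamma> \<in> U}"
  have "istopology ?P"
    unfolding istopology_def
  proof (intro conjI allI impI)
    fix S S' assume "?P S" "?P S'"
    moreover have "{g \<in> carrier G. g <#\<^bsub>G\<^esub> \<Gamma> \<in> S \<inter> S'} =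
        {g \<in> carrier G. g <#\<^bsub>G\<^esub> \<Gamma> \<in> S} \<inter> {g \<in> carrier G. g <#\<^bsub>G\<^esub> \<Gamma> \<in> S'}"
      by blast
    ultimately show "S \<inter> S' \<subseteq> lcosets\<^bsub>G\<^esub> \<Gamma>"
      and "openin T {g \<in> carrier G. g <#\<^bsub>G\<^esub> \<Gamma> \<in> S \<inter> S'}"
      by auto
  next
    fix \<K> assume K: "\<forall>K\<in>\<K>. ?P K"
    then show "\<Union>\<K> \<subseteq> lcosets\<^bsub>G\<^esub> \<Gamma>" by blast
    have "{g \<in> carrier G. g <#\<^bsub>G\<^esub> \<Gamma> \<in> \<Union>\<K>} = (\<Union>K\<in>\<K>. {g \<in> carrier G. g <#\<^bsub>G\<^esub> \<Gamma> \<in> K})"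
      by blast
    moreover have "openin T (\<Union>K\<in>\<K>. {g \<in> carrier G. g <#\<^bsub>G\<^esub> \<Gamma> \<in> K})"
      using K by (intro openin_Union) auto
    ultimately show "openin T {g \<in> carrier G. g <#\<^bsub>G\<^esub> \<Gamma> \<in> \<Union>\<K>}" by (simp only:)
  qed
  then show ?thesis
    unfolding coset_topology_def by (simp add: topology_inverse')
qed

lemma quotient_map_coset_topology:
  assumes "topspace T = carrier G"
  shows "quotient_map T (coset_topology G T \<Gamma>) (\<lambda>g. g <#\<^bsub>G\<^esub> \<Gamma>)"
proof -
  have "{g \<in> carrier G. g <#\<^bsub>G\<^esub> \<Gamma> \<in> lcosets\<^bsub>G\<^esub> \<Gamma>} = topspace T"
    using assms by (auto simp: LCOSETS_def)
  then have "openin (coset_topology G T \<Gamma>) (lcosets\<^bsub>G\<^esub> \<Gamma>)"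
    by (simp add: openin_coset_topology)
  then have "topspace (coset_topology G T \<Gamma>) = lcosets\<^bsub>G\<^esub> \<Gamma>"
    using openin_coset_topology[of G T \<Gamma> "topspace (coset_topology G T \<Gamma>)"]
    by (meson openin_subset openin_topspace subset_antisym)
  then show ?thesis
    using assms by (auto simp: quotient_map_def openin_coset_topology LCOSETS_def)
qed


subsection \<open>Arithmetic subgroups of matrix groups over \<open>\<bbbF>\<^sub>q((t))\<close>\<close>

definition GL :: "('a::semiring_1 ^ 'n ^ 'n) monoid" where
  "GL = \<lparr>carrier = {A. invertible A}, mult = (**), one = mat 1\<rparr>"

text \<open>The subring \<open>\<bbbF>\<^sub>q[t\<^sup>-\<^sup>1]\<close>, as the image of the evaluation of polynomials at \<open>t\<^sup>-\<^sup>1\<close>.\<close>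

definition F_minus :: "'k::field fls set" where
  "F_minus = range (\<lambda>P :: 'k poly. poly (map_poly fls_const P) fls_X_inv)"

definition GL_minus :: "('k::field fls ^ 'n ^ 'n) set" where
  "GL_minus = {A. (\<forall>i j. A $ i $ j \<in> F_minus) \<and>
     (\<exists>B. (\<forall>i j. B $ i $ j \<in> F_minus) \<and> A ** B = mat 1 \<and> B ** A = mat 1)}"

text \<open>Meant for a closed subgroup \<open>G\<close> of \<open>GL\<close>.\<close>

definition arithmetic_in ::
  "('k::field fls ^ 'n ^ 'n) set \<Rightarrow> ('k fls ^ 'n ^ 'n) set \<Rightarrow> bool" where
  "arithmetic_in \<Gamma> G \<longleftrightarrow>
     subgroup \<Gamma> (GL\<lparr>carrier := G\<rparr>) \<and> commensurable GL \<Gamma> (GL_minus \<inter> G)"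


subsection \<open>The group \<open>G\<^sub>2\<close>\<close>

definition G2_elt :: "nat \<Rightarrow> 'k::field fls \<Rightarrow> 'k fls \<Rightarrow> 'k fls ^ 3 ^ 3" where
  "G2_elt r y z = vector [vector [1, y ^ r, z],
                          vector [0, 1, y],
                          vector [0, 0, 1]]"

definition G2 :: "nat \<Rightarrow> ('k::field fls ^ 3 ^ 3) set" where
  "G2 r = {G2_elt r y z | y z. True}"

abbreviation G2_group :: "nat \<Rightarrow> ('k::field fls ^ 3 ^ 3) monoid" where
  "G2_group r \<equiv> GL\<lparr>carrier := G2 r\<rparr>"

text \<open>The topology of \<open>G\<^sub>2\<close> is induced by the product topology on matrices, where
  \<open>\<bbbF>\<^sub>q((t))\<close> carries the library's \<open>t\<close>-adic metric.\<close>

abbreviation G2_topology :: "nat \<Rightarrow> ('k::field fls ^ 3 ^ 3) topology" where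
  "G2_topology r \<equiv> top_of_set (G2 r)"

lemma G2_elt_mult:
  assumes "(y + y') ^ r = y ^ r + y' ^ r"
  shows "G2_elt r y z ** G2_elt r y' z' = G2_elt r (y + y') (z + z' + y ^ r * y')"
  using assms
  by (simp add: G2_elt_def matrix_matrix_mult_def vec_eq_iff forall_3 sum_3 algebra_simps)

lemma group_GL: "group (GL :: ('a::semiring_1 ^ 'n ^ 'n) monoid)"
proof (rule groupI)
  fix A assume "A \<in> carrier (GL :: ('a ^ 'n ^ 'n) monoid)"
  then obtain B :: "'a ^ 'n ^ 'n" where "A ** B = mat 1" "B ** A = mat 1"
    by (auto simp: GL_def invertible_def)
  then show "\<exists>B\<in>carrier GL. B \<otimes>\<^bsub>GL\<^esub> A = \<one>\<^bsub>GL\<^esub>"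
    by (auto simp: GL_def invertible_def)
next
  fix A B assume "A \<in> carrier (GL :: ('a ^ 'n ^ 'n) monoid)" "B \<in> carrier (GL :: ('a ^ 'n ^ 'n) monoid)"
  then obtain A' B' :: "'a ^ 'n ^ 'n"
    where "A ** A' = mat 1" "A' ** A = mat 1" "B ** B' = mat 1" "B' ** B = mat 1"
    by (auto simp: GL_def invertible_def)
  then have "(A ** B) ** (B' ** A') = mat 1" "(B' ** A') ** (A ** B) = mat 1"
    by (metis matrix_mul_assoc matrix_mul_rid)+
  then show "A \<otimes>\<^bsub>GL\<^esub> B \<in> carrier GL"
    by (auto simp: GL_def invertible_def)
qed (auto simp: GL_def matrix_mul_assoc invertible_def)

lemma subgroup_G2:
  assumes p: "prime p" and q: "CARD('k::{field,finite}) = p ^ m" and r: "r = p ^ s"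
  shows "subgroup (G2 r) (GL :: ('k fls ^ 3 ^ 3) monoid)"
proof -
  have "prime CHAR('k)"
    by (simp add: finite_imp_CHAR_pos prime_CHAR_semidom)
  moreover have "CHAR('k) dvd p ^ m"
    using CHAR_dvd_CARD[where ?'a = 'k] q by simp
  ultimately have k: "CHAR('k) = p"
    using p by (meson prime_dvd_power primes_dvd_imp_eq)
  have "CHAR('k fls) = p"
  proof (rule CHAR_eqI)
    have *: "of_nat n = (0 :: 'k fls) \<longleftrightarrow> of_nat n = (0 :: 'k)" for n
      by (simp add: fls_of_nat)
    show "of_nat p = (0 :: 'k fls)" using k by (simp add: * of_nat_eq_0_iff_char_dvd)
    show "p dvd n" if "of_nat n = (0 :: 'k fls)" for n
      using that k by (simp add: * of_nat_eq_0_iff_char_dvd)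
  qed
  then have add: "(y + z) ^ r = y ^ r + z ^ r" for y z :: "'k fls"
    using p r by (intro freshmans_dream') auto
  have r0: "r > 0" using p r by (simp add: prime_gt_0_nat)
  have one: "mat 1 = G2_elt r 0 (0 :: 'k fls)"
    using r0 by (simp add: G2_elt_def mat_def vec_eq_iff forall_3)
  have inv: "\<exists>y' z'. G2_elt r y z ** G2_elt r y' z' = mat 1 \<and>
      G2_elt r y' z' ** G2_elt r y z = mat 1" for y z :: "'k fls"
  proof (intro exI conjI)
    have n: "(- y) ^ r + y ^ r = 0" using add[of "- y" y] r0 by (simp add: zero_power)
    then have n': "(- y) ^ r * y = - (y ^ r * y)"
      by (simp add: add_eq_0_iff2)
    show "G2_elt r y z ** G2_elt r (- y) (- z + y ^ r * y) = mat 1"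
      by (simp add: G2_elt_mult[OF add] one)
    show "G2_elt r (- y) (- z + y ^ r * y) ** G2_elt r y z = mat 1"
      by (simp add: G2_elt_mult[OF add] one n')
  qed
  interpret GL: group "GL :: ('k fls ^ 3 ^ 3) monoid" by (rule group_GL)
  have sub: "G2 r \<subseteq> carrier (GL :: ('k fls ^ 3 ^ 3) monoid)"
    using inv by (fastforce simp: G2_def GL_def invertible_def)
  show ?thesis
  proof (rule GL.subgroupI[OF sub])
    show "G2 r \<noteq> ({} :: ('k fls ^ 3 ^ 3) set)" by (auto simp: G2_def)
  next
    fix A :: "'k fls ^ 3 ^ 3" assume A: "A \<in> G2 r"
    then obtain B where B: "B \<in> G2 r" "B ** A = mat 1"
      using inv by (fastforce simp: G2_def)
    then have "inv\<^bsub>GL\<^esub> A = B"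
      using A sub by (intro GL.inv_equality) (auto simp: GL_def)
    with B show "inv\<^bsub>GL\<^esub> A \<in> G2 r" by simp
  next
    fix A B :: "'k fls ^ 3 ^ 3" assume "A \<in> G2 r" "B \<in> G2 r"
    then show "A \<otimes>\<^bsub>GL\<^esub> B \<in> G2 r"
      by (auto simp: G2_def GL_def G2_elt_mult[OF add]) blast
  qed
qed

end

theory Submission
  imports Defs
begin

text \<open>
  Write \<open>x = t\<^sup>-\<^sup>1\<close>, \<open>A = \<bbbF>\<^sub>q[x] = F\<^sup>-\<close> and \<open>K = \<bbbF>\<^sub>q(x)\<close>. An element of \<open>G\<^sub>2\<close> is a pair \<open>(y, z)\<close> with
  \<open>(y, z) (y', z') = (y + y', z + z' + y\<^sup>r y')\<close>, and the commutator of two elements is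
  \<open>(0, [y, y'])\<close> with \<open>[y, y'] = y\<^sup>r y' - y y'\<^sup>r\<close>. An arithmetic group is commensurable with \<open>G\<^sub>2(A)\<close>,
  so a virtual automorphism restricts to an isomorphism \<open>\<phi>\<close> between two finite-index subgroups of
  \<open>G\<^sub>2(A)\<close> (\<open>commensurable_restriction\<close>). What has to be shown is that \<open>\<phi>\<close>, after one more
  restriction, is given by a formula that makes sense on \<open>G\<^sub>2\<close>.

  If \<open>r = 1\<close>, the group \<open>G\<^sub>2\<close> is commutative and is the direct product of the discrete group
  \<open>G\<^sub>2(A)\<close> and the compact open group of pairs with entries in \<open>t\<bbbF>\<^sub>q[[t]]\<close>. Then \<open>\<phi>\<close> extends by
  the identity on the second factor (\<open>commutative_isomorphism_extends\<close>).

  Let \<open>r > 1\<close>. The centre of a finite-index subgroup is its set of elements with \<open>y = 0\<close>, so \<open>\<phi>\<close>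
  induces an additive bijection \<open>T : V\<^sub>1 \<rightarrow> V\<^sub>2\<close> between finite-index subgroups of \<open>A\<close>, and
  \<open>[v, v'] = [w, w']\<close> holds if and only if \<open>[T v, T v'] = [T w, T w']\<close>. These coincidences contain
  the multiplication of \<open>K\<close>:

  \<^item> For given nonzero \<open>v\<close>, \<open>w\<close> there are infinitely many coincidences \<open>[v, v'] = [w, w']\<close> if and
    only if \<open>v / w\<close> is an \<open>r\<close>-th power in \<open>K\<close> (\<open>infinite_coincidences_iff\<close>). Hence \<open>T\<close> maps lines
    to lines, for the structure of \<open>K\<close> as a vector space over its subfield \<open>K\<^sup>r\<close> of \<open>r\<close>-th powers.
    As \<open>T\<close> is additive and \<open>K \<noteq> K\<^sup>r\<close>, it is semilinear over \<open>K\<^sup>r\<close>, just as in the fundamental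
    theorem of projective geometry.
  \<^item> If \<open>v = k\<^sup>r w\<close>, the coincidences \<open>[v, v'] = [w, w']\<close> can be written down explicitly. That \<open>T\<close>
    preserves them says that \<open>T\<close> is compatible with multiplication by certain elements of \<open>K\<close> which,
    together with \<open>K\<^sup>r\<close>, generate \<open>K\<close>. So \<open>T v = \<tau>(v) a\<close> for a field homomorphism \<open>\<tau>\<close> of
    \<open>K\<close> and a constant \<open>a\<close> (\<open>T_is_semilinear\<close>).
  \<^item> Since \<open>A\<close> is integrally closed and \<open>V\<^sub>1\<close>, \<open>V\<^sub>2\<close> have finite index, \<open>\<tau>\<close> restricts to an automorphism
    of the ring \<open>A\<close> (\<open>commutator_isomorphism_is_ring_automorphism\<close>). Therefore it preserves degrees and
    extends to a continuous automorphism \<open>\<Phi>\<close> of \<open>F\<close>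
    (\<open>ring_automorphism_extends_to_Laurent_series\<close>).

  Comparing \<open>\<phi>\<close> with \<open>(y, z) \<mapsto> (a \<Phi>(y), a\<^sup>r\<^sup>+\<^sup>1 \<Phi>(z))\<close> leaves a homomorphism into \<open>F\<close> that kills all
  commutators. The commutators generate a subgroup of finite index in the centre, because
  \<open>[x\<^sup>r w, v] - [w, x v] = (x ^ (r * r) - x) w\<^sup>r v\<close>. So after a last restriction the
  homomorphism is an additive function \<open>h(y)\<close> of \<open>y\<close> (\<open>structure_of_isomorphism\<close>), and
  \<open>(y, z) \<mapsto> (a \<Phi>(y), a\<^sup>r\<^sup>+\<^sup>1 \<Phi>(z) + h(y))\<close>, with \<open>h\<close> evaluated at the polynomial part of \<open>y\<close>, is
  the required virtual automorphism of \<open>G\<^sub>2\<close> (\<open>semilinear_map_is_virtual_automorphism\<close>).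
\<close>

(* The names and the dollar sign are wanted for univariate polynomials and for matrix entries. *)
hide_const (open) UnivPoly.coeff UnivPoly.monom UnivPoly.deg
no_notation fps_nth (infixl \<open>$\<close> 75)

section \<open>Additive maps that preserve lines and commutators\<close>

text \<open>
  The upper right entry of the commutator of two elements of \<open>G\<^sub>2\<close>, as a function of their entries
  \<open>y\<close>.
\<close>
definition G2_commutator :: "nat \<Rightarrow> 'a::comm_ring_1 \<Rightarrow> 'a \<Rightarrow> 'a" where
  "G2_commutator r v w = v ^ r * w - v * w ^ r"

text \<open>
  In a field, and with \<open>\<theta> = (k v' - w') / w\<close>, the right-hand side says that
  \<open>k ^ (r * r) v' - w' = \<theta>\<^sup>r w\<close>. Once \<open>\<theta>\<close> is prescribed, this and \<open>k v' - w' = \<theta> w\<close> are two linear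
  equations for \<open>v'\<close> and \<open>w'\<close>, so \<open>\<theta>\<close> parametrises the coincidences.
\<close>
lemma commutator_coincidence_iff:
  fixes k w v' w' :: "'a::comm_ring_1"
  assumes "\<And>x y :: 'a. (x - y) ^ r = x ^ r - y ^ r"
  shows "G2_commutator r (k ^ r * w) v' = G2_commutator r w w' \<longleftrightarrow>
    w ^ r * (k ^ (r * r) * v' - w') = w * (k * v' - w') ^ r"
  by (auto simp: G2_commutator_def assms algebra_simps power_mult_distrib power_mult)

text \<open>
  In the application the field is \<open>K = \<bbbF>\<^sub>q(x)\<close> and \<open>V\<close> is a finite-index subgroup of \<open>\<bbbF>\<^sub>q[x]\<close>, of which only
  the absorption property is kept. A line is a set \<open>K\<^sup>r w\<close>. The assumption \<open>imperfect\<close> provides two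
  different lines, and \<open>large\<close> excludes the case that \<open>K\<close> is contained in the field with \<open>r * r\<close> elements,
  where the denominators of the explicit coincidences vanish.
\<close>
locale line_preserving_map =
  fixes V :: "'a::field set" and T :: "'a \<Rightarrow> 'a" and r :: nat
  assumes frobenius: "(x + y :: 'a) ^ r = x ^ r + y ^ r"
    and r_pos: "0 < r"
    and V_add: "v \<in> V \<Longrightarrow> w \<in> V \<Longrightarrow> v + w \<in> V"
    and V_absorbing: "finite Y \<Longrightarrow> \<exists>b. b \<noteq> 0 \<and> (\<forall>y\<in>Y. b ^ r * y \<in> V)"
    and T_add: "v \<in> V \<Longrightarrow> w \<in> V \<Longrightarrow> T (v + w) = T v + T w"
    and T_nonzero: "v \<in> V \<Longrightarrow> v \<noteq> 0 \<Longrightarrow> T v \<noteq> 0"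
    and T_lines: "v \<in> V \<Longrightarrow> w \<in> V \<Longrightarrow> v \<noteq> 0 \<Longrightarrow> w \<noteq> 0 \<Longrightarrow>
      (\<exists>k. T v = k ^ r * T w) \<longleftrightarrow> (\<exists>k. v = k ^ r * w)"
    and T_commutator: "v \<in> V \<Longrightarrow> v' \<in> V \<Longrightarrow> w \<in> V \<Longrightarrow> w' \<in> V \<Longrightarrow>
      G2_commutator r v v' = G2_commutator r w w' \<Longrightarrow>
      G2_commutator r (T v) (T v') = G2_commutator r (T w) (T w')"
    and imperfect: "\<exists>x. \<forall>k. x \<noteq> (k::'a) ^ r"
    and large: "\<exists>k::'a. k ^ (r * r) \<noteq> k"
begin

lemma power_r_eq_iff: "x ^ r = y ^ r \<longleftrightarrow> x = (y::'a)"
proof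
  assume "x ^ r = y ^ r"
  moreover have "x ^ r = (x - y) ^ r + y ^ r" by (simp flip: frobenius)
  ultimately show "x = y" using r_pos by simp
qed simp

lemma frobenius_diff: "(x - y :: 'a) ^ r = x ^ r - y ^ r"
  using frobenius[of "x - y" y] by (simp add: algebra_simps)

lemma zero_in_V: "0 \<in> V"
  using V_absorbing[of "{0}"] by auto

lemma T_zero: "T 0 = 0"
  using T_add[OF zero_in_V zero_in_V] by (metis add_cancel_left_left add_0)

text \<open>
  The set \<open>V\<close> need not be closed under multiplication by \<open>k\<^sup>r\<close>, so scalars are tested only where the
  product stays in \<open>V\<close>.
\<close>
definition scales_by :: "'a \<Rightarrow> 'a \<Rightarrow> bool" where
  "scales_by k \<kappa> \<longleftrightarrow> (\<forall>w\<in>V. k ^ r * w \<in> V \<longrightarrow> T (k ^ r * w) = \<kappa> ^ r * T w)"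

lemma scalar_on_one_line:
  assumes "w \<in> V" "k ^ r * w \<in> V" "w \<noteq> 0"
  obtains \<kappa> where "T (k ^ r * w) = \<kappa> ^ r * T w"
proof (cases "k = 0")
  case True
  then show ?thesis using that[of 0] r_pos T_zero by (simp add: power_0_left)
next
  case False
  then show ?thesis using T_lines[of "k ^ r * w" w] assms that by auto
qed

text \<open>
  The argument of the fundamental theorem of projective geometry: the scalar on the line of
  \<open>w\<^sub>1 + w\<^sub>2\<close> has to agree with those on both summands, since \<open>T w\<^sub>1\<close> and \<open>T w\<^sub>2\<close> are independent.
\<close>
lemma scalars_agree_on_independent_lines:
  assumes w: "w\<^sub>1 \<in> V" "k ^ r * w\<^sub>1 \<in> V" "w\<^sub>1 \<noteq> 0" "w\<^sub>2 \<in> V" "k ^ r * w\<^sub>2 \<in> V" "w\<^sub>2 \<noteq> 0"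
    and indep: "\<nexists>c. w\<^sub>1 = c ^ r * w\<^sub>2"
    and T1: "T (k ^ r * w\<^sub>1) = \<kappa>\<^sub>1 ^ r * T w\<^sub>1" and T2: "T (k ^ r * w\<^sub>2) = \<kappa>\<^sub>2 ^ r * T w\<^sub>2"
  shows "\<kappa>\<^sub>1 = \<kappa>\<^sub>2"
proof -
  have nz: "w\<^sub>1 + w\<^sub>2 \<noteq> 0"
  proof
    assume *: "w\<^sub>1 + w\<^sub>2 = 0"
    have "(-1 :: 'a) ^ r = -1"
      using frobenius[of 1 "-1"] r_pos by (simp add: power_0_left add_eq_0_iff)
    moreover have "w\<^sub>1 = - w\<^sub>2" using * by (simp only: eq_neg_iff_add_eq_0)
    ultimately have "w\<^sub>1 = (-1) ^ r * w\<^sub>2" by simp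
    then show False using indep by blast
  qed
  obtain \<kappa>\<^sub>3 where T3: "T (k ^ r * (w\<^sub>1 + w\<^sub>2)) = \<kappa>\<^sub>3 ^ r * T (w\<^sub>1 + w\<^sub>2)"
    using scalar_on_one_line[of "w\<^sub>1 + w\<^sub>2" k] w V_add nz by (metis distrib_left)
  have "\<kappa>\<^sub>1 ^ r * T w\<^sub>1 + \<kappa>\<^sub>2 ^ r * T w\<^sub>2 = \<kappa>\<^sub>3 ^ r * (T w\<^sub>1 + T w\<^sub>2)"
    using T1 T2 T3 T_add w by (metis distrib_left)
  then have eq: "(\<kappa>\<^sub>1 - \<kappa>\<^sub>3) ^ r * T w\<^sub>1 = (\<kappa>\<^sub>3 - \<kappa>\<^sub>2) ^ r * T w\<^sub>2"
    by (simp add: frobenius_diff algebra_simps)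
  have "\<kappa>\<^sub>1 = \<kappa>\<^sub>3"
  proof (rule ccontr)
    assume "\<kappa>\<^sub>1 \<noteq> \<kappa>\<^sub>3"
    then have "T w\<^sub>1 = ((\<kappa>\<^sub>3 - \<kappa>\<^sub>2) / (\<kappa>\<^sub>1 - \<kappa>\<^sub>3)) ^ r * T w\<^sub>2"
      using eq by (simp add: power_divide field_simps)
    then show False using T_lines[of w\<^sub>1 w\<^sub>2] w indep by blast
  qed
  moreover from this have "\<kappa>\<^sub>3 = \<kappa>\<^sub>2" using eq r_pos T_nonzero[of w\<^sub>2] w by (simp add: zero_power)
  ultimately show ?thesis by simp
qed

lemma exists_independent:
  assumes "w \<noteq> 0"
  obtains u where "u \<in> V" "k ^ r * u \<in> V" "u \<noteq> 0" "\<nexists>c. w = c ^ r * u"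
proof -
  obtain x where x: "\<forall>c. x \<noteq> (c::'a) ^ r" using imperfect by blast
  then have x0: "x \<noteq> 0" using r_pos by (metis power_0_left less_irrefl)
  obtain b where b: "b \<noteq> 0" "\<forall>y\<in>{w * x, k ^ r * (w * x)}. b ^ r * y \<in> V"
    using V_absorbing[of "{w * x, k ^ r * (w * x)}"] by auto
  show ?thesis
  proof (rule that[of "b ^ r * (w * x)"])
    show "k ^ r * (b ^ r * (w * x)) \<in> V" using b by (simp add: ac_simps)
    show "\<nexists>c. w = c ^ r * (b ^ r * (w * x))"
    proof
      assume "\<exists>c. w = c ^ r * (b ^ r * (w * x))"
      then obtain c where c: "w = c ^ r * (b ^ r * (w * x))" by blast
      then have "w * ((c * b) ^ r * x) = w * 1" by (simp add: power_mult_distrib ac_simps)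
      then have "(c * b) ^ r * x = 1" using assms by simp
      then have "x = inverse ((c * b) ^ r)" by (metis inverse_unique)
      then have "x = (inverse (c * b)) ^ r" by (simp only: power_inverse)
      then show False using x by blast
    qed
  qed (use b x0 assms in auto)
qed

text \<open>
  Elements of one line are compared through a third element off that line.
\<close>
lemma scales_by_exists: "\<exists>\<kappa>. scales_by k \<kappa>"
proof -
  obtain u where u: "u \<in> V" "k ^ r * u \<in> V" "u \<noteq> 0"
    by (metis exists_independent one_neq_zero)
  then obtain \<kappa> where \<kappa>: "T (k ^ r * u) = \<kappa> ^ r * T u" using scalar_on_one_line by blast
  have "T (k ^ r * w) = \<kappa> ^ r * T w" if w: "w \<in> V" "k ^ r * w \<in> V" for w
  proof (cases "w = 0")
    case True
    then show ?thesis by (simp add: T_zero)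
  next
    case False
    then obtain \<kappa>' where \<kappa>': "T (k ^ r * w) = \<kappa>' ^ r * T w" using scalar_on_one_line w by blast
    show ?thesis
    proof (cases "\<exists>c. w = c ^ r * u")
      case True
      obtain e where e: "e \<in> V" "k ^ r * e \<in> V" "e \<noteq> 0" "\<nexists>c. u = c ^ r * e"
        by (rule exists_independent[OF u(3)])
      obtain \<kappa>'' where \<kappa>'': "T (k ^ r * e) = \<kappa>'' ^ r * T e" using scalar_on_one_line e by blast
      have "\<nexists>c. w = c ^ r * e"
      proof
        assume "\<exists>c. w = c ^ r * e"
        then obtain c d where cd: "w = c ^ r * e" "w = d ^ r * u" using True by blast
        then have "d \<noteq> 0" using False r_pos by (auto simp: zero_power)
        with cd have "u = (c / d) ^ r * e" using False by (auto simp: power_divide field_simps)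
        then show False using e by blast
      qed
      then have "\<kappa>' = \<kappa>''" "\<kappa> = \<kappa>''"
        using scalars_agree_on_independent_lines[OF w False e(1-3) _ \<kappa>' \<kappa>'']
          scalars_agree_on_independent_lines[OF u e \<kappa> \<kappa>''] by blast+
      then show ?thesis using \<kappa>' by simp
    next
      case indep: False
      then have "\<kappa>' = \<kappa>"
        using scalars_agree_on_independent_lines[OF w False u _ \<kappa>' \<kappa>] by blast
      then show ?thesis using \<kappa>' by simp
    qed
  qed
  then show ?thesis unfolding scales_by_def by blast
qed

definition \<tau> :: "'a \<Rightarrow> 'a" where "\<tau> k = (SOME \<kappa>. scales_by k \<kappa>)"

lemma T_scale: "w \<in> V \<Longrightarrow> k ^ r * w \<in> V \<Longrightarrow> T (k ^ r * w) = \<tau> k ^ r * T w"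
  using someI_ex[OF scales_by_exists[of k]] unfolding \<tau>_def scales_by_def by blast

lemma \<tau>_eqI:
  assumes "w \<in> V" "k ^ r * w \<in> V" "w \<noteq> 0" "T (k ^ r * w) = \<kappa> ^ r * T w"
  shows "\<tau> k = \<kappa>"
  using T_scale[of w k] assms T_nonzero power_r_eq_iff by auto

lemma \<tau>_0: "\<tau> 0 = 0" and \<tau>_1: "\<tau> 1 = 1"
proof -
  obtain w where "w \<in> V" "w \<noteq> 0" by (metis exists_independent one_neq_zero)
  then show "\<tau> 0 = 0" "\<tau> 1 = 1"
    by (auto intro!: \<tau>_eqI[of w] simp: zero_power[OF r_pos] T_zero zero_in_V)
qed

lemma \<tau>_mult: "\<tau> (k * l) = \<tau> k * \<tau> l"
proof -
  obtain b where b: "b \<noteq> 0" "\<forall>y\<in>{1, l ^ r, (k * l) ^ r}. b ^ r * y \<in> V"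
    using V_absorbing[of "{1, l ^ r, (k * l) ^ r}"] by auto
  then have w: "b ^ r \<in> V" "l ^ r * b ^ r \<in> V" "k ^ r * (l ^ r * b ^ r) \<in> V" "b ^ r \<noteq> 0"
    by (auto simp: ac_simps power_mult_distrib)
  have "T ((k * l) ^ r * b ^ r) = (\<tau> k * \<tau> l) ^ r * T (b ^ r)"
    using T_scale[OF w(2,3)] T_scale[OF w(1,2)] by (simp add: ac_simps power_mult_distrib)
  then show ?thesis using w by (intro \<tau>_eqI[of "b ^ r"]) (auto simp: ac_simps power_mult_distrib)
qed

lemma \<tau>_add: "\<tau> (k + l) = \<tau> k + \<tau> l"
proof -
  obtain b where b: "b \<noteq> 0" "\<forall>y\<in>{1, k ^ r, l ^ r}. b ^ r * y \<in> V"
    using V_absorbing[of "{1, k ^ r, l ^ r}"] by auto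
  then have w: "b ^ r \<in> V" "k ^ r * b ^ r \<in> V" "l ^ r * b ^ r \<in> V" "b ^ r \<noteq> 0"
    by (auto simp: ac_simps)
  have eq: "(k + l) ^ r * b ^ r = k ^ r * b ^ r + l ^ r * b ^ r"
    by (simp add: frobenius algebra_simps)
  show ?thesis
    using w V_add T_add T_scale[OF w(1,2)] T_scale[OF w(1,3)]
    by (intro \<tau>_eqI[of "b ^ r"]) (auto simp: eq frobenius algebra_simps)
qed

lemma \<tau>_nonzero: "k \<noteq> 0 \<Longrightarrow> \<tau> k \<noteq> 0"
  using \<tau>_mult[of k "inverse k"] \<tau>_1 by auto

lemma \<tau>_minus: "\<tau> (- k) = - \<tau> k"
  using \<tau>_add[of k "- k"] \<tau>_0 by (simp add: add_eq_0_iff)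

lemma \<tau>_diff: "\<tau> (k - l) = \<tau> k - \<tau> l"
  using \<tau>_add[of k "- l"] by (simp add: \<tau>_minus)

lemma \<tau>_power: "\<tau> (k ^ n) = \<tau> k ^ n"
  by (induction n) (auto simp: \<tau>_1 \<tau>_mult)

lemma \<tau>_inverse: "\<tau> (inverse k) = inverse (\<tau> k)"
proof (cases "k = 0")
  case False
  then have "\<tau> k * \<tau> (inverse k) = 1" using \<tau>_mult[of k "inverse k"] \<tau>_1 by simp
  then show ?thesis by (metis inverse_unique)
qed (simp add: \<tau>_0)

text \<open>
  The extension of \<open>T\<close> to the whole field, by clearing denominators with \<open>r\<close>-th powers.
\<close>
definition ext :: "'a \<Rightarrow> 'a" where
  "ext y = (let b = SOME b. b \<noteq> 0 \<and> b ^ r * y \<in> V in T (b ^ r * y) / \<tau> b ^ r)"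

lemma ext_eq:
  assumes b: "b \<noteq> 0" "b ^ r * y \<in> V"
  shows "ext y = T (b ^ r * y) / \<tau> b ^ r"
proof -
  define c where "c = (SOME b. b \<noteq> 0 \<and> b ^ r * y \<in> V)"
  have c: "c \<noteq> 0" "c ^ r * y \<in> V"
    using someI_ex[of "\<lambda>b. b \<noteq> 0 \<and> b ^ r * y \<in> V"] b unfolding c_def by blast+
  have eq: "(c / b) ^ r * (b ^ r * y) = c ^ r * y" using b by (simp add: power_divide field_simps)
  then have "T (c ^ r * y) = \<tau> (c / b) ^ r * T (b ^ r * y)"
    using T_scale[of "b ^ r * y" "c / b"] b c unfolding eq by blast
  moreover have "\<tau> c = \<tau> (c / b) * \<tau> b" using b by (simp flip: \<tau>_mult)
  ultimately show ?thesis
    using \<tau>_nonzero b c unfolding ext_def Let_def c_def[symmetric]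
    by (simp add: field_simps power_mult_distrib)
qed

lemma ext_on_V: "v \<in> V \<Longrightarrow> ext v = T v"
  using ext_eq[of 1 v] by (simp add: \<tau>_1)

lemma ext_add: "ext (x + y) = ext x + ext y"
proof -
  obtain b where b: "b \<noteq> 0" "b ^ r * x \<in> V" "b ^ r * y \<in> V"
    using V_absorbing[of "{x, y}"] by auto
  then have "b ^ r * (x + y) \<in> V" "T (b ^ r * (x + y)) = T (b ^ r * x) + T (b ^ r * y)"
    using V_add T_add by (auto simp: distrib_left)
  then show ?thesis using b by (simp add: ext_eq add_divide_distrib)
qed

lemma ext_zero: "ext 0 = 0"
  using ext_on_V[OF zero_in_V] T_zero by simp

lemma ext_minus: "ext (- x) = - ext x"
  using ext_add[of x "- x"] ext_zero by (simp add: add_eq_0_iff)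

lemma ext_diff: "ext (x - y) = ext x - ext y"
  using ext_add[of x "- y"] by (simp add: ext_minus)

lemma ext_scale: "ext (k ^ r * y) = \<tau> k ^ r * ext y"
proof -
  obtain b where b: "b \<noteq> 0" "b ^ r * y \<in> V" "b ^ r * (k ^ r * y) \<in> V"
    using V_absorbing[of "{y, k ^ r * y}"] by auto
  then have "T (b ^ r * (k ^ r * y)) = \<tau> k ^ r * T (b ^ r * y)"
    using T_scale[of "b ^ r * y" k] by (simp add: ac_simps)
  then show ?thesis using b by (simp add: ext_eq)
qed

lemma ext_nonzero: "y \<noteq> 0 \<Longrightarrow> ext y \<noteq> 0"
proof -
  assume "y \<noteq> 0"
  moreover obtain b where b: "b \<noteq> 0" "b ^ r * y \<in> V"
    using V_absorbing[of "{y}"] by auto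
  ultimately show ?thesis using T_nonzero[OF b(2)] \<tau>_nonzero[OF b(1)] by (simp add: ext_eq[OF b])
qed

lemma commutator_scale: "G2_commutator r (c * v) (c * w) = c ^ Suc r * G2_commutator r v w"
  by (simp add: G2_commutator_def algebra_simps power_mult_distrib)

lemma ext_commutator:
  assumes "G2_commutator r v v' = G2_commutator r w w'"
  shows "G2_commutator r (ext v) (ext v') = G2_commutator r (ext w) (ext w')"
proof -
  obtain b where b: "b \<noteq> 0" "b ^ r * v \<in> V" "b ^ r * v' \<in> V" "b ^ r * w \<in> V" "b ^ r * w' \<in> V"
    using V_absorbing[of "{v, v', w, w'}"] by auto
  have T: "T (b ^ r * u) = \<tau> b ^ r * ext u" if "b ^ r * u \<in> V" for u
    using ext_on_V[OF that] ext_scale by simp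
  have "G2_commutator r (T (b ^ r * v)) (T (b ^ r * v')) =
      G2_commutator r (T (b ^ r * w)) (T (b ^ r * w'))"
    using b assms by (intro T_commutator) (auto simp: commutator_scale)
  then show ?thesis
    using b \<tau>_nonzero[of b] by (simp add: T commutator_scale)
qed

text \<open>
  The multiple \<open>v'\<close> of \<open>w\<close> is the first component of the solution of \<open>[k\<^sup>r w, v'] = [w, w']\<close> with
  parameter \<open>\<theta>\<close>. On \<open>k ^ (r * r) v' - w' = \<theta>\<^sup>r w\<close> the map is understood, because it is semilinear over \<open>r\<close>-th
  powers. The image coincidence therefore determines the \<open>r\<close>-th power of \<open>\<tau>(k) ext v' - ext w'\<close>, hence
  this element itself, and then \<open>ext v'\<close>.
\<close>
lemma ext_special_multiple:
  assumes k: "k ^ (r * r) \<noteq> k"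
  shows "ext ((\<theta> - \<theta> ^ r) / (k - k ^ (r * r)) * w) =
    (\<tau> \<theta> - \<tau> \<theta> ^ r) / (\<tau> k - \<tau> k ^ (r * r)) * ext w"
proof (cases "w = 0")
  case True
  then show ?thesis by (simp add: ext_zero)
next
  case False
  define v' where "v' = (\<theta> - \<theta> ^ r) / (k - k ^ (r * r)) * w"
  define w' where "w' = k * v' - \<theta> * w"
  have v': "(k - k ^ (r * r)) * v' = (\<theta> - \<theta> ^ r) * w"
    using k by (simp add: v'_def)
  then have w': "k ^ (r * r) * v' - w' = \<theta> ^ r * w"
    by (simp add: w'_def algebra_simps)
  note key = commutator_coincidence_iff[of r, OF frobenius_diff]
  have "G2_commutator r (k ^ r * w) v' = G2_commutator r w w'"
    unfolding key w' by (simp add: w'_def power_mult_distrib)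
  then have "G2_commutator r (\<tau> k ^ r * ext w) (ext v') = G2_commutator r (ext w) (ext w')"
    using ext_commutator ext_scale by metis
  then have "ext w ^ r * (\<tau> k ^ (r * r) * ext v' - ext w') = ext w * (\<tau> k * ext v' - ext w') ^ r"
    unfolding key .
  moreover have E: "\<tau> k ^ (r * r) * ext v' - ext w' = \<tau> \<theta> ^ r * ext w"
    using arg_cong[OF w', of ext] ext_scale[of "k ^ r" v']
    by (simp add: ext_diff ext_scale power_mult \<tau>_power)
  ultimately have "(\<tau> k * ext v' - ext w') ^ r = (\<tau> \<theta> * ext w) ^ r"
    using ext_nonzero[OF False] by (simp add: power_mult_distrib ac_simps)
  then have "\<tau> k * ext v' - ext w' = \<tau> \<theta> * ext w" by (simp add: power_r_eq_iff)
  with E have "(\<tau> k - \<tau> k ^ (r * r)) * ext v' = (\<tau> \<theta> - \<tau> \<theta> ^ r) * ext w"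
    by (simp add: algebra_simps)
  moreover have "\<tau> k - \<tau> k ^ (r * r) \<noteq> 0"
    using \<tau>_nonzero[of "k - k ^ (r * r)"] k by (simp add: \<tau>_diff \<tau>_power)
  ultimately show ?thesis unfolding v'_def[symmetric] by (simp add: field_simps)
qed

text \<open>
  With \<open>E = 1 / (k - k ^ (r * r))\<close>, the map is compatible with multiplication by \<open>(\<theta> - \<theta>\<^sup>r) E\<close> for all
  \<open>\<theta>\<close>. If \<open>\<theta>\<close> is an \<open>r\<close>-th power, so is \<open>\<theta> - \<theta>\<^sup>r\<close>; it can be divided out, which leaves \<open>E\<close>.
  For arbitrary \<open>\<theta>\<close> the term \<open>\<theta>\<^sup>r E\<close> is then known as well, which leaves \<open>\<theta> E\<close>; and every element
  of the field has this form.
\<close>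
lemma ext_multiplicative: "ext (y * w) = \<tau> y * ext w"
proof -
  obtain k where k: "k ^ (r * r) \<noteq> (k::'a)" using large by blast
  define E where "E = 1 / (k - k ^ (r * r))"
  have \<tau>E: "\<tau> E = 1 / (\<tau> k - \<tau> k ^ (r * r))"
    by (simp add: E_def divide_inverse \<tau>_inverse \<tau>_diff \<tau>_power)
  have special: "ext ((\<theta> * E - \<theta> ^ r * E) * w) = (\<tau> \<theta> - \<tau> \<theta> ^ r) * \<tau> E * ext w" for \<theta> w
  proof -
    have "\<theta> * E - \<theta> ^ r * E = (\<theta> - \<theta> ^ r) / (k - k ^ (r * r))"
      by (simp add: E_def diff_divide_distrib)
    then show ?thesis using ext_special_multiple[OF k, of \<theta> w] by (simp add: \<tau>E)
  qed
  have E: "ext (E * w) = \<tau> E * ext w" for w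
  proof -
    have k': "k \<noteq> k ^ r" using k by (metis power_mult)
    have "ext ((k ^ r - k ^ (r * r)) * E * w) = (\<tau> k ^ r - \<tau> k ^ (r * r)) * \<tau> E * ext w"
      using special[of "k ^ r" w] by (simp add: \<tau>_power power_mult algebra_simps)
    moreover have "ext ((k - k ^ r) ^ r * (E * w)) = (\<tau> k - \<tau> k ^ r) ^ r * ext (E * w)"
      by (simp add: ext_scale \<tau>_diff \<tau>_power)
    moreover have "(k - k ^ r) ^ r * (E * w) = (k ^ r - k ^ (r * r)) * E * w"
      by (simp add: frobenius_diff power_mult)
    moreover have "(\<tau> k - \<tau> k ^ r) ^ r = \<tau> k ^ r - \<tau> k ^ (r * r)"
      by (simp add: frobenius_diff power_mult)
    moreover have "\<tau> k ^ r - \<tau> k ^ (r * r) \<noteq> 0"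
      using \<tau>_nonzero[of "(k - k ^ r) ^ r"] k' power_r_eq_iff[of k "k ^ r"]
      by (simp add: \<tau>_power \<tau>_diff frobenius_diff power_mult)
    ultimately show ?thesis by (simp add: mult.assoc)
  qed
  have *: "ext (\<theta> * E * w) = \<tau> \<theta> * \<tau> E * ext w" for \<theta>
  proof -
    have "ext (\<theta> * E * w) - ext (\<theta> ^ r * (E * w)) = (\<tau> \<theta> - \<tau> \<theta> ^ r) * \<tau> E * ext w"
      using special[of \<theta> w] by (simp add: ext_diff[symmetric] algebra_simps)
    moreover have "ext (\<theta> ^ r * (E * w)) = \<tau> \<theta> ^ r * (\<tau> E * ext w)"
      by (simp only: ext_scale E)
    ultimately show ?thesis by (simp add: algebra_simps)
  qed
  have "E \<noteq> 0" using k by (simp add: E_def)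
  then show ?thesis
    using *[of "y / E"] \<tau>_mult[of "y / E" E] by simp
qed

theorem T_is_semilinear: "v \<in> V \<Longrightarrow> T v = \<tau> v * ext 1"
  using ext_multiplicative[of v 1] ext_on_V by simp

end

section \<open>Additive subgroups of finite index\<close>

definition finite_index_add :: "'a::ab_group_add set \<Rightarrow> bool" where
  "finite_index_add V \<longleftrightarrow> 0 \<in> V \<and> (\<forall>x\<in>V. \<forall>y\<in>V. x - y \<in> V) \<and>
     (\<exists>S. finite S \<and> (\<forall>x. \<exists>s\<in>S. x - s \<in> V))"

lemma finite_index_add_diff: "finite_index_add V \<Longrightarrow> x \<in> V \<Longrightarrow> y \<in> V \<Longrightarrow> x - y \<in> V"
  and finite_index_add_zero: "finite_index_add V \<Longrightarrow> 0 \<in> V"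
  by (auto simp: finite_index_add_def)

lemma finite_index_add_minus: "finite_index_add V \<Longrightarrow> x \<in> V \<Longrightarrow> - x \<in> V"
  using finite_index_add_diff[of V 0 x] finite_index_add_zero by force

lemma finite_index_add_add: "finite_index_add V \<Longrightarrow> x \<in> V \<Longrightarrow> y \<in> V \<Longrightarrow> x + y \<in> V"
  using finite_index_add_diff[of V x "- y"] finite_index_add_minus[of V y] by simp

lemma finite_index_add_UNIV: "finite_index_add UNIV"
  unfolding finite_index_add_def by (auto intro!: exI[of _ "{0}"])

text \<open>
  Finite index is witnessed by a colouring with finitely many colours such that elements of one
  colour differ by an element of the subgroup. Intersections and preimages are then obtained by
  combining colourings.
\<close>
lemma finite_index_addI:
  assumes "0 \<in> V" "\<And>x y. x \<in> V \<Longrightarrow> y \<in> V \<Longrightarrow> x - y \<in> V"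
    and fin: "finite (range c)" and c: "\<And>x y. c x = c y \<Longrightarrow> x - y \<in> V"
  shows "finite_index_add V"
proof -
  define S where "S = (\<lambda>d. SOME y. c y = d) ` range c"
  have "x - (SOME y. c y = c x) \<in> V" for x
    by (rule c) (metis (mono_tags, lifting) someI)
  then have "\<exists>s\<in>S. x - s \<in> V" for x
    unfolding S_def by blast
  moreover have "finite S" using fin by (simp add: S_def)
  ultimately show ?thesis using assms(1,2) unfolding finite_index_add_def by blast
qed

lemma finite_index_addE:
  fixes V :: "'a::ab_group_add set"
  assumes V: "finite_index_add V"
  obtains c :: "'a \<Rightarrow> 'a" where "finite (range c)" "\<And>x y. c x = c y \<Longrightarrow> x - y \<in> V"
proof -
  obtain S where S: "finite S" "\<forall>x. \<exists>s\<in>S. x - s \<in> V"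
    using V unfolding finite_index_add_def by blast
  then obtain c where c: "\<forall>x. c x \<in> S \<and> x - c x \<in> V" by metis
  show ?thesis
  proof (rule that[of c])
    show "finite (range c)" using c S(1) by (meson finite_subset image_subsetI)
    show "x - y \<in> V" if "c x = c y" for x y
    proof -
      have "(x - c x) - (y - c y) \<in> V" using finite_index_add_diff[OF V] c by blast
      then show ?thesis using that by simp
    qed
  qed
qed

lemma finite_index_add_Int:
  fixes V W :: "'a::ab_group_add set"
  assumes "finite_index_add V" "finite_index_add W"
  shows "finite_index_add (V \<inter> W)"
proof -
  obtain c :: "'a \<Rightarrow> 'a" where c: "finite (range c)" "\<And>x y. c x = c y \<Longrightarrow> x - y \<in> V"
    using finite_index_addE[OF assms(1)] by blast
  obtain d :: "'a \<Rightarrow> 'a" where d: "finite (range d)" "\<And>x y. d x = d y \<Longrightarrow> x - y \<in> W"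
    using finite_index_addE[OF assms(2)] by blast
  show ?thesis
  proof (rule finite_index_addI[where c = "\<lambda>x. (c x, d x)"])
    show "finite (range (\<lambda>x. (c x, d x)))"
      by (rule finite_subset[of _ "range c \<times> range d"]) (use c d in auto)
  qed (use assms c d finite_index_add_diff finite_index_add_zero in auto)
qed

lemma finite_index_add_vimage:
  fixes V :: "'a::ab_group_add set" and g :: "'b::ab_group_add \<Rightarrow> 'a"
  assumes V: "finite_index_add V" and g: "\<And>x y. g (x - y) = g x - g y"
  shows "finite_index_add {x. g x \<in> V}"
proof -
  obtain c :: "'a \<Rightarrow> 'a" where c: "finite (range c)" "\<And>x y. c x = c y \<Longrightarrow> x - y \<in> V"
    using finite_index_addE[OF V] by blast
  have "g 0 = 0" using g[of 0 0] by simp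
  then show ?thesis
    using c V finite_index_add_diff finite_index_add_zero
    by (intro finite_index_addI[where c = "\<lambda>x. c (g x)"])
      (auto simp: g intro: finite_subset[of _ "range c"])
qed

lemma finite_index_add_infinite:
  fixes V :: "'a::ab_group_add set"
  assumes V: "finite_index_add V" and inf: "infinite (UNIV :: 'a set)"
  shows "infinite V"
proof
  assume "finite V"
  obtain S where S: "finite S" "\<forall>x. \<exists>s\<in>S. x - s \<in> V"
    using V unfolding finite_index_add_def by blast
  have "UNIV \<subseteq> (\<lambda>(s, v). s + v) ` (S \<times> V)"
  proof
    fix x :: 'a
    obtain s where "s \<in> S" "x - s \<in> V" using S by blast
    then show "x \<in> (\<lambda>(s, v). s + v) ` (S \<times> V)"
      by (intro image_eqI[of _ _ "(s, x - s)"]) auto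
  qed
  then show False using inf \<open>finite V\<close> S(1) by (meson finite_SigmaI finite_imageI finite_subset)
qed

text \<open>
  Used to place several multiples of one unknown in \<open>V\<close> simultaneously; since there are infinitely
  many solutions, one of them is nonzero.
\<close>
lemma finite_index_add_common_element:
  fixes V :: "'a::ab_group_add set" and g :: "'i \<Rightarrow> 'b::ab_group_add \<Rightarrow> 'a"
  assumes V: "finite_index_add V" and inf: "infinite (UNIV :: 'b set)" and "finite I"
    and g: "\<And>i x y. i \<in> I \<Longrightarrow> g i (x - y) = g i x - g i y"
  shows "infinite {x. \<forall>i\<in>I. g i x \<in> V}"
proof -
  have "finite_index_add {x. \<forall>i\<in>I. g i x \<in> V}"
    using \<open>finite I\<close> g
  proof (induction I rule: finite_induct)
    case empty
    then show ?case using finite_index_add_UNIV by simp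
  next
    case (insert i I)
    then have "finite_index_add ({x. g i x \<in> V} \<inter> {x. \<forall>i\<in>I. g i x \<in> V})"
      by (intro finite_index_add_Int finite_index_add_vimage V) auto
    moreover have "{x. g i x \<in> V} \<inter> {x. \<forall>i\<in>I. g i x \<in> V} = {x. \<forall>i\<in>insert i I. g i x \<in> V}" by auto
    ultimately show ?case by simp
  qed
  then show ?thesis using inf by (rule finite_index_add_infinite)
qed

lemma finite_polys_bounded_degree: "finite {p :: 'k::{field,finite} poly. degree p \<le> n}"
proof (rule finite_subset)
  show "{p :: 'k poly. degree p \<le> n} \<subseteq> Poly ` {xs. set xs \<subseteq> UNIV \<and> length xs = Suc n}"
  proof
    fix p :: "'k poly" assume "p \<in> {p. degree p \<le> n}"
    then have "Poly (map (coeff p) [0..<Suc n]) = p"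
      by (intro poly_eqI) (auto simp: coeff_Poly_eq nth_default_def coeff_eq_0 simp del: upt_Suc)
    then show "p \<in> Poly ` {xs. set xs \<subseteq> UNIV \<and> length xs = Suc n}"
      by (intro image_eqI[of _ _ "map (coeff p) [0..<Suc n]"]) auto
  qed
  show "finite (Poly ` {xs :: 'k list. set xs \<subseteq> UNIV \<and> length xs = Suc n})"
    by (intro finite_imageI finite_lists_length_eq) auto
qed

section \<open>Coincidences of commutators of polynomials\<close>

locale frobenius_power =
  fixes k_type :: "'k::{field,finite} itself" and r s :: nat
  assumes r_def: "r = CHAR('k) ^ s" and s_pos: "0 < s"
begin

lemma prime_char: "prime CHAR('k)"
  by (simp add: finite_imp_CHAR_pos prime_CHAR_semidom)

lemma r_ge_2: "2 \<le> r"
proof -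
  have "2 \<le> CHAR('k)" using prime_char by (rule prime_ge_2_nat)
  also have "\<dots> \<le> r" using s_pos prime_char unfolding r_def by (metis One_nat_def Suc_leI power_increasing power_one_right prime_ge_1_nat)
  finally show ?thesis .
qed

lemma frob_add: "(x + y :: 'k poly) ^ r = x ^ r + y ^ r"
  using prime_char by (intro freshmans_dream'[where n = s]) (auto simp: r_def)

lemma frob_diff: "(x - y :: 'k poly) ^ r = x ^ r - y ^ r"
  using frob_add[of "x - y" y] by simp

lemma root_exists: "\<exists>d. d ^ r = (c :: 'k)"
proof -
  have add: "(x + y :: 'k) ^ r = x ^ r + y ^ r" for x y
    using prime_char by (intro freshmans_dream'[where n = s]) (auto simp: r_def)
  have "inj (\<lambda>d :: 'k. d ^ r)"
  proof (rule injI)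
    fix x y :: 'k assume "x ^ r = y ^ r"
    then have "(x - y) ^ r = 0" using add[of "x - y" y] by simp
    then show "x = y" by simp
  qed
  then have "surj (\<lambda>d :: 'k. d ^ r)" by (intro finite_UNIV_inj_surj) auto
  then show ?thesis by (metis surjD)
qed

lemma coeff_power_r:
  "coeff (p ^ r) n = (if r dvd n then coeff (p :: 'k poly) (n div r) ^ r else 0)"
proof (induction p arbitrary: n)
  case 0
  then show ?case using r_ge_2 by (simp add: power_0_left)
next
  case (pCons a p)
  have "pCons a p ^ r = ([:a:] + monom 1 1 * p) ^ r" by (simp add: monom_altdef)
  also have "\<dots> = [:a ^ r:] + monom 1 r * p ^ r"
    by (simp add: frob_add power_mult_distrib monom_power poly_const_pow)
  finally have eq: "coeff (pCons a p ^ r) n =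
      coeff [:a ^ r:] n + (if n < r then 0 else coeff (p ^ r) (n - r))"
    by (simp add: coeff_monom_mult)
  show ?case
  proof (cases "n < r")
    case True
    then show ?thesis unfolding eq by (cases n) (auto dest: dvd_imp_le)
  next
    case False
    then have "n div r = Suc ((n - r) div r)" "r dvd n \<longleftrightarrow> r dvd (n - r)"
      using r_ge_2 by (auto simp: le_div_geq intro: dvd_diff_nat dest: dvd_diffD)
    then show ?thesis using False r_ge_2 unfolding eq pCons.IH by (cases n) auto
  qed
qed

text \<open>
  Every coefficient is an \<open>r\<close>-th power, so \<open>1, x, \<dots>, x\<^sup>r\<^sup>-\<^sup>1\<close> is a basis of \<open>\<bbbF>\<^sub>q[x]\<close> over the subring of
  \<open>r\<close>-th powers.
\<close>
lemma poly_decomposition: "\<exists>\<alpha>. p = (\<Sum>i<r. \<alpha> i ^ r * monom 1 i :: 'k poly)"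
proof (induction p)
  case 0
  then show ?case using r_ge_2 by (intro exI[of _ "\<lambda>_. 0"]) (simp add: power_0_left)
next
  case (pCons a p)
  then obtain \<alpha> where \<alpha>: "p = (\<Sum>i<r. \<alpha> i ^ r * monom 1 i)" by blast
  obtain d where d: "d ^ r = a" using root_exists by blast
  obtain r' where r': "r = Suc r'" using r_ge_2 by (cases r) auto
  \<comment> \<open>Multiplication by \<open>x\<close> shifts the basis; the last basis element wraps around to \<open>x\<^sup>r\<close>.\<close>
  define \<beta> where "\<beta> i = (case i of 0 \<Rightarrow> [:d:] + monom 1 1 * \<alpha> r' | Suc j \<Rightarrow> \<alpha> j)" for i
  have "(\<Sum>i<r. \<beta> i ^ r * monom 1 i) = \<beta> 0 ^ r + (\<Sum>i<r'. \<alpha> i ^ r * monom 1 (Suc i))"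
    by (simp add: r' sum.lessThan_Suc_shift \<beta>_def del: sum.lessThan_Suc)
  also have "\<beta> 0 ^ r = [:a:] + monom 1 r * \<alpha> r' ^ r"
    by (simp add: \<beta>_def frob_add power_mult_distrib monom_power poly_const_pow d)
  also have "[:a:] + monom 1 r * \<alpha> r' ^ r + (\<Sum>i<r'. \<alpha> i ^ r * monom 1 (Suc i)) =
      [:a:] + (\<Sum>i<r. \<alpha> i ^ r * monom 1 (Suc i))"
    by (simp add: r' ac_simps)
  also have "(\<Sum>i<r. \<alpha> i ^ r * monom 1 (Suc i)) = monom 1 1 * p"
    unfolding \<alpha> sum_distrib_left
    by (intro sum.cong) (simp_all add: mult.left_commute[of "monom 1 (Suc 0)"] mult_monom)
  also have "[:a:] + monom 1 1 * p = pCons a p" by (simp add: monom_altdef)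
  finally show ?case by metis
qed

text \<open>
  The degrees of the nonzero summands are distinct modulo \<open>r\<close>, so no leading terms cancel.
\<close>
lemma degree_component_le:
  assumes i: "i < r"
  shows "r * degree (\<gamma> i) \<le> degree (\<Sum>j<r. \<gamma> j ^ r * monom 1 j :: 'k poly)"
proof (cases "\<gamma> i = 0")
  case False
  let ?n = "r * degree (\<gamma> i) + i"
  have "coeff (\<gamma> j ^ r * monom 1 j) ?n = (if j = i then lead_coeff (\<gamma> i) ^ r else 0)" if "j < r" for j
  proof -
    have *: "coeff (\<gamma> j ^ r * monom 1 j) ?n = (if ?n < j then 0 else coeff (\<gamma> j ^ r) (?n - j))"
      by (simp add: mult.commute[of _ "monom 1 j"] coeff_monom_mult)
    have "j = i" if "\<not> ?n < j" "r dvd ?n - j"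
    proof -
      have "?n mod r = j mod r" using that by (metis mod_eq_dvd_iff_nat not_less)
      then show ?thesis using i \<open>j < r\<close> by simp
    qed
    then show ?thesis using r_ge_2 by (auto simp: * coeff_power_r)
  qed
  then have "coeff (\<Sum>j<r. \<gamma> j ^ r * monom 1 j) ?n = lead_coeff (\<gamma> i) ^ r"
    using i by (simp add: coeff_sum)
  then have "?n \<le> degree (\<Sum>j<r. \<gamma> j ^ r * monom 1 j)"
    using False by (intro le_degree) auto
  then show ?thesis by simp
qed simp

definition coincidences :: "'k poly set \<Rightarrow> 'k poly \<Rightarrow> 'k poly \<Rightarrow> ('k poly \<times> 'k poly) set" where
  "coincidences V v w = {(v', w'). v' \<in> V \<and> w' \<in> V \<and> G2_commutator r v v' = G2_commutator r w w'}"

text \<open>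
  A coincidence says that \<open>v v'\<^sup>r - w w'\<^sup>r = v\<^sup>r v' - w\<^sup>r w'\<close>. The right-hand side grows linearly with the
  degrees of \<open>v'\<close> and \<open>w'\<close>. In the basis of \<open>poly_decomposition\<close>, the left-hand side has the components
  \<open>(\<alpha>\<^sub>l v' - \<beta>\<^sub>l w')\<^sup>r\<close>; if \<open>v\<close> and \<open>w\<close> are independent over \<open>r\<close>-th powers, two of these linear forms are
  independent, and the left-hand side grows \<open>r\<close> times as fast. This bounds the degrees.
\<close>
lemma finite_coincidences:
  assumes v: "v \<noteq> 0" and w: "w \<noteq> 0" and indep: "\<And>a b. a \<noteq> 0 \<Longrightarrow> b \<noteq> 0 \<Longrightarrow> a ^ r * v \<noteq> b ^ r * w"
  shows "finite (coincidences V v w)"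
proof -
  obtain \<alpha> where \<alpha>: "v = (\<Sum>i<r. \<alpha> i ^ r * monom 1 i)" using poly_decomposition by blast
  obtain \<beta> where \<beta>: "w = (\<Sum>i<r. \<beta> i ^ r * monom 1 i)" using poly_decomposition by blast
  have "\<exists>i<r. \<exists>j<r. \<alpha> i * \<beta> j \<noteq> \<alpha> j * \<beta> i"
  proof (rule ccontr)
    assume "\<not> ?thesis"
    then have *: "\<alpha> i * \<beta> j = \<alpha> j * \<beta> i" if "i < r" "j < r" for i j using that by blast
    have "\<exists>j<r. \<beta> j \<noteq> 0"
    proof (rule ccontr)
      assume "\<not> ?thesis"
      then have "w = 0" unfolding \<beta> using r_ge_2 by (intro sum.neutral) (auto simp: power_0_left)
      with w show False by simp
    qed
    then obtain j where j: "j < r" "\<beta> j \<noteq> 0" by blast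
    have eq: "\<beta> j ^ r * v = \<alpha> j ^ r * w"
    proof -
      have "\<beta> j ^ r * v = (\<Sum>i<r. (\<alpha> i * \<beta> j) ^ r * monom 1 i)"
        by (simp add: \<alpha> sum_distrib_left power_mult_distrib ac_simps)
      also have "\<dots> = (\<Sum>i<r. (\<alpha> j * \<beta> i) ^ r * monom 1 i)"
        using * j by (intro sum.cong) auto
      also have "\<dots> = \<alpha> j ^ r * w"
        by (simp add: \<beta> sum_distrib_left power_mult_distrib ac_simps)
      finally show ?thesis .
    qed
    moreover have "\<alpha> j \<noteq> 0"
    proof
      assume "\<alpha> j = 0"
      then show False using eq j v r_ge_2 by (simp add: power_0_left)
    qed
    ultimately show False using indep j by blast
  qed
  then obtain i j where ij: "i < r" "j < r" "\<alpha> i * \<beta> j \<noteq> \<alpha> j * \<beta> i" by blast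
  \<comment> \<open>The determinant by which Cramer's rule recovers \<open>v'\<close> and \<open>w'\<close> from \<open>\<gamma> i\<close> and \<open>\<gamma> j\<close>.\<close>
  define \<delta> where "\<delta> = \<alpha> i * \<beta> j - \<alpha> j * \<beta> i"
  have \<delta>: "\<delta> \<noteq> 0" using ij by (simp add: \<delta>_def)
  define C where "C = max (degree (v ^ r)) (degree (w ^ r))"
  define B where "B = max (max (degree (\<alpha> i)) (degree (\<alpha> j))) (max (degree (\<beta> i)) (degree (\<beta> j)))"
  have bound: "degree v' \<le> 2 * B + C \<and> degree w' \<le> 2 * B + C"
    if "G2_commutator r v v' = G2_commutator r w w'" for v' w'
  proof -
    define M where "M = max (degree v') (degree w')"
    define \<gamma> where "\<gamma> l = \<alpha> l * v' - \<beta> l * w'" for l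
    have "(\<Sum>l<r. \<gamma> l ^ r * monom 1 l) = v * v' ^ r - w * w' ^ r"
      by (simp add: \<gamma>_def \<alpha> \<beta> frob_diff power_mult_distrib sum_subtractf sum_distrib_left algebra_simps)
    also have "\<dots> = v ^ r * v' - w ^ r * w'"
      using that by (simp add: G2_commutator_def algebra_simps)
    also have "degree \<dots> \<le> C + M"
    proof (rule degree_diff_le)
      show "degree (v ^ r * v') \<le> C + M" "degree (w ^ r * w') \<le> C + M"
        by (auto intro!: order_trans[OF degree_mult_le] add_mono simp: C_def M_def)
    qed
    finally have "degree (\<Sum>l<r. \<gamma> l ^ r * monom 1 l) \<le> C + M" .
    then have "2 * degree (\<gamma> l) \<le> C + M" if "l < r" for l
      using degree_component_le[OF that, of \<gamma>] mult_le_mono1[OF r_ge_2, of "degree (\<gamma> l)"] by linarith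
    then have \<gamma>: "2 * degree (\<gamma> i) \<le> C + M" "2 * degree (\<gamma> j) \<le> C + M" using ij by blast+
    have le: "2 * degree u \<le> 2 * B + (C + M)"
      if "\<delta> * u = x * \<gamma> i - y * \<gamma> j" "degree x \<le> B" "degree y \<le> B" for u x y
    proof (cases "u = 0")
      case False
      have "degree u \<le> degree (\<delta> * u)" using False \<delta> by (simp add: degree_mult_eq)
      also have "\<dots> \<le> max (degree (x * \<gamma> i)) (degree (y * \<gamma> j))"
        unfolding that(1) by (rule degree_diff_le_max)
      also have "2 * \<dots> \<le> 2 * B + (C + M)"
        using degree_mult_le[of x "\<gamma> i"] degree_mult_le[of y "\<gamma> j"] that(2,3) \<gamma> by linarith
      finally show ?thesis by simp
    qed simp
    have "2 * degree v' \<le> 2 * B + (C + M)"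
      by (rule le[of _ "\<beta> j" "\<beta> i"]) (auto simp: \<delta>_def \<gamma>_def B_def algebra_simps)
    moreover have "2 * degree w' \<le> 2 * B + (C + M)"
      by (rule le[of _ "\<alpha> j" "\<alpha> i"]) (auto simp: \<delta>_def \<gamma>_def B_def algebra_simps)
    ultimately show ?thesis unfolding M_def by linarith
  qed
  show ?thesis
    by (rule finite_subset[of _ "{p. degree p \<le> 2 * B + C} \<times> {p. degree p \<le> 2 * B + C}"])
      (use bound finite_polys_bounded_degree in \<open>auto simp: coincidences_def\<close>)
qed

end

lemma to_fract_power: "to_fract (p ^ n) = to_fract p ^ n"
  by (induction n) auto

lemma fract_common_denominator:
  fixes Y :: "'a::idom fract set"
  assumes "finite Y"
  shows "\<exists>d. d \<noteq> 0 \<and> (\<forall>y\<in>Y. to_fract d * y \<in> range to_fract)"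
  using assms
proof (induction Y rule: finite_induct)
  case empty
  then show ?case by (intro exI[of _ 1]) simp
next
  case (insert y Y)
  then obtain d where d: "d \<noteq> 0" "\<forall>y\<in>Y. to_fract d * y \<in> range to_fract" by blast
  obtain a b where y: "y = Fract a b" "b \<noteq> 0" by (cases y) auto
  have "to_fract (b * d) * y = to_fract (d * a)" using y by (simp add: Fract_conv_to_fract)
  then have "to_fract (b * d) * y \<in> range to_fract" by (metis rangeI)
  moreover have "to_fract (b * d) * u \<in> range to_fract" if "u \<in> Y" for u
  proof -
    have "to_fract d * u \<in> range to_fract" using d(2) that by (rule bspec)
    then obtain c where "to_fract d * u = to_fract c" by auto
    then have "to_fract (b * d) * u = to_fract (b * c)" by (simp add: mult.assoc)
    then show ?thesis by (metis rangeI)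
  qed
  ultimately have "\<forall>u\<in>insert y Y. to_fract (b * d) * u \<in> range to_fract" by blast
  then show ?case using d y by (intro exI[of _ "b * d"]) (simp del: to_fract_mult)
qed

lemma infinite_UNIV_poly: "infinite (UNIV :: 'a::zero_neq_one poly set)"
proof -
  have "inj (monom (1::'a))" by (intro injI) (simp add: monom_eq_iff')
  then show ?thesis by (metis finite_imageD finite_subset infinite_UNIV_nat subset_UNIV)
qed

context frobenius_power begin

lemma r_pos: "0 < r" using r_ge_2 by simp

text \<open>
  If \<open>a\<^sup>r v = b\<^sup>r w\<close>, the substitution \<open>v' = a u\<close>, \<open>w' = b u - \<theta> w\<close> turns the coincidence into
  \<open>D u = w\<^sup>r\<^sup>+\<^sup>1 (\<theta>\<^sup>r - \<theta>)\<close>. This has a solution \<open>u\<close> for every multiple \<open>\<theta>\<close> of \<open>D\<close> if \<open>D \<noteq> 0\<close>, and for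
  \<open>\<theta> = 0\<close> every \<open>u\<close> is a solution if \<open>D = 0\<close>. In both cases the solutions depend additively on a
  parameter that ranges over all polynomials, so infinitely many lie in \<open>V\<close>.
\<close>
lemma infinite_coincidences:
  assumes V: "finite_index_add V" and v: "v \<noteq> 0" and w: "w \<noteq> 0"
    and a: "a \<noteq> 0" and b: "b \<noteq> 0" and dep: "a ^ r * v = b ^ r * w"
  shows "infinite (coincidences V v w)"
proof -
  define D where "D = a * v ^ r - b * w ^ r"
  have solution: "G2_commutator r v (a * u) = G2_commutator r w (b * u - \<theta> * w)"
    if "D * u = w ^ Suc r * (\<theta> ^ r - \<theta>)" for u \<theta>
  proof -
    have "v * (a * u) ^ r = (a ^ r * v) * u ^ r" by (simp add: power_mult_distrib)
    also have "\<dots> = (b ^ r * w) * u ^ r" by (simp only: dep)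
    also have "\<dots> = w * (b * u) ^ r" by (simp add: power_mult_distrib)
    finally have key: "v * (a * u) ^ r = w * (b * u) ^ r" .
    have "G2_commutator r v (a * u) - G2_commutator r w (b * u - \<theta> * w) =
        v ^ r * (a * u) - v * (a * u) ^ r - (w ^ r * (b * u - \<theta> * w) - w * ((b * u) ^ r - (\<theta> * w) ^ r))"
      by (simp only: G2_commutator_def frob_diff)
    also have "\<dots> = v ^ r * (a * u) - w * (b * u) ^ r -
        (w ^ r * (b * u - \<theta> * w) - w * ((b * u) ^ r - (\<theta> * w) ^ r))"
      by (simp only: key)
    also have "\<dots> = D * u - w ^ Suc r * (\<theta> ^ r - \<theta>)"
      by (simp add: D_def algebra_simps power_mult_distrib)
    finally show ?thesis using that by simp
  qed
  \<comment> \<open>The parametrised families of solutions in the two cases.\<close>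
  obtain u \<theta> :: "'k poly \<Rightarrow> 'k poly" where
    add: "\<And>x y. u (x - y) = u x - u y" "\<And>x y. \<theta> (x - y) = \<theta> x - \<theta> y"
    and eq: "\<And>x. D * u x = w ^ Suc r * (\<theta> x ^ r - \<theta> x)"
    and inj: "\<And>x y. u x = u y \<Longrightarrow> \<theta> x = \<theta> y \<Longrightarrow> x = y"
  proof (cases "D = 0")
    case True
    then show ?thesis using that[of "\<lambda>x. x" "\<lambda>_. 0"] r_pos by (simp add: zero_power)
  next
    case False
    have *: "D * (w ^ Suc r * (D ^ (r - 1) * x ^ r - x)) = w ^ Suc r * ((D * x) ^ r - D * x)" for x
      using r_pos by (cases r) (simp_all add: algebra_simps power_mult_distrib)
    show ?thesis
    proof (rule that[of "\<lambda>x. w ^ Suc r * (D ^ (r - 1) * x ^ r - x)" "\<lambda>x. D * x"])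
      show "w ^ Suc r * (D ^ (r - 1) * (x - y) ^ r - (x - y)) =
          w ^ Suc r * (D ^ (r - 1) * x ^ r - x) - w ^ Suc r * (D ^ (r - 1) * y ^ r - y)" for x y
        by (simp only: frob_diff) (simp only: algebra_simps)
      show "x = y" if "D * x = D * y" for x y using that False by simp
    qed (use * in \<open>simp_all add: right_diff_distrib\<close>)
  qed
  \<comment> \<open>Both components of the solution, indexed by a truth value.\<close>
  define g where "g i x = (if i then a * u x else b * u x - \<theta> x * w)" for i x
  define Z where "Z = {x. \<forall>i\<in>UNIV. g i x \<in> V}"
  have "infinite Z"
    unfolding Z_def using V infinite_UNIV_poly
    by (rule finite_index_add_common_element) (auto simp: g_def add algebra_simps)
  moreover have "inj_on (\<lambda>x. (g True x, g False x)) Z"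
  proof (rule inj_onI)
    fix x y assume "(g True x, g False x) = (g True y, g False y)"
    then have "u x = u y" "\<theta> x = \<theta> y" using a w by (auto simp: g_def)
    then show "x = y" by (rule inj)
  qed
  ultimately have "infinite ((\<lambda>x. (g True x, g False x)) ` Z)" by (simp add: finite_image_iff)
  moreover have "(\<lambda>x. (g True x, g False x)) ` Z \<subseteq> coincidences V v w"
    using solution[OF eq] by (auto simp: coincidences_def Z_def g_def UNIV_bool)
  ultimately show ?thesis using infinite_super by blast
qed

lemma line_iff:
  fixes v w :: "'k poly"
  assumes "v \<noteq> 0" "w \<noteq> 0"
  shows "(\<exists>k. to_fract v = k ^ r * to_fract w) \<longleftrightarrow> (\<exists>a b. a \<noteq> 0 \<and> b \<noteq> 0 \<and> a ^ r * v = b ^ r * w)"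
proof
  assume "\<exists>k. to_fract v = k ^ r * to_fract w"
  then obtain k where k: "to_fract v = k ^ r * to_fract w" by blast
  obtain b a where ab: "k = Fract b a" "a \<noteq> 0" by (cases k) auto
  then have "to_fract (a ^ r * v) = to_fract (b ^ r * w)"
    using k by (simp add: Fract_conv_to_fract power_divide to_fract_power)
  then have eq: "a ^ r * v = b ^ r * w" by (simp only: to_fract_eq_iff)
  moreover have "b \<noteq> 0" using eq ab assms r_pos by (auto simp: zero_power)
  ultimately show "\<exists>a b. a \<noteq> 0 \<and> b \<noteq> 0 \<and> a ^ r * v = b ^ r * w" using ab by blast
next
  assume "\<exists>a b. a \<noteq> 0 \<and> b \<noteq> 0 \<and> a ^ r * v = b ^ r * w"
  then obtain a b where ab: "a \<noteq> 0" "b \<noteq> 0" "a ^ r * v = b ^ r * w" by blast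
  then have "to_fract a ^ r * to_fract v = to_fract b ^ r * to_fract w"
    by (metis to_fract_mult to_fract_power)
  then have "to_fract v = (to_fract b / to_fract a) ^ r * to_fract w"
    using ab by (simp add: power_divide field_simps)
  then show "\<exists>k. to_fract v = k ^ r * to_fract w" by blast
qed

text \<open>
  Whether two polynomials lie on one line can be read off from the commutator relations.
\<close>
lemma infinite_coincidences_iff:
  assumes "finite_index_add V" "v \<noteq> 0" "w \<noteq> 0"
  shows "infinite (coincidences V v w) \<longleftrightarrow> (\<exists>k. to_fract v = k ^ r * to_fract w)"
  unfolding line_iff[OF assms(2,3)]
proof
  assume inf: "infinite (coincidences V v w)"
  show "\<exists>a b. a \<noteq> 0 \<and> b \<noteq> 0 \<and> a ^ r * v = b ^ r * w"
  proof (rule ccontr)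
    assume *: "\<not> ?thesis"
    have "a ^ r * v \<noteq> b ^ r * w" if "a \<noteq> 0" "b \<noteq> 0" for a b using * that by blast
    then show False using finite_coincidences[OF assms(2,3)] inf by blast
  qed
next
  assume "\<exists>a b. a \<noteq> 0 \<and> b \<noteq> 0 \<and> a ^ r * v = b ^ r * w"
  then obtain a b where "a \<noteq> 0" "b \<noteq> 0" "a ^ r * v = b ^ r * w" by blast
  then show "infinite (coincidences V v w)" by (rule infinite_coincidences[OF assms])
qed

lemma fract_frob_add: "(x + y :: 'k poly fract) ^ r = x ^ r + y ^ r"
proof -
  obtain d where d: "d \<noteq> 0" "\<forall>z\<in>{x, y}. to_fract d * z \<in> range to_fract"
    using fract_common_denominator[of "{x, y}"] by auto
  then obtain a b where ab: "to_fract d * x = to_fract a" "to_fract d * y = to_fract b" by auto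
  have "to_fract d ^ r * (x + y) ^ r = to_fract (a + b) ^ r"
    by (simp add: ab[symmetric] algebra_simps flip: power_mult_distrib)
  also have "\<dots> = to_fract a ^ r + to_fract b ^ r"
    by (metis frob_add to_fract_add to_fract_power)
  also have "\<dots> = to_fract d ^ r * (x ^ r + y ^ r)"
    by (simp add: ab[symmetric] algebra_simps power_mult_distrib)
  finally show ?thesis using d by simp
qed

lemma X_not_power: "to_fract (monom (1::'k) 1) \<noteq> k ^ r"
proof
  assume *: "to_fract (monom (1::'k) 1) = k ^ r"
  obtain b a where ab: "k = Fract b a" "a \<noteq> 0" by (cases k) auto
  then have "to_fract (a ^ r * monom 1 1) = to_fract (b ^ r)"
    using * by (simp add: Fract_conv_to_fract power_divide to_fract_power)
  then have eq: "a ^ r * monom 1 1 = b ^ r" by (simp only: to_fract_eq_iff)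
  then have "b \<noteq> 0" using ab r_pos by (auto simp: zero_power)
  then have "r * degree a + 1 = r * degree b"
    using arg_cong[OF eq, of degree] ab by (simp add: degree_mult_eq degree_power_eq degree_monom_eq)
  then have "r dvd 1" by (metis dvd_add_right_iff dvd_triv_left)
  then show False using r_ge_2 by simp
qed

lemma fract_absorbing:
  assumes V: "finite_index_add (V :: 'k poly set)" and Y: "finite Y"
  shows "\<exists>b. b \<noteq> 0 \<and> (\<forall>y\<in>Y. b ^ r * y \<in> to_fract ` V)"
proof -
  obtain d where d: "d \<noteq> 0" "\<forall>y\<in>Y. to_fract d * y \<in> range to_fract"
    using fract_common_denominator[OF Y] by blast
  then obtain n where n: "\<And>y. y \<in> Y \<Longrightarrow> to_fract d * y = to_fract (n y)"
    unfolding image_iff by metis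
  define g where "g y \<eta> = \<eta> ^ r * (d ^ (r - 1) * n y)" for y \<eta>
  have "infinite {\<eta>. \<forall>y\<in>Y. g y \<eta> \<in> V}"
    using V infinite_UNIV_poly Y
    by (rule finite_index_add_common_element) (simp add: g_def frob_diff algebra_simps)
  then have "\<not> {\<eta>. \<forall>y\<in>Y. g y \<eta> \<in> V} \<subseteq> {0}" by (meson finite.emptyI finite.insertI finite_subset)
  then obtain \<eta> where \<eta>: "\<eta> \<noteq> 0" "\<forall>y\<in>Y. g y \<eta> \<in> V" by blast
  have "to_fract (d * \<eta>) ^ r * y = to_fract (g y \<eta>)" if "y \<in> Y" for y
  proof -
    have "to_fract (g y \<eta>) = to_fract \<eta> ^ r * (to_fract d ^ (r - 1) * (to_fract d * y))"
      using n[OF that] by (simp add: g_def to_fract_power)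
    also have "\<dots> = to_fract (d * \<eta>) ^ r * y"
      using r_pos by (cases r) (simp_all add: power_mult_distrib ac_simps)
    finally show ?thesis by simp
  qed
  then show ?thesis using d \<eta> by (intro exI[of _ "to_fract (d * \<eta>)"]) auto
qed

section \<open>Rigidity over the polynomial ring\<close>

text \<open>
  What an isomorphism between finite-index subgroups of \<open>G\<^sub>2(\<bbbF>\<^sub>q[x])\<close> induces modulo the centres.
\<close>
definition commutator_isomorphism where
  "commutator_isomorphism V W (T :: 'k poly \<Rightarrow> 'k poly) \<longleftrightarrow>
     finite_index_add V \<and> finite_index_add W \<and> bij_betw T V W \<and>
     (\<forall>v\<in>V. \<forall>w\<in>V. T (v + w) = T v + T w) \<and>
     (\<forall>v\<in>V. \<forall>v'\<in>V. \<forall>w\<in>V. \<forall>w'\<in>V.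
        G2_commutator r (T v) (T v') = G2_commutator r (T w) (T w') \<longleftrightarrow>
        G2_commutator r v v' = G2_commutator r w w')"

lemma commutator_isomorphism_inverse:
  assumes "commutator_isomorphism V W T"
  shows "commutator_isomorphism W V (inv_into V T)"
proof -
  have T: "finite_index_add V" "finite_index_add W" "bij_betw T V W"
    "\<And>v w. v \<in> V \<Longrightarrow> w \<in> V \<Longrightarrow> T (v + w) = T v + T w"
    "\<And>v v' w w'. v \<in> V \<Longrightarrow> v' \<in> V \<Longrightarrow> w \<in> V \<Longrightarrow> w' \<in> V \<Longrightarrow>
      G2_commutator r (T v) (T v') = G2_commutator r (T w) (T w') \<longleftrightarrow>
        G2_commutator r v v' = G2_commutator r w w'"
    using assms unfolding commutator_isomorphism_def by blast+
  define S where "S = inv_into V T"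
  have S: "S u \<in> V" "T (S u) = u" if "u \<in> W" for u
    using that T(3) unfolding S_def
    by (auto simp: bij_betw_inv_into_right bij_betw_def inv_into_into)
  have inj: "inj_on T V" using T(3) by (simp add: bij_betw_def)
  show ?thesis
    unfolding commutator_isomorphism_def S_def[symmetric]
  proof (intro conjI ballI)
    show "bij_betw S W V" unfolding S_def using T(3) by (rule bij_betw_inv_into)
    show "S (v + w) = S v + S w" if "v \<in> W" "w \<in> W" for v w
    proof (rule inj_onD[OF inj])
      show "T (S (v + w)) = T (S v + S w)"
        using T(2,4) S that finite_index_add_add by metis
      show "S (v + w) \<in> V" using S(1) finite_index_add_add[OF T(2) that] .
      show "S v + S w \<in> V" using finite_index_add_add[OF T(1)] S(1) that by blast
    qed
    show "G2_commutator r (S v) (S v') = G2_commutator r (S w) (S w') \<longleftrightarrow>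
        G2_commutator r v v' = G2_commutator r w w'"
      if "v \<in> W" "v' \<in> W" "w \<in> W" "w' \<in> W" for v v' w w'
      using T(5)[of "S v" "S v'" "S w" "S w'"] S that by simp
  qed (use T in auto)
qed

text \<open>
  The number of coincidences for \<open>(v, w)\<close> and for \<open>(T v, T w)\<close> is the same, so \<open>T\<close> preserves lines.
\<close>
lemma commutator_isomorphism_semilinear:
  assumes "commutator_isomorphism V W T"
  obtains \<tau> :: "'k poly fract \<Rightarrow> 'k poly fract" and a where
    "\<And>x y. \<tau> (x + y) = \<tau> x + \<tau> y" "\<And>x y. \<tau> (x * y) = \<tau> x * \<tau> y" "\<tau> 1 = 1" "a \<noteq> 0"
    "\<And>v. v \<in> V \<Longrightarrow> to_fract (T v) = \<tau> (to_fract v) * a"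
proof -
  have V: "finite_index_add V" and W: "finite_index_add W" and bij: "bij_betw T V W"
    and Tadd: "\<And>v w. v \<in> V \<Longrightarrow> w \<in> V \<Longrightarrow> T (v + w) = T v + T w"
    and Tcom: "\<And>v v' w w'. v \<in> V \<Longrightarrow> v' \<in> V \<Longrightarrow> w \<in> V \<Longrightarrow> w' \<in> V \<Longrightarrow>
      G2_commutator r (T v) (T v') = G2_commutator r (T w) (T w') \<longleftrightarrow>
        G2_commutator r v v' = G2_commutator r w w'"
    using assms unfolding commutator_isomorphism_def by blast+
  have TV: "T v \<in> W" if "v \<in> V" for v using bij that by (auto simp: bij_betw_def)
  have T0: "T 0 = 0"
    using Tadd[of 0 0] finite_index_add_zero[OF V] by (metis add_cancel_left_left add_0)
  have Tnz: "T v \<noteq> 0" if "v \<in> V" "v \<noteq> 0" for v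
    using bij that T0 finite_index_add_zero[OF V] by (metis bij_betw_def inj_onD)
  have com: "G2_commutator r (to_fract x) (to_fract y) = to_fract (G2_commutator r x y)"
    for x y :: "'k poly"
    by (simp add: G2_commutator_def to_fract_power)
  have inf: "infinite (coincidences W (T v) (T w)) \<longleftrightarrow> infinite (coincidences V v w)"
    if "v \<in> V" "w \<in> V" for v w
  proof -
    have "coincidences W (T v) (T w) = map_prod T T ` coincidences V v w"
    proof (intro equalityI subsetI)
      fix z assume "z \<in> coincidences W (T v) (T w)"
      then obtain v' w' where z: "z = (v', w')" "v' \<in> W" "w' \<in> W"
        "G2_commutator r (T v) v' = G2_commutator r (T w) w'"
        by (auto simp: coincidences_def)
      then obtain v'' w'' where "v'' \<in> V" "w'' \<in> V" "v' = T v''" "w' = T w''"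
        using bij by (auto simp: bij_betw_def)
      then show "z \<in> map_prod T T ` coincidences V v w"
        using z Tcom that by (auto simp: coincidences_def)
    qed (use Tcom that TV in \<open>auto simp: coincidences_def\<close>)
    moreover have "inj_on (map_prod T T) (coincidences V v w)"
      using bij by (auto simp: bij_betw_def inj_on_def coincidences_def)
    ultimately show ?thesis by (simp add: finite_image_iff)
  qed
  define T' where "T' = (\<lambda>y. to_fract (T (inv_into UNIV to_fract y)))"
  have T': "T' (to_fract v) = to_fract (T v)" for v
    by (simp add: T'_def inv_f_f inj_def)
  interpret line_preserving_map "to_fract ` V" T' r
  proof unfold_locales
    show "\<exists>b. b \<noteq> 0 \<and> (\<forall>y\<in>Y. b ^ r * y \<in> to_fract ` V)" if "finite Y" for Y
      using fract_absorbing[OF V that] .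
    show "\<exists>x. \<forall>k. x \<noteq> (k :: 'k poly fract) ^ r" using X_not_power by blast
    show "\<exists>k :: 'k poly fract. k ^ (r * r) \<noteq> k"
    proof
      have "r * r \<noteq> 1" using r_ge_2 by simp
      then show "to_fract (monom (1::'k) 1) ^ (r * r) \<noteq> to_fract (monom 1 1)"
        by (simp only: to_fract_eq_iff monom_power flip: to_fract_power) (simp add: monom_eq_iff')
    qed
    fix v w assume vw: "v \<in> to_fract ` V" "w \<in> to_fract ` V"
    then obtain x y where xy: "v = to_fract x" "w = to_fract y" "x \<in> V" "y \<in> V" by blast
    show "v + w \<in> to_fract ` V"
      using xy finite_index_add_add[OF V] by (auto simp flip: to_fract_add)
    show "T' (v + w) = T' v + T' w"
      using xy Tadd by (simp add: T' flip: to_fract_add)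
    show "T' v \<noteq> 0" if "v \<noteq> 0" using that xy Tnz by (auto simp: T')
    show "(\<exists>k. T' v = k ^ r * T' w) \<longleftrightarrow> (\<exists>k. v = k ^ r * w)" if "v \<noteq> 0" "w \<noteq> 0"
      using infinite_coincidences_iff[OF V, of x y] infinite_coincidences_iff[OF W, of "T x" "T y"]
        inf[of x y] xy that Tnz by (simp add: T')
    fix v' w' assume "v' \<in> to_fract ` V" "w' \<in> to_fract ` V"
    then obtain x' y' where xy': "v' = to_fract x'" "w' = to_fract y'" "x' \<in> V" "y' \<in> V" by blast
    show "G2_commutator r (T' v) (T' v') = G2_commutator r (T' w) (T' w')"
      if "G2_commutator r v v' = G2_commutator r w w'"
      using that Tcom[of x x' y y'] xy xy' by (simp add: T' com)
  qed (use r_pos fract_frob_add in auto)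
  show ?thesis
  proof (rule that[of \<tau> "ext 1"])
    show "to_fract (T v) = \<tau> (to_fract v) * ext 1" if "v \<in> V" for v
      using T_is_semilinear[of "to_fract v"] that by (simp add: T')
    show "ext 1 \<noteq> 0" by (rule ext_nonzero) simp
  qed (rule \<tau>_add \<tau>_mult \<tau>_1)+
qed

text \<open>
  The polynomials \<open>g\<close> for which all \<open>g z\<^sup>n\<close> are polynomials form a nonzero ideal that is stable under
  multiplication by \<open>z\<close>. If \<open>g\<close> generates it, \<open>z g\<close> is a multiple of \<open>g\<close>.
\<close>
lemma polynomials_integrally_closed:
  fixes z :: "'k poly fract"
  assumes "g\<^sub>0 \<noteq> 0" and g0: "\<And>n. to_fract g\<^sub>0 * z ^ n \<in> range to_fract"
  shows "z \<in> range to_fract"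
proof -
  define I where "I = {g. \<forall>n. to_fract g * z ^ n \<in> range to_fract}"
  have diff: "x - y \<in> I" if "x \<in> I" "y \<in> I" for x y
  proof -
    have "to_fract (x - y) * z ^ n \<in> range to_fract" for n
    proof -
      have "to_fract x * z ^ n \<in> range to_fract" "to_fract y * z ^ n \<in> range to_fract"
        using that by (simp_all add: I_def)
      then obtain a b where "to_fract x * z ^ n = to_fract a" "to_fract y * z ^ n = to_fract b"
        by auto
      then have "to_fract (x - y) * z ^ n = to_fract (a - b)" by (simp add: algebra_simps)
      then show ?thesis by (metis rangeI)
    qed
    then show ?thesis by (simp add: I_def)
  qed
  have mult: "x * y \<in> I" if "x \<in> I" for x y
  proof -
    have "to_fract (x * y) * z ^ n \<in> range to_fract" for n
    proof -
      have "to_fract x * z ^ n \<in> range to_fract" using that by (simp add: I_def)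
      then obtain a where "to_fract x * z ^ n = to_fract a" by auto
      then have "to_fract (x * y) * z ^ n = to_fract (a * y)" by (simp add: algebra_simps)
      then show ?thesis by (metis rangeI)
    qed
    then show ?thesis by (simp add: I_def)
  qed
  have "\<exists>g. g \<in> I \<and> g \<noteq> 0" using assms unfolding I_def by blast
  then obtain g where g: "g \<in> I" "g \<noteq> 0" and min: "\<And>h. h \<in> I \<Longrightarrow> h \<noteq> 0 \<Longrightarrow> degree g \<le> degree h"
    using ex_has_least_nat[of "\<lambda>g. g \<in> I \<and> g \<noteq> 0" _ degree] by blast
  have "to_fract g * z ^ 1 \<in> range to_fract" using g(1) unfolding I_def by blast
  then obtain h where h: "to_fract g * z = to_fract h" by auto
  have "h \<in> I"
  proof -
    have "to_fract h * z ^ n = to_fract g * z ^ Suc n" for n by (simp flip: h)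
    then show ?thesis using g(1) by (simp add: I_def del: power_Suc)
  qed
  then have "h mod g \<in> I"
    using diff mult g(1) by (simp flip: minus_mult_div_eq_mod)
  then have "h mod g = 0"
    using min[of "h mod g"] degree_mod_less[of g h] g(2) by force
  then have "h = g * (h div g)" by (metis mult_div_mod_eq add.right_neutral)
  then have "to_fract g * z = to_fract g * to_fract (h div g)" using h by (metis to_fract_mult)
  then show ?thesis using g by simp
qed

text \<open>
  Finitely many cosets of \<open>V\<close> cover the ring, so the elements \<open>\<tau>(p) a\<close> have a common denominator. It
  also serves for all powers of one \<open>\<tau>(p)\<close>, which is therefore a polynomial.
\<close>
lemma semilinear_preserves_polynomials:
  assumes add: "\<And>x y. \<tau> (x + y) = \<tau> x + \<tau> y" and mult: "\<And>x y. \<tau> (x * y) = \<tau> x * \<tau> y"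
    and one: "\<tau> 1 = 1" and a: "a \<noteq> 0" and V: "finite_index_add V"
    and int: "\<And>v. v \<in> V \<Longrightarrow> \<tau> (to_fract v) * a \<in> range to_fract"
  shows "\<tau> (to_fract p) \<in> range (to_fract :: 'k poly \<Rightarrow> _)"
proof -
  obtain S where S: "finite S" "\<forall>x. \<exists>s\<in>S. x - s \<in> V"
    using V unfolding finite_index_add_def by blast
  obtain e where e: "e \<noteq> 0"
    "\<forall>y\<in>insert a ((\<lambda>s. \<tau> (to_fract s) * a) ` S). to_fract e * y \<in> range to_fract"
    using fract_common_denominator[of "insert a ((\<lambda>s. \<tau> (to_fract s) * a) ` S)"] S(1) by auto
  have e': "to_fract e * (\<tau> (to_fract x) * a) \<in> range to_fract" for x
  proof -
    obtain s where s: "s \<in> S" "x - s \<in> V" using S by blast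
    have "to_fract e * (\<tau> (to_fract s) * a) \<in> range to_fract" using e(2) s(1) by simp
    then obtain b where b: "to_fract e * (\<tau> (to_fract s) * a) = to_fract b" by auto
    obtain c where c: "\<tau> (to_fract (x - s)) * a = to_fract c" using int[OF s(2)] by auto
    have "\<tau> (to_fract x) = \<tau> (to_fract s) + \<tau> (to_fract (x - s))" by (simp flip: add)
    then have "to_fract e * (\<tau> (to_fract x) * a) = to_fract (b + e * c)"
      using b c by (simp add: algebra_simps)
    then show ?thesis by (metis rangeI)
  qed
  obtain g where g: "to_fract e * a = to_fract g" using e by auto
  have pow: "\<tau> (x ^ n) = \<tau> x ^ n" for x n by (induction n) (auto simp: one mult)
  show ?thesis
  proof (rule polynomials_integrally_closed)
    show "g \<noteq> 0" using g e a by auto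
    show "to_fract g * \<tau> (to_fract p) ^ n \<in> range to_fract" for n
      using e'[of "p ^ n"] by (simp add: to_fract_power pow ac_simps flip: g)
  qed
qed

text \<open>
  On \<open>V\<close> the composite \<open>\<tau>' \<circ> \<tau>\<close> is multiplication by a constant, and every polynomial is a quotient
  of two elements of \<open>V\<close>.
\<close>
lemma semilinear_inverse:
  assumes \<tau>: "\<And>x y. \<tau> (x * y) = \<tau> x * \<tau> y" "\<And>x y. \<tau>' (x * y) = \<tau>' x * \<tau>' y"
    and V: "finite_index_add V" and a: "a \<noteq> 0"
    and T: "\<And>v. v \<in> V \<Longrightarrow> to_fract (T v) = \<tau> (to_fract v) * a"
    and T': "\<And>v. v \<in> V \<Longrightarrow> to_fract v = \<tau>' (to_fract (T v)) * a'"
  shows "\<tau>' (\<tau> (to_fract p)) = to_fract (p :: 'k poly)"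
proof -
  have v: "to_fract v = \<tau>' (\<tau> (to_fract v)) * (\<tau>' a * a')" if "v \<in> V" for v
    using T'[OF that] by (simp add: T[OF that] \<tau> mult.assoc)
  have "infinite {v. \<forall>c\<in>{1, p}. c * v \<in> V}"
    using V infinite_UNIV_poly by (rule finite_index_add_common_element) (auto simp: algebra_simps)
  then have "\<not> {v. \<forall>c\<in>{1, p}. c * v \<in> V} \<subseteq> {0}" by (meson finite.emptyI finite.insertI finite_subset)
  then obtain u where u: "u \<noteq> 0" "u \<in> V" "p * u \<in> V" by auto
  have "to_fract p * to_fract u = \<tau>' (\<tau> (to_fract p)) * (\<tau>' (\<tau> (to_fract u)) * (\<tau>' a * a'))"
    using v[OF u(3)] by (simp add: \<tau> ac_simps)
  also have "\<dots> = \<tau>' (\<tau> (to_fract p)) * to_fract u" using v[OF u(2)] by simp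
  finally show ?thesis using u by simp
qed

theorem commutator_isomorphism_is_ring_automorphism:
  assumes T: "commutator_isomorphism V W T"
  obtains \<sigma> :: "'k poly \<Rightarrow> 'k poly" where
    "\<And>x y. \<sigma> (x + y) = \<sigma> x + \<sigma> y" "\<And>x y. \<sigma> (x * y) = \<sigma> x * \<sigma> y" "bij \<sigma>"
    "\<And>v w. v \<in> V \<Longrightarrow> w \<in> V \<Longrightarrow> T v * \<sigma> w = T w * \<sigma> v"
proof -
  define T' where "T' = inv_into V T"
  have T': "commutator_isomorphism W V T'"
    unfolding T'_def using T by (rule commutator_isomorphism_inverse)
  have bij: "bij_betw T V W" and V: "finite_index_add V" and W: "finite_index_add W"
    using T by (auto simp: commutator_isomorphism_def)
  have inv: "T' (T v) = v" if "v \<in> V" for v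
    using that bij unfolding T'_def by (simp add: bij_betw_inv_into_left)
  have inv': "T (T' u) = u" if "u \<in> W" for u
    using that bij unfolding T'_def by (simp add: bij_betw_inv_into_right)
  have TV: "T v \<in> W" if "v \<in> V" for v using bij that by (auto simp: bij_betw_def)
  have TW: "T' u \<in> V" if "u \<in> W" for u
    using T' that by (auto simp: commutator_isomorphism_def bij_betw_def)
  obtain \<tau> a where \<tau>: "\<And>x y. \<tau> (x + y) = \<tau> x + \<tau> y" "\<And>x y. \<tau> (x * y) = \<tau> x * \<tau> y"
    "\<tau> 1 = 1" "a \<noteq> 0" "\<And>v. v \<in> V \<Longrightarrow> to_fract (T v) = \<tau> (to_fract v) * a"
    using commutator_isomorphism_semilinear[OF T] by blast
  obtain \<tau>' a' where \<tau>': "\<And>x y. \<tau>' (x + y) = \<tau>' x + \<tau>' y" "\<And>x y. \<tau>' (x * y) = \<tau>' x * \<tau>' y"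
    "\<tau>' 1 = 1" "a' \<noteq> 0" "\<And>v. v \<in> W \<Longrightarrow> to_fract (T' v) = \<tau>' (to_fract v) * a'"
    using commutator_isomorphism_semilinear[OF T'] by blast
  have "\<tau> (to_fract p) \<in> range to_fract" for p
    using \<tau>(1-4) V by (rule semilinear_preserves_polynomials) (simp flip: \<tau>(5))
  then obtain \<sigma> where \<sigma>: "\<And>p. \<tau> (to_fract p) = to_fract (\<sigma> p)"
    unfolding image_iff by metis
  have "\<tau>' (to_fract p) \<in> range to_fract" for p
    using \<tau>'(1-4) W by (rule semilinear_preserves_polynomials) (simp flip: \<tau>'(5))
  then obtain \<sigma>' where \<sigma>': "\<And>p. \<tau>' (to_fract p) = to_fract (\<sigma>' p)"
    unfolding image_iff by metis
  have T'_T: "to_fract v = \<tau>' (to_fract (T v)) * a'" if "v \<in> V" for v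
    using \<tau>'(5)[OF TV[OF that]] inv[OF that] by simp
  have inverse_1: "\<tau>' (\<tau> (to_fract p)) = to_fract p" for p
    by (rule semilinear_inverse[where T = T, OF \<tau>(2) \<tau>'(2) V \<tau>(4,5) T'_T])
  have T_T': "to_fract u = \<tau> (to_fract (T' u)) * a" if "u \<in> W" for u
    using \<tau>(5)[OF TW[OF that]] inv'[OF that] by simp
  have inverse_2: "\<tau> (\<tau>' (to_fract p)) = to_fract p" for p
    by (rule semilinear_inverse[where T = T', OF \<tau>'(2) \<tau>(2) W \<tau>'(4,5) T_T'])
  have "bij \<sigma>"
    by (rule o_bij[of \<sigma>' \<sigma>])
      (use inverse_1 inverse_2 in \<open>simp_all add: \<sigma> \<sigma>' fun_eq_iff\<close>)
  show ?thesis
  proof (rule that[of \<sigma>])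
    fix x y
    have "to_fract (\<sigma> (x + y)) = to_fract (\<sigma> x + \<sigma> y)"
      by (simp add: \<tau>(1) flip: \<sigma>)
    then show "\<sigma> (x + y) = \<sigma> x + \<sigma> y" by (simp only: to_fract_eq_iff)
    have "to_fract (\<sigma> (x * y)) = to_fract (\<sigma> x * \<sigma> y)"
      by (simp add: \<tau>(2) flip: \<sigma>)
    then show "\<sigma> (x * y) = \<sigma> x * \<sigma> y" by (simp only: to_fract_eq_iff)
  next
    show "T v * \<sigma> w = T w * \<sigma> v" if "v \<in> V" "w \<in> V" for v w
    proof -
      have "to_fract (T v * \<sigma> w) = to_fract (T w * \<sigma> v)"
        using \<tau>(5) that by (simp add: \<sigma> ac_simps)
      then show ?thesis by (simp only: to_fract_eq_iff)
    qed
  qed fact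
qed

end

section \<open>Polynomials inside Laurent series\<close>

text \<open>
  The identification of \<open>\<bbbF>\<^sub>q[x]\<close> with \<open>\<bbbF>\<^sub>q[t\<^sup>-\<^sup>1]\<close>.
\<close>
definition inv_eval :: "'k::field poly \<Rightarrow> 'k fls" where
  "inv_eval p = poly (map_poly fls_const p) fls_X_inv"

lemma inv_eval_0 [simp]: "inv_eval 0 = 0"
  by (simp add: inv_eval_def)

lemma inv_eval_pCons: "inv_eval (pCons a p) = fls_const a + fls_X_inv * inv_eval p"
  by (simp add: inv_eval_def map_poly_pCons)

lemma fls_nth_inv_eval: "fls_nth (inv_eval p) n = (if n \<le> 0 then coeff p (nat (- n)) else 0)"
proof (induction p arbitrary: n)
  case (pCons a p)
  show ?case
  proof (cases "n < 0")
    case True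
    then have "nat (- n) = Suc (nat (- (n + 1)))" by simp
    then show ?thesis using True by (simp add: inv_eval_pCons fls_X_inv_times_conv_shift pCons.IH)
  qed (simp add: inv_eval_pCons fls_X_inv_times_conv_shift pCons.IH)
qed simp

lemma inv_eval_add: "inv_eval (p + q) = inv_eval p + inv_eval q"
  by (intro fls_eqI) (simp add: fls_nth_inv_eval)

lemma inv_eval_diff: "inv_eval (p - q) = inv_eval p - inv_eval q"
  by (intro fls_eqI) (simp add: fls_nth_inv_eval)

lemma inv_eval_smult: "inv_eval (Polynomial.smult c p) = fls_const c * inv_eval p"
  by (intro fls_eqI) (simp add: fls_nth_inv_eval)

lemma inv_eval_mult: "inv_eval (p * q) = inv_eval p * inv_eval q"
  by (induction p) (simp_all add: inv_eval_pCons inv_eval_add inv_eval_smult algebra_simps)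

lemma inv_eval_1 [simp]: "inv_eval 1 = 1"
  by (simp add: inv_eval_def)

lemma inv_eval_power: "inv_eval (p ^ n) = inv_eval p ^ n"
  by (induction n) (simp_all add: inv_eval_mult)

lemma inv_eval_eq_iff [simp]: "inv_eval p = inv_eval q \<longleftrightarrow> p = q"
proof
  assume *: "inv_eval p = inv_eval q"
  show "p = q"
  proof (rule poly_eqI)
    fix n
    show "coeff p n = coeff q n"
      using arg_cong[OF *, of "\<lambda>f. fls_nth f (- int n)"] by (simp add: fls_nth_inv_eval)
  qed
qed simp

lemma inv_eval_eq_0_iff [simp]: "inv_eval p = 0 \<longleftrightarrow> p = 0"
  using inv_eval_eq_iff[of p 0] by (simp del: inv_eval_eq_iff)

lemma F_minus_eq_range_inv_eval: "F_minus = range inv_eval"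
  by (simp add: F_minus_def inv_eval_def)

text \<open>
  The projection of \<open>F = \<bbbF>\<^sub>q[t\<^sup>-\<^sup>1] \<oplus> t\<bbbF>\<^sub>q[[t]]\<close> onto the first summand. The principal part of a series
  does not contain its constant coefficient, which belongs to the polynomial.
\<close>
definition poly_part :: "'k::field fls \<Rightarrow> 'k poly" where
  "poly_part y = fls_prpart y + [:fls_nth y 0:]"

lemma coeff_poly_part: "coeff (poly_part y) n = fls_nth y (- int n)"
  by (cases n) (simp_all add: poly_part_def)

lemma poly_part_add: "poly_part (y + z) = poly_part y + poly_part z"
  by (intro poly_eqI) (simp add: coeff_poly_part)

lemma poly_part_inv_eval [simp]: "poly_part (inv_eval p) = p"
  by (intro poly_eqI) (simp add: coeff_poly_part fls_nth_inv_eval)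

lemma poly_part_eq_0_iff: "poly_part y = 0 \<longleftrightarrow> (\<forall>n\<le>0. fls_nth y n = 0)"
proof
  assume *: "poly_part y = 0"
  show "\<forall>n\<le>0. fls_nth y n = 0"
  proof (intro allI impI)
    fix n :: int assume "n \<le> 0"
    then show "fls_nth y n = 0" using arg_cong[OF *, of "\<lambda>p. coeff p (nat (- n))"]
      by (simp add: coeff_poly_part)
  qed
qed (auto intro!: poly_eqI simp: coeff_poly_part)

definition fls_map :: "('a::zero \<Rightarrow> 'b::zero) \<Rightarrow> 'a fls \<Rightarrow> 'b fls" where
  "fls_map \<phi> f = Abs_fls (\<lambda>n. \<phi> (fls_nth f n))"

lemma fls_nth_fls_map:
  assumes "\<phi> 0 = 0"
  shows "fls_nth (fls_map \<phi> f) n = \<phi> (fls_nth f n)"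
proof -
  obtain N where "\<forall>n<N. fls_nth f n = 0" by (rule fls_nth_vanishes_belowE)
  then show ?thesis unfolding fls_map_def
    using assms by (intro nth_Abs_fls_lower_bound[of N]) simp
qed

lemma fls_map_mult:
  fixes \<phi> :: "'a::field \<Rightarrow> 'b::field"
  assumes add: "\<And>x y. \<phi> (x + y) = \<phi> x + \<phi> y" and mult: "\<And>x y. \<phi> (x * y) = \<phi> x * \<phi> y"
  shows "fls_map \<phi> (f * g) = fls_map \<phi> f * fls_map \<phi> g"
proof -
  have 0: "\<phi> 0 = 0" using add[of 0 0] by (metis add_cancel_left_left add_0)
  have sum: "\<phi> (sum h A) = (\<Sum>i\<in>A. \<phi> (h i))" if "finite A" for h and A :: "nat set"
    using that by (induction A rule: finite_induct) (simp_all add: 0 add)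
  define M where "M F = Abs_fps (\<lambda>n. \<phi> (fps_nth F n))" for F
  have M: "M (F * G) = M F * M G" for F G
    by (intro fps_ext) (simp add: M_def fps_mult_nth sum mult)
  have shift: "fls_map \<phi> (fls_shift n f) = fls_shift n (fls_map \<phi> f)" for n f
    by (intro fls_eqI) (simp add: fls_nth_fls_map 0)
  have fps: "fls_map \<phi> (fps_to_fls F) = fps_to_fls (M F)" for F
    by (intro fls_eqI) (simp add: fls_nth_fls_map 0 M_def)
  obtain m F where F: "f = fls_shift m (fps_to_fls F)"
    using fls_conv_base_factor_to_fps_shift_subdegree by blast
  obtain n G where G: "g = fls_shift n (fps_to_fls G)"
    using fls_conv_base_factor_to_fps_shift_subdegree by blast
  show ?thesis
    unfolding F G by (simp add: fls_times_both_shifted_simp shift fps M flip: fls_times_fps_to_fls)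
qed

text \<open>
  The series to be substituted for \<open>t\<close> in order to send \<open>t\<^sup>-\<^sup>1\<close> to \<open>\<alpha> t\<^sup>-\<^sup>1 + \<beta>\<close>.
\<close>
lemma affine_substitution:
  fixes \<alpha> \<beta> :: "'k::field"
  assumes "\<alpha> \<noteq> 0"
  obtains H where "fps_nth H 0 = 0" "H \<noteq> 0"
    "fps_to_fls H = inverse (fls_const \<alpha> * fls_X_inv + fls_const \<beta>)"
    "fls_subdegree (fps_to_fls H) = 1"
proof -
  define D where "D = fps_const \<alpha> + fps_const \<beta> * fps_X"
  define H where "H = fps_X * inverse D"
  have D0: "fps_nth D 0 \<noteq> 0" using assms by (simp add: D_def)
  have "D * inverse D = 1" using D0 by (rule inverse_mult_eq_1')
  moreover have "fps_to_fls D = (fls_const \<alpha> * fls_X_inv + fls_const \<beta>) * fls_X"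
    by (simp add: D_def fls_times_fps_to_fls algebra_simps flip: fls_inverse_X)
  ultimately have "(fls_const \<alpha> * fls_X_inv + fls_const \<beta>) * fps_to_fls H = 1"
    unfolding H_def by (metis fls_times_fps_to_fls fps_one_to_fls fps_X_to_fls mult.assoc)
  then have inv: "fps_to_fls H = inverse (fls_const \<alpha> * fls_X_inv + fls_const \<beta>)"
    by (simp add: inverse_unique)
  have H: "fps_nth H 0 = 0" "fps_nth H 1 \<noteq> 0"
    using assms D0 by (simp_all add: H_def)
  moreover have "fls_subdegree (fps_to_fls H) = 1"
    by (rule fls_subdegree_eqI) (use H in auto)
  ultimately show ?thesis using inv by (intro that[of H]) auto
qed

lemma fls_subdegree_compose:
  assumes "fls_subdegree (fps_to_fls H) = 1" "H \<noteq> 0"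
  shows "fls_subdegree (fls_compose_fps f H) = fls_subdegree f"
proof (cases "f = 0")
  case False
  define g where "g = fps_to_fls (fps_compose (fls_base_factor_to_fps f) H)"
  have g: "fls_nth g 0 \<noteq> 0" using False by (simp add: g_def)
  then have "fls_subdegree g = 0"
    by (rule fls_subdegree_eqI) (simp add: g_def)
  moreover have "g \<noteq> 0" using g by auto
  moreover have "fls_compose_fps f H = g * fps_to_fls H powi fls_subdegree f"
    by (simp only: fls_compose_fps_def g_def)
  ultimately show ?thesis using assms by simp
qed simp

lemma fls_compose_fps_X_right: "fls_compose_fps f fps_X = f"
proof (cases "f = 0")
  case False
  then show ?thesis
    by (simp add: fls_compose_fps_def fls_X_power_int fls_X_intpow_times_conv_shift)
qed simp

text \<open>
  A ring automorphism of \<open>k[x]\<close> acts on the constants by a field automorphism \<open>\<phi>\<close>. It multiplies all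
  degrees by the degree of the image of \<open>x\<close>; by surjectivity this image is \<open>\<alpha> x + \<beta>\<close> with
  \<open>\<alpha> \<noteq> 0\<close>. Both the action of \<open>\<phi>\<close> on coefficients and the substitution make sense for Laurent
  series in \<open>t = x\<^sup>-\<^sup>1\<close> and do not change the order of vanishing, which gives continuity later on.
\<close>
theorem ring_automorphism_extends_to_Laurent_series:
  fixes \<sigma> :: "'k::field poly \<Rightarrow> 'k poly"
  assumes add: "\<And>x y. \<sigma> (x + y) = \<sigma> x + \<sigma> y" and mult: "\<And>x y. \<sigma> (x * y) = \<sigma> x * \<sigma> y"
    and bij: "bij \<sigma>"
  obtains \<Phi> :: "'k fls \<Rightarrow> 'k fls" where
    "\<And>x y. \<Phi> (x + y) = \<Phi> x + \<Phi> y" "\<And>x y. \<Phi> (x * y) = \<Phi> x * \<Phi> y" "bij \<Phi>"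
    "\<And>y. fls_subdegree (\<Phi> y) = fls_subdegree y" "\<And>p. \<Phi> (inv_eval p) = inv_eval (\<sigma> p)"
proof -
  have s0: "\<sigma> 0 = 0" using add[of 0 0] by (metis add_cancel_left_left add_0)
  have inj: "\<sigma> x = \<sigma> y \<longleftrightarrow> x = y" for x y using bij by (auto simp: bij_def inj_eq)
  have surj: "\<exists>x. \<sigma> x = y" for y using bij by (metis bij_pointE)
  obtain e where e: "\<sigma> e = 1" using surj by blast
  have s1: "\<sigma> 1 = 1" using mult[of 1 e] e by simp
  have deg0: "degree (\<sigma> [:c:]) = 0" for c
  proof (cases "c = 0")
    case False
    have "\<sigma> [:c:] * \<sigma> [:inverse c:] = \<sigma> ([:c:] * [:inverse c:])" by (rule mult[symmetric])
    also have "[:c:] * [:inverse c:] = 1" using False by (simp add: one_pCons)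
    finally have unit: "\<sigma> [:c:] * \<sigma> [:inverse c:] = 1" by (simp only: s1)
    then have "\<sigma> [:c:] \<noteq> 0" "\<sigma> [:inverse c:] \<noteq> 0" by auto
    then have "degree (\<sigma> [:c:]) + degree (\<sigma> [:inverse c:]) = 0"
      using arg_cong[OF unit, of degree] by (simp add: degree_mult_eq)
    then show ?thesis by simp
  qed (simp add: s0)
  define \<phi> where "\<phi> c = coeff (\<sigma> [:c:]) 0" for c
  have \<phi>: "\<sigma> [:c:] = [:\<phi> c:]" for c
    by (rule poly_eqI) (auto simp: \<phi>_def coeff_pCons coeff_eq_0 deg0 split: nat.splits)
  define x where "x = [:0, 1 :: 'k:]"
  have \<sigma>_pCons: "\<sigma> (pCons c p) = [:\<phi> c:] + \<sigma> x * \<sigma> p" for c p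
  proof -
    have "pCons c p = [:c:] + x * p" by (simp add: x_def)
    then show ?thesis by (simp only: add mult \<phi>)
  qed
  have deg: "degree (\<sigma> p) = degree (\<sigma> x) * degree p" for p
  proof (induction p)
    case (pCons c p)
    show ?case
    proof (cases "p = 0")
      case False
      have "x \<noteq> 0" by (simp add: x_def)
      then have nz: "\<sigma> x \<noteq> 0" "\<sigma> p \<noteq> 0" using False inj[of _ 0] by (auto simp: s0)
      then have d: "degree (\<sigma> x * \<sigma> p) = degree (\<sigma> x) * Suc (degree p)"
        by (simp add: degree_mult_eq pCons.IH)
      show ?thesis
      proof (cases "degree (\<sigma> x) = 0")
        case True
        have "degree ([:\<phi> c:] + \<sigma> x * \<sigma> p) \<le> 0"
          by (rule degree_add_le) (use d True in auto)
        then show ?thesis using True by (simp add: \<sigma>_pCons)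
      next
        case False
        then show ?thesis using \<open>p \<noteq> 0\<close> d by (simp add: \<sigma>_pCons degree_add_eq_right)
      qed
    qed (simp add: \<sigma>_pCons s0)
  qed (simp add: s0)
  obtain z where "\<sigma> z = x" using surj by blast
  then have "degree (\<sigma> x) * degree z = 1" using deg[of z] by (simp add: x_def)
  then have deg1: "degree (\<sigma> x) = 1" by simp
  define \<alpha> \<beta> where "\<alpha> = coeff (\<sigma> x) 1" and "\<beta> = coeff (\<sigma> x) 0"
  have x: "\<sigma> x = [:\<beta>, \<alpha>:]"
    by (rule poly_eqI) (use deg1 in \<open>auto simp: \<alpha>_def \<beta>_def coeff_pCons coeff_eq_0 split: nat.splits\<close>)
  have \<alpha>: "\<alpha> \<noteq> 0" using deg1 by (metis \<alpha>_def degree_0 leading_coeff_neq_0 zero_neq_one)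
  have \<phi>_add: "\<phi> (c + d) = \<phi> c + \<phi> d" for c d
    using add[of "[:c:]" "[:d:]"] by (simp add: \<phi>)
  have \<phi>_mult: "\<phi> (c * d) = \<phi> c * \<phi> d" for c d
    using mult[of "[:d:]" "[:c:]"] by (simp add: \<phi>)
  have \<phi>_0: "\<phi> 0 = 0" using \<phi>[of 0] s0 by simp
  have \<phi>_1: "\<phi> 1 = 1" using \<phi>[of 1] s1 by (simp add: one_pCons)
  have \<phi>_inj: "\<phi> c = \<phi> d \<longleftrightarrow> c = d" for c d
    using inj[of "[:c:]" "[:d:]"] by (simp add: \<phi>)
  have \<phi>_surj: "\<exists>c. \<phi> c = d" for d
  proof -
    obtain p where p: "\<sigma> p = [:d:]" using surj by blast
    then have "degree p = 0" using deg[of p] deg1 by simp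
    then obtain c where "p = [:c:]" by (metis degree_eq_zeroE)
    then show ?thesis using p \<phi> by auto
  qed
  obtain H where H: "fps_nth H 0 = 0" "H \<noteq> 0"
    "fps_to_fls H = inverse (fls_const \<alpha> * fls_X_inv + fls_const \<beta>)"
    "fls_subdegree (fps_to_fls H) = 1"
    by (rule affine_substitution[OF \<alpha>])
  have comp_X_inv: "fls_compose_fps fls_X_inv H = fls_const \<alpha> * fls_X_inv + fls_const \<beta>"
  proof -
    have "fls_compose_fps (inverse fls_X) H = inverse (fps_to_fls H)"
      using H(1,2) by (simp add: fls_compose_fps_inverse)
    then show ?thesis by (simp add: H(3) fls_inverse_X)
  qed
  define \<Phi> where "\<Phi> y = fls_compose_fps (fls_map \<phi> y) H" for y
  have map_nth: "fls_nth (fls_map \<phi> y) n = \<phi> (fls_nth y n)" for y n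
    by (rule fls_nth_fls_map[of \<phi>, OF \<phi>_0])
  have map_add: "fls_map \<phi> (y + z) = fls_map \<phi> y + fls_map \<phi> z" for y z
    by (intro fls_eqI) (simp add: map_nth \<phi>_add)
  have \<Phi>_add: "\<Phi> (y + z) = \<Phi> y + \<Phi> z" for y z
    using H by (simp add: \<Phi>_def map_add fls_compose_fps_add)
  have \<Phi>_mult: "\<Phi> (y * z) = \<Phi> y * \<Phi> z" for y z
    using H by (simp add: \<Phi>_def fls_map_mult[of \<phi>, OF \<phi>_add \<phi>_mult] fls_compose_fps_mult)
  have subdeg: "fls_subdegree (\<Phi> y) = fls_subdegree y" for y
  proof -
    have "fls_subdegree (fls_map \<phi> y) = fls_subdegree y"
    proof (cases "y = 0")
      case True
      then have "fls_map \<phi> y = 0" by (intro fls_eqI) (simp add: map_nth \<phi>_0)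
      then show ?thesis using True by simp
    next
      case False
      then show ?thesis
        using \<phi>_inj[of _ 0] by (intro fls_subdegree_eqI) (auto simp: map_nth \<phi>_0)
    qed
    then show ?thesis by (simp only: \<Phi>_def fls_subdegree_compose[OF H(4,2)])
  qed
  have \<Phi>_eq_0: "y = 0" if "\<Phi> y = 0" for y
  proof -
    have "fls_map \<phi> y = 0" using that H by (simp add: \<Phi>_def fls_compose_fps_eq_0_iff)
    then show ?thesis using \<phi>_inj[of _ 0] map_nth[of y] by (intro fls_eqI) (auto simp: \<phi>_0)
  qed
  have \<Phi>_0: "\<Phi> 0 = 0" using \<Phi>_add[of 0 0] by (metis add_cancel_left_left add_0)
  have "inj \<Phi>"
  proof (rule injI)
    fix y z assume "\<Phi> y = \<Phi> z"
    moreover have "\<Phi> y = \<Phi> (y - z) + \<Phi> z" by (simp flip: \<Phi>_add)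
    ultimately show "y = z" using \<Phi>_eq_0[of "y - z"] by simp
  qed
  moreover have "surj \<Phi>"
  proof -
    have "\<exists>z. \<Phi> z = y" for y
    proof -
      \<comment> \<open>The inverse substitution \<open>x \<mapsto> (x - \<beta>) / \<alpha>\<close>.\<close>
      obtain H' where H': "fps_nth H' 0 = 0" "H' \<noteq> 0"
        "fps_to_fls H' = inverse (fls_const (inverse \<alpha>) * fls_X_inv + fls_const (- \<beta> / \<alpha>))"
        using affine_substitution[of "inverse \<alpha>" "- \<beta> / \<alpha>"] \<alpha> by (metis nonzero_imp_inverse_nonzero)
      have "fls_const (inverse \<alpha>) * (fls_const \<alpha> * fls_X_inv + fls_const \<beta>) + fls_const (- \<beta> / \<alpha>) =
          (fls_const (inverse \<alpha>) * fls_const \<alpha>) * fls_X_inv +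
          (fls_const (inverse \<alpha>) * fls_const \<beta> + fls_const (- \<beta> / \<alpha>))"
        by (simp only: distrib_left mult.assoc add.assoc)
      also have "fls_const (inverse \<alpha>) * fls_const \<alpha> = 1" using \<alpha> by simp
      also have "fls_const (inverse \<alpha>) * fls_const \<beta> + fls_const (- \<beta> / \<alpha>) = 0"
        by (simp only: fls_const_mult_const fls_plus_const) (simp add: divide_inverse)
      finally have "fls_const (inverse \<alpha>) * (fls_const \<alpha> * fls_X_inv + fls_const \<beta>) +
          fls_const (- \<beta> / \<alpha>) = fls_X_inv" by simp
      then have "fls_compose_fps (fps_to_fls H') H = inverse fls_X_inv"
        unfolding H'(3)
        by (simp only: fls_compose_fps_inverse[OF H(2,1)] fls_compose_fps_add[OF H(2,1)]
            fls_compose_fps_mult[OF H(2,1)] fls_compose_fps_const comp_X_inv)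
      then have "fps_to_fls (fps_compose H' H) = fls_X"
        using H by (simp flip: fls_inverse_X)
      then have "fps_compose H' H = fps_X" by (metis fps_to_fls_eq_iff fps_X_to_fls)
      then have comp: "fls_compose_fps (fls_compose_fps y H') H = y"
        using H H' by (simp add: fls_compose_fps_assoc fls_compose_fps_X_right)
      define z where "z = fls_map (inv_into UNIV \<phi>) (fls_compose_fps y H')"
      have inv: "inv_into UNIV \<phi> (\<phi> c) = c" "\<phi> (inv_into UNIV \<phi> c) = c" for c
        using \<phi>_inj \<phi>_surj[of c] by (auto simp: inj_def intro: inv_f_f f_inv_into_f)
      have "inv_into UNIV \<phi> 0 = 0" using inv(1)[of 0] by (simp add: \<phi>_0)
      then have "fls_map \<phi> z = fls_compose_fps y H'"
        by (intro fls_eqI) (simp add: z_def map_nth fls_nth_fls_map inv)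
      then have "\<Phi> z = y" using comp by (simp only: \<Phi>_def)
      then show ?thesis by blast
    qed
    then show ?thesis by (metis surj_def)
  qed
  ultimately have "bij \<Phi>" by (rule bijI)
  have \<Phi>_const: "\<Phi> (fls_const c) = fls_const (\<phi> c)" for c
  proof -
    have "fls_map \<phi> (fls_const c) = fls_const (\<phi> c)"
      by (intro fls_eqI) (simp add: map_nth \<phi>_0)
    then show ?thesis by (simp add: \<Phi>_def)
  qed
  have "fls_map \<phi> fls_X_inv = fls_X_inv"
    by (intro fls_eqI) (simp add: map_nth \<phi>_0 \<phi>_1)
  then have "\<Phi> fls_X_inv = fls_const \<alpha> * fls_X_inv + fls_const \<beta>"
    by (simp add: \<Phi>_def comp_X_inv)
  then have \<Phi>_X: "\<Phi> fls_X_inv = inv_eval (\<sigma> x)"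
    by (simp add: x inv_eval_pCons ac_simps)
  have "\<Phi> (inv_eval p) = inv_eval (\<sigma> p)" for p
  proof (induction p)
    case (pCons c p)
    then show ?case
      by (simp only: inv_eval_pCons \<Phi>_add \<Phi>_mult \<Phi>_const \<Phi>_X pCons \<sigma>_pCons inv_eval_add inv_eval_mult)
        (simp add: inv_eval_pCons)
  qed (simp add: \<Phi>_0 s0)
  then show ?thesis using that \<Phi>_add \<Phi>_mult \<open>bij \<Phi>\<close> subdeg by blast
qed

section \<open>Subgroups of finite index\<close>

context group begin

text \<open>
  As in the additive case, finite index is witnessed by a finite colouring \<open>c\<close> of \<open>K\<close> for which
  elements of one colour lie in one coset of \<open>H\<close>.
\<close>
lemma finite_index_subgroup_iff:
  assumes K: "subgroup K G"
  shows "finite_index_subgroup H (G\<lparr>carrier := K\<rparr>) \<longleftrightarrow>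
    subgroup H G \<and> H \<subseteq> K \<and>
    (\<exists>c :: 'a \<Rightarrow> 'a. finite (c ` K) \<and> (\<forall>x\<in>K. \<forall>y\<in>K. c x = c y \<longrightarrow> x \<otimes> inv y \<in> H))"
proof -
  have sub: "subgroup H (G\<lparr>carrier := K\<rparr>) \<longleftrightarrow> subgroup H G \<and> H \<subseteq> K"
  proof
    assume H: "subgroup H (G\<lparr>carrier := K\<rparr>)"
    then show "subgroup H G \<and> H \<subseteq> K"
      using incl_subgroup[OF K H] subgroup.subset[OF H] by simp
  qed (use K subgroup_incl in blast)
  have rcosets: "rcosets\<^bsub>G\<lparr>carrier := K\<rparr>\<^esub> H = (\<lambda>x. H #> x) ` K"
    by (auto simp: RCOSETS_def r_coset_def)
  have eq: "H #> x = H #> y \<longleftrightarrow> x \<otimes> inv y \<in> H" if "subgroup H G" "x \<in> K" "y \<in> K" for x y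
  proof -
    have car: "x \<in> carrier G" "y \<in> carrier G"
      using that(2,3) by (simp_all add: subgroup.mem_carrier[OF K])
    have "H #> x = H #> y \<longleftrightarrow> x \<in> H #> y"
    proof
      assume "H #> x = H #> y"
      then show "x \<in> H #> y" using rcos_self[OF car(1) that(1)] by simp
    next
      assume "x \<in> H #> y"
      then show "H #> x = H #> y" using repr_independence[OF _ car(2) that(1)] by simp
    qed
    then show ?thesis
      using subgroup.rcos_module[OF that(1) group_axioms car(2,1)] by simp
  qed
  show ?thesis
  proof (cases "subgroup H G \<and> H \<subseteq> K")
    case True
    then have H: "subgroup H G" by blast
    have "finite ((\<lambda>x. H #> x) ` K) \<longleftrightarrow>
      (\<exists>c :: 'a \<Rightarrow> 'a. finite (c ` K) \<and> (\<forall>x\<in>K. \<forall>y\<in>K. c x = c y \<longrightarrow> x \<otimes> inv y \<in> H))"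
    proof
      assume fin: "finite ((\<lambda>x. H #> x) ` K)"
      define c where "c x = (SOME y. y \<in> K \<and> H #> y = H #> x)" for x
      have c: "c x \<in> K \<and> H #> c x = H #> x" if "x \<in> K" for x
        unfolding c_def by (rule someI[of _ x]) (use that in auto)
      have "c ` K = (\<lambda>C. SOME y. y \<in> K \<and> H #> y = C) ` (\<lambda>x. H #> x) ` K"
        by (simp add: c_def image_image)
      then have "finite (c ` K)" using fin by simp
      moreover have "x \<otimes> inv y \<in> H" if "x \<in> K" "y \<in> K" "c x = c y" for x y
        using c[OF that(1)] c[OF that(2)] that eq[OF H that(1,2)] by simp
      ultimately show "\<exists>c :: 'a \<Rightarrow> 'a. finite (c ` K) \<and> (\<forall>x\<in>K. \<forall>y\<in>K. c x = c y \<longrightarrow> x \<otimes> inv y \<in> H)"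
        by blast
    next
      assume "\<exists>c :: 'a \<Rightarrow> 'a. finite (c ` K) \<and> (\<forall>x\<in>K. \<forall>y\<in>K. c x = c y \<longrightarrow> x \<otimes> inv y \<in> H)"
      then obtain c :: "'a \<Rightarrow> 'a" where c: "finite (c ` K)"
        "\<And>x y. x \<in> K \<Longrightarrow> y \<in> K \<Longrightarrow> c x = c y \<Longrightarrow> x \<otimes> inv y \<in> H" by blast
      define s where "s d = (SOME y. y \<in> K \<and> c y = d)" for d
      have s: "s (c x) \<in> K \<and> c (s (c x)) = c x" if "x \<in> K" for x
        unfolding s_def by (rule someI[of _ x]) (use that in auto)
      have "(\<lambda>x. H #> x) ` K \<subseteq> (\<lambda>d. H #> s d) ` c ` K"
      proof
        fix C assume "C \<in> (\<lambda>x. H #> x) ` K"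
        then obtain x where x: "x \<in> K" "C = H #> x" by blast
        then have "C = H #> s (c x)" using s[OF x(1)] c(2) eq[OF H] by simp
        then show "C \<in> (\<lambda>d. H #> s d) ` c ` K" using x by blast
      qed
      then show "finite ((\<lambda>x. H #> x) ` K)" using c(1) by (meson finite_imageI finite_subset)
    qed
    then show ?thesis using True by (simp add: finite_index_subgroup_def sub rcosets)
  qed (auto simp: finite_index_subgroup_def sub)
qed

lemma finite_index_subgroupI:
  fixes c :: "'a \<Rightarrow> 'c"
  assumes K: "subgroup K G" and H: "subgroup H G" "H \<subseteq> K"
    and c: "finite (c ` K)" "\<And>x y. x \<in> K \<Longrightarrow> y \<in> K \<Longrightarrow> c x = c y \<Longrightarrow> x \<otimes> inv y \<in> H"
  shows "finite_index_subgroup H (G\<lparr>carrier := K\<rparr>)"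
proof -
  define s where "s x = (SOME y. y \<in> K \<and> c y = c x)" for x
  have s: "s x \<in> K \<and> c (s x) = c x" if "x \<in> K" for x
    unfolding s_def by (rule someI[of _ x]) (use that in auto)
  have "s ` K = (\<lambda>d. SOME y. y \<in> K \<and> c y = d) ` c ` K" by (simp add: s_def image_image)
  then have "finite (s ` K)" using c(1) by simp
  moreover have "x \<otimes> inv y \<in> H" if "x \<in> K" "y \<in> K" "s x = s y" for x y
    using c(2)[of x y] s[of x] s[of y] that by simp
  ultimately show ?thesis using K H unfolding finite_index_subgroup_iff[OF K] by blast
qed

lemma finite_index_subgroupE:
  assumes "finite_index_subgroup H (G\<lparr>carrier := K\<rparr>)" "subgroup K G"
  obtains c :: "'a \<Rightarrow> 'a" where "subgroup H G" "H \<subseteq> K" "finite (c ` K)"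
    "\<And>x y. x \<in> K \<Longrightarrow> y \<in> K \<Longrightarrow> c x = c y \<Longrightarrow> x \<otimes> inv y \<in> H"
proof -
  have *: "subgroup H G \<and> H \<subseteq> K \<and>
      (\<exists>c :: 'a \<Rightarrow> 'a. finite (c ` K) \<and> (\<forall>x\<in>K. \<forall>y\<in>K. c x = c y \<longrightarrow> x \<otimes> inv y \<in> H))"
    using assms(1) unfolding finite_index_subgroup_iff[OF assms(2)] .
  then obtain c :: "'a \<Rightarrow> 'a" where c: "finite (c ` K)"
    "\<forall>x\<in>K. \<forall>y\<in>K. c x = c y \<longrightarrow> x \<otimes> inv y \<in> H" by blast
  show ?thesis
    by (rule that[of c]) (use * c in simp_all)
qed

lemma finite_index_subgroup_Int:
  assumes K: "subgroup K G" and "finite_index_subgroup H (G\<lparr>carrier := K\<rparr>)"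
    and "finite_index_subgroup H' (G\<lparr>carrier := K\<rparr>)"
  shows "finite_index_subgroup (H \<inter> H') (G\<lparr>carrier := K\<rparr>)"
proof -
  obtain c :: "'a \<Rightarrow> 'a" where c: "subgroup H G" "H \<subseteq> K" "finite (c ` K)"
    "\<And>x y. x \<in> K \<Longrightarrow> y \<in> K \<Longrightarrow> c x = c y \<Longrightarrow> x \<otimes> inv y \<in> H"
    by (rule finite_index_subgroupE[OF assms(2) K]) blast
  obtain d :: "'a \<Rightarrow> 'a" where d: "subgroup H' G" "H' \<subseteq> K" "finite (d ` K)"
    "\<And>x y. x \<in> K \<Longrightarrow> y \<in> K \<Longrightarrow> d x = d y \<Longrightarrow> x \<otimes> inv y \<in> H'"
    by (rule finite_index_subgroupE[OF assms(3) K]) blast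
  show ?thesis
  proof (rule finite_index_subgroupI[where c = "\<lambda>x. (c x, d x)"])
    show "finite ((\<lambda>x. (c x, d x)) ` K)"
      by (rule finite_subset[of _ "c ` K \<times> d ` K"]) (use c d in auto)
    show "subgroup (H \<inter> H') G" using c(1) d(1) by (rule subgroups_Inter_pair)
  qed (use K c d in auto)
qed

text \<open>
  The colour of \<open>x\<close> records its coset of \<open>K\<close> and, after division by a representative of that coset,
  the resulting coset of \<open>H\<close>.
\<close>
lemma finite_index_subgroup_trans:
  assumes L: "subgroup L G" and KL: "finite_index_subgroup K (G\<lparr>carrier := L\<rparr>)"
    and HK: "finite_index_subgroup H (G\<lparr>carrier := K\<rparr>)"
  shows "finite_index_subgroup H (G\<lparr>carrier := L\<rparr>)"
proof -
  obtain c :: "'a \<Rightarrow> 'a" where c: "subgroup K G" "K \<subseteq> L" "finite (c ` L)"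
    "\<And>x y. x \<in> L \<Longrightarrow> y \<in> L \<Longrightarrow> c x = c y \<Longrightarrow> x \<otimes> inv y \<in> K"
    by (rule finite_index_subgroupE[OF KL L]) blast
  obtain d :: "'a \<Rightarrow> 'a" where d: "subgroup H G" "H \<subseteq> K" "finite (d ` K)"
    "\<And>x y. x \<in> K \<Longrightarrow> y \<in> K \<Longrightarrow> d x = d y \<Longrightarrow> x \<otimes> inv y \<in> H"
    by (rule finite_index_subgroupE[OF HK c(1)]) blast
  define s where "s e = (SOME y. y \<in> L \<and> c y = e)" for e
  have s: "s (c x) \<in> L \<and> c (s (c x)) = c x" if "x \<in> L" for x
    unfolding s_def by (rule someI[of _ x]) (use that in auto)
  have sK: "x \<otimes> inv (s (c x)) \<in> K" if "x \<in> L" for x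
    using s[OF that] c(4) that by simp
  show ?thesis
  proof (rule finite_index_subgroupI[where c = "\<lambda>x. (c x, d (x \<otimes> inv (s (c x))))"])
    show "finite ((\<lambda>x. (c x, d (x \<otimes> inv (s (c x))))) ` L)"
      by (rule finite_subset[of _ "c ` L \<times> d ` K"]) (use c d sK in auto)
    fix x y assume xy: "x \<in> L" "y \<in> L"
      "(c x, d (x \<otimes> inv (s (c x)))) = (c y, d (y \<otimes> inv (s (c y))))"
    define e where "e = s (c x)"
    have car: "x \<in> carrier G" "y \<in> carrier G" "e \<in> carrier G"
      using xy(1,2) s[OF xy(1)] by (simp_all add: e_def subgroup.mem_carrier[OF L])
    have "(x \<otimes> inv e) \<otimes> inv (y \<otimes> inv e) \<in> H"
    proof (rule d(4))
      show "x \<otimes> inv e \<in> K" using sK[OF xy(1)] by (simp add: e_def)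
      show "y \<otimes> inv e \<in> K" "d (x \<otimes> inv e) = d (y \<otimes> inv e)"
        using sK[OF xy(2)] xy(3) by (auto simp: e_def)
    qed
    also have "(x \<otimes> inv e) \<otimes> inv (y \<otimes> inv e) = (x \<otimes> inv e) \<otimes> (e \<otimes> inv y)"
      using car by (simp add: inv_mult_group)
    also have "\<dots> = x \<otimes> ((inv e \<otimes> e) \<otimes> inv y)"
      using car by (simp only: m_assoc m_closed inv_closed)
    also have "\<dots> = x \<otimes> inv y" using car by simp
    finally show "x \<otimes> inv y \<in> H" .
  qed (use L c d in auto)
qed

lemma finite_index_subgroup_mono:
  assumes L: "subgroup L G" and K: "subgroup K G" "H \<subseteq> K" "K \<subseteq> L"
    and H: "finite_index_subgroup H (G\<lparr>carrier := L\<rparr>)"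
  shows "finite_index_subgroup H (G\<lparr>carrier := K\<rparr>)" "finite_index_subgroup K (G\<lparr>carrier := L\<rparr>)"
proof -
  obtain c :: "'a \<Rightarrow> 'a" where c: "subgroup H G" "H \<subseteq> L" "finite (c ` L)"
    "\<And>x y. x \<in> L \<Longrightarrow> y \<in> L \<Longrightarrow> c x = c y \<Longrightarrow> x \<otimes> inv y \<in> H"
    by (rule finite_index_subgroupE[OF H L]) blast
  show "finite_index_subgroup H (G\<lparr>carrier := K\<rparr>)"
  proof (rule finite_index_subgroupI[where c = c, OF K(1) c(1) K(2)])
    show "finite (c ` K)" by (rule finite_subset[OF image_mono[OF K(3)] c(3)])
    show "x \<otimes> inv y \<in> H" if "x \<in> K" "y \<in> K" "c x = c y" for x y
      using that c(4)[of x y] K(3) by blast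
  qed
  show "finite_index_subgroup K (G\<lparr>carrier := L\<rparr>)"
  proof (rule finite_index_subgroupI[where c = c, OF L K(1,3) c(3)])
    show "x \<otimes> inv y \<in> K" if "x \<in> L" "y \<in> L" "c x = c y" for x y
      using that c(4)[of x y] K(2) by blast
  qed
qed

lemma finite_index_subgroup_vimage:
  assumes K: "subgroup K G" and L: "subgroup L G"
    and \<phi>: "\<phi> \<in> hom (G\<lparr>carrier := K\<rparr>) (G\<lparr>carrier := L\<rparr>)"
    and H: "finite_index_subgroup H (G\<lparr>carrier := L\<rparr>)"
  shows "finite_index_subgroup {x \<in> K. \<phi> x \<in> H} (G\<lparr>carrier := K\<rparr>)"
proof -
  obtain c :: "'a \<Rightarrow> 'a" where c: "subgroup H G" "H \<subseteq> L" "finite (c ` L)"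
    "\<And>x y. x \<in> L \<Longrightarrow> y \<in> L \<Longrightarrow> c x = c y \<Longrightarrow> x \<otimes> inv y \<in> H"
    by (rule finite_index_subgroupE[OF H L]) blast
  interpret \<phi>: group_hom "G\<lparr>carrier := K\<rparr>" "G\<lparr>carrier := L\<rparr>" \<phi>
    by (intro group_hom.intro group_hom_axioms.intro subgroup_imp_group K L \<phi>)
  have mult: "\<phi> (x \<otimes> y) = \<phi> x \<otimes> \<phi> y" if "x \<in> K" "y \<in> K" for x y
    using \<phi>.hom_mult that by simp
  have inv: "\<phi> (inv x) = inv (\<phi> x)" if "x \<in> K" for x
    using \<phi>.hom_inv[of x] that m_inv_consistent[OF K that] m_inv_consistent[OF L, of "\<phi> x"]
      \<phi>.hom_closed[of x] by simp
  have L': "\<phi> x \<in> L" if "x \<in> K" for x using \<phi>.hom_closed[of x] that by simp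
  show ?thesis
  proof (rule finite_index_subgroupI[where c = "c \<circ> \<phi>"])
    show "subgroup {x \<in> K. \<phi> x \<in> H} G"
    proof (rule subgroupI)
      show "{x \<in> K. \<phi> x \<in> H} \<subseteq> carrier G" using subgroup.subset[OF K] by blast
      have "\<one> \<in> K" "\<phi> \<one> = \<one>" using subgroup.one_closed[OF K] \<phi>.hom_one by auto
      then show "{x \<in> K. \<phi> x \<in> H} \<noteq> {}" using subgroup.one_closed[OF c(1)] by force
    qed (use K c(1) mult inv in \<open>auto simp: subgroup.m_inv_closed subgroup.m_closed\<close>)
    show "finite ((c \<circ> \<phi>) ` K)"
      by (rule finite_subset[OF _ c(3)]) (use L' in auto)
    show "x \<otimes> inv y \<in> {x \<in> K. \<phi> x \<in> H}" if "x \<in> K" "y \<in> K" "(c \<circ> \<phi>) x = (c \<circ> \<phi>) y" for x y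
      using that K L' c(4)[of "\<phi> x" "\<phi> y"] mult inv
      by (simp add: subgroup.m_inv_closed subgroup.m_closed)
  qed (use K in auto)
qed

end

section \<open>Continuity in the t-adic topology\<close>

text \<open>
  Membership in the open subgroup \<open>t\<^sup>N\<^sup>+\<^sup>1 \<bbbF>\<^sub>q[[t]]\<close>, in a form that needs no exception for the zero
  series.
\<close>
definition vanishes_upto :: "int \<Rightarrow> 'a::zero fls \<Rightarrow> bool" where
  "vanishes_upto N u \<longleftrightarrow> (\<forall>n\<le>N. fls_nth u n = 0)"

lemma vanishes_upto_iff: "vanishes_upto N u \<longleftrightarrow> u = 0 \<or> N < fls_subdegree u"
proof
  assume "vanishes_upto N u"
  then show "u = 0 \<or> N < fls_subdegree u"
    unfolding vanishes_upto_def using nth_fls_subdegree_nonzero[of u] by (meson not_le)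
qed (auto simp: vanishes_upto_def)

lemma dist_fls_less_iff:
  "dist u v < (1 / 2) ^ N \<longleftrightarrow> vanishes_upto (int N) (u - v :: 'a::group_add fls)"
proof (cases "u = v")
  case False
  show ?thesis
  proof (cases "fls_subdegree (u - v) \<ge> 0")
    case True
    have "dist u v = (1 / 2) ^ nat (fls_subdegree (u - v))"
      using True False by (simp add: dist_fls_def power_one_over inverse_eq_divide)
    moreover have "(1 / 2 :: real) ^ a < (1 / 2) ^ b \<longleftrightarrow> b < a" for a b
      by (rule power_strict_decreasing_iff) auto
    ultimately show ?thesis using True False by (auto simp: vanishes_upto_iff)
  next
    case neg: False
    have "(1::real) \<le> dist u v" using neg False by (simp add: dist_fls_def)
    moreover have "(1 / 2 :: real) ^ N \<le> 1" by (simp add: power_le_one)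
    ultimately have "\<not> dist u v < (1 / 2) ^ N" by linarith
    then show ?thesis using neg False by (simp add: vanishes_upto_iff)
  qed
qed (simp add: vanishes_upto_def)

lemma continuous_on_flsI:
  fixes g :: "'a::group_add fls \<Rightarrow> 'b::group_add fls"
  assumes "\<And>N. \<exists>M. \<forall>u\<in>S. \<forall>v\<in>S. vanishes_upto M (u - v) \<longrightarrow> vanishes_upto N (g u - g v)"
  shows "continuous_on S g"
  unfolding continuous_on_iff
proof (intro ballI allI impI)
  fix u :: "'a fls" and e :: real assume u: "u \<in> S" and "e > 0"
  then obtain N where N: "(1 / 2) ^ N < e" using real_arch_pow_inv[of e "1 / 2"] by auto
  obtain M where M: "\<forall>u\<in>S. \<forall>v\<in>S. vanishes_upto M (u - v) \<longrightarrow> vanishes_upto (int N) (g u - g v)"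
    using assms by blast
  have "dist (g v) (g u) < e" if "v \<in> S" "dist v u < (1 / 2) ^ nat M" for v
  proof -
    have "vanishes_upto (int (nat M)) (v - u)" using that(2) by (simp only: dist_fls_less_iff)
    then have "vanishes_upto M (v - u)" by (auto simp: vanishes_upto_def)
    then have "vanishes_upto (int N) (g v - g u)" using M that u by blast
    then have "dist (g v) (g u) < (1 / 2) ^ N" by (simp only: dist_fls_less_iff)
    then show ?thesis using N by linarith
  qed
  moreover have "(0::real) < (1 / 2) ^ nat M" by simp
  ultimately show "\<exists>d>0. \<forall>v\<in>S. dist v u < d \<longrightarrow> dist (g v) (g u) < e" by blast
qed

lemma vanishes_upto_mult:
  fixes a u :: "'a::field fls"
  assumes "vanishes_upto (N - fls_subdegree a) u"
  shows "vanishes_upto N (a * u)"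
proof (cases "a = 0 \<or> u = 0")
  case False
  then show ?thesis using assms by (auto simp: vanishes_upto_iff)
qed (auto simp: vanishes_upto_def)

lemma continuous_on_fls_mult_left: "continuous_on S (\<lambda>u. a * u :: 'a::field fls)"
  by (rule continuous_on_flsI) (metis right_diff_distrib vanishes_upto_mult)

lemma tendsto_fls_iff:
  "(f \<longlongrightarrow> (a :: 'a::group_add fls)) F \<longleftrightarrow> (\<forall>N. eventually (\<lambda>x. vanishes_upto N (f x - a)) F)"
proof
  assume f: "(f \<longlongrightarrow> a) F"
  show "\<forall>N. eventually (\<lambda>x. vanishes_upto N (f x - a)) F"
  proof
    fix N
    have "eventually (\<lambda>x. dist (f x) a < (1 / 2) ^ nat N) F" using f by (rule tendstoD) simp
    then show "eventually (\<lambda>x. vanishes_upto N (f x - a)) F"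
      by (rule eventually_mono) (auto simp: dist_fls_less_iff vanishes_upto_def)
  qed
next
  assume *: "\<forall>N. eventually (\<lambda>x. vanishes_upto N (f x - a)) F"
  show "(f \<longlongrightarrow> a) F"
  proof (rule tendstoI)
    fix e :: real assume "e > 0"
    then obtain N where N: "(1 / 2) ^ N < e" using real_arch_pow_inv[of e "1 / 2"] by auto
    have "eventually (\<lambda>x. vanishes_upto (int N) (f x - a)) F" using * by blast
    then show "eventually (\<lambda>x. dist (f x) a < e) F"
      by (rule eventually_mono) (use N in \<open>auto simp flip: dist_fls_less_iff\<close>)
  qed
qed

lemma vanishes_upto_add: "vanishes_upto N u \<Longrightarrow> vanishes_upto N v \<Longrightarrow> vanishes_upto N (u + v :: 'a::monoid_add fls)"
  by (simp add: vanishes_upto_def)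

lemma continuous_on_fls_add:
  fixes f g :: "'c::topological_space \<Rightarrow> 'a::ab_group_add fls"
  assumes "continuous_on S f" "continuous_on S g"
  shows "continuous_on S (\<lambda>x. f x + g x)"
  unfolding continuous_on_def tendsto_fls_iff
proof (intro ballI allI)
  fix x N assume x: "x \<in> S"
  have "\<forall>\<^sub>F y in at x within S. vanishes_upto N (f y - f x)"
    "\<forall>\<^sub>F y in at x within S. vanishes_upto N (g y - g x)"
    using assms x unfolding continuous_on_def tendsto_fls_iff by blast+
  then show "\<forall>\<^sub>F y in at x within S. vanishes_upto N (f y + g y - (f x + g x))"
  proof eventually_elim
    case (elim y)
    then have "vanishes_upto N ((f y - f x) + (g y - g x))" by (rule vanishes_upto_add)
    then show ?case by (simp add: algebra_simps)
  qed
qed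

section \<open>The group and its integral points\<close>

text \<open>
  An isomorphism between finite-index subgroups of \<open>\<Gamma>\<close> can be transported to \<open>\<Gamma>\<^sub>0\<close>: restrict it to
  the elements of \<open>\<Gamma>\<^sub>0\<close> whose images lie in \<open>\<Gamma>\<^sub>0\<close> too.
\<close>
lemma (in group) commensurable_restriction:
  assumes \<Gamma>: "subgroup \<Gamma> G" and \<Gamma>0: "subgroup \<Gamma>\<^sub>0 G" and com: "commensurable G \<Gamma> \<Gamma>\<^sub>0"
    and \<Gamma>1: "finite_index_subgroup \<Gamma>\<^sub>1 (G\<lparr>carrier := \<Gamma>\<rparr>)"
    and \<Gamma>2: "finite_index_subgroup \<Gamma>\<^sub>2 (G\<lparr>carrier := \<Gamma>\<rparr>)"
    and \<phi>: "\<phi> \<in> iso (G\<lparr>carrier := \<Gamma>\<^sub>1\<rparr>) (G\<lparr>carrier := \<Gamma>\<^sub>2\<rparr>)"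
  obtains \<Delta>\<^sub>1 \<Delta>\<^sub>2 where
    "finite_index_subgroup \<Delta>\<^sub>1 (G\<lparr>carrier := \<Gamma>\<^sub>1\<rparr>)"
    "finite_index_subgroup \<Delta>\<^sub>1 (G\<lparr>carrier := \<Gamma>\<^sub>0\<rparr>)" "finite_index_subgroup \<Delta>\<^sub>2 (G\<lparr>carrier := \<Gamma>\<^sub>0\<rparr>)"
    "\<phi> \<in> iso (G\<lparr>carrier := \<Delta>\<^sub>1\<rparr>) (G\<lparr>carrier := \<Delta>\<^sub>2\<rparr>)"
proof -
  have sub1: "subgroup \<Gamma>\<^sub>1 G" "\<Gamma>\<^sub>1 \<subseteq> \<Gamma>" by (rule finite_index_subgroupE[OF \<Gamma>1 \<Gamma>], blast)+
  have sub2: "subgroup \<Gamma>\<^sub>2 G" "\<Gamma>\<^sub>2 \<subseteq> \<Gamma>" by (rule finite_index_subgroupE[OF \<Gamma>2 \<Gamma>], blast)+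
  have I: "finite_index_subgroup (\<Gamma> \<inter> \<Gamma>\<^sub>0) (G\<lparr>carrier := \<Gamma>\<rparr>)"
    "finite_index_subgroup (\<Gamma> \<inter> \<Gamma>\<^sub>0) (G\<lparr>carrier := \<Gamma>\<^sub>0\<rparr>)"
    using com by (simp_all add: commensurable_def)
  have sub0: "subgroup (\<Gamma> \<inter> \<Gamma>\<^sub>0) G" using \<Gamma> \<Gamma>0 by (rule subgroups_Inter_pair)
  have meet: "finite_index_subgroup (A \<inter> \<Gamma>\<^sub>0) (G\<lparr>carrier := A\<rparr>)"
    if A: "finite_index_subgroup A (G\<lparr>carrier := \<Gamma>\<rparr>)" "subgroup A G" "A \<subseteq> \<Gamma>" for A
  proof -
    have "finite_index_subgroup (A \<inter> (\<Gamma> \<inter> \<Gamma>\<^sub>0)) (G\<lparr>carrier := \<Gamma>\<rparr>)"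
      using finite_index_subgroup_Int[OF \<Gamma> A(1) I(1)] .
    moreover have "A \<inter> (\<Gamma> \<inter> \<Gamma>\<^sub>0) = A \<inter> \<Gamma>\<^sub>0" using A(3) by blast
    ultimately show ?thesis
      using finite_index_subgroup_mono(1)[OF \<Gamma> A(2) _ A(3)] by simp
  qed
  have up: "finite_index_subgroup B (G\<lparr>carrier := \<Gamma>\<^sub>0\<rparr>)"
    if B: "finite_index_subgroup B (G\<lparr>carrier := A\<rparr>)" "B \<subseteq> \<Gamma>\<^sub>0"
      and A: "finite_index_subgroup A (G\<lparr>carrier := \<Gamma>\<rparr>)" "subgroup A G" "A \<subseteq> \<Gamma>" for A B
  proof -
    have "B \<subseteq> A" by (rule finite_index_subgroupE[OF B(1) A(2)]) blast
    then have "B \<subseteq> \<Gamma> \<inter> \<Gamma>\<^sub>0" using A(3) B(2) by blast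
    moreover have "finite_index_subgroup B (G\<lparr>carrier := \<Gamma>\<rparr>)"
      using finite_index_subgroup_trans[OF \<Gamma> A(1) B(1)] .
    ultimately have "finite_index_subgroup B (G\<lparr>carrier := \<Gamma> \<inter> \<Gamma>\<^sub>0\<rparr>)"
      using finite_index_subgroup_mono(1)[OF \<Gamma> sub0] by blast
    then show ?thesis using finite_index_subgroup_trans[OF \<Gamma>0 I(2)] by blast
  qed
  define \<psi> where "\<psi> = inv_into \<Gamma>\<^sub>1 \<phi>"
  have bij: "bij_betw \<phi> \<Gamma>\<^sub>1 \<Gamma>\<^sub>2" and hom: "\<phi> \<in> hom (G\<lparr>carrier := \<Gamma>\<^sub>1\<rparr>) (G\<lparr>carrier := \<Gamma>\<^sub>2\<rparr>)"
    using \<phi> by (auto simp: iso_def)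
  have "\<psi> \<in> iso (G\<lparr>carrier := \<Gamma>\<^sub>2\<rparr>) (G\<lparr>carrier := \<Gamma>\<^sub>1\<rparr>)"
    using group.iso_set_sym[OF subgroup_imp_group[OF sub1(1)] \<phi>] by (simp add: \<psi>_def)
  then have hom': "\<psi> \<in> hom (G\<lparr>carrier := \<Gamma>\<^sub>2\<rparr>) (G\<lparr>carrier := \<Gamma>\<^sub>1\<rparr>)" by (simp add: iso_def)
  define \<Delta>\<^sub>1 where "\<Delta>\<^sub>1 = \<Gamma>\<^sub>1 \<inter> \<Gamma>\<^sub>0 \<inter> {x \<in> \<Gamma>\<^sub>1. \<phi> x \<in> \<Gamma>\<^sub>2 \<inter> \<Gamma>\<^sub>0}"
  define \<Delta>\<^sub>2 where "\<Delta>\<^sub>2 = {y \<in> \<Gamma>\<^sub>2. \<psi> y \<in> \<Delta>\<^sub>1}"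
  have \<Delta>1: "finite_index_subgroup \<Delta>\<^sub>1 (G\<lparr>carrier := \<Gamma>\<^sub>1\<rparr>)"
    unfolding \<Delta>\<^sub>1_def
    using finite_index_subgroup_Int[OF sub1(1) meet[OF \<Gamma>1 sub1]
        finite_index_subgroup_vimage[OF sub1(1) sub2(1) hom meet[OF \<Gamma>2 sub2]]] .
  have \<Delta>2: "finite_index_subgroup \<Delta>\<^sub>2 (G\<lparr>carrier := \<Gamma>\<^sub>2\<rparr>)"
    unfolding \<Delta>\<^sub>2_def using finite_index_subgroup_vimage[OF sub2(1) sub1(1) hom' \<Delta>1] .
  have inv: "\<phi> (\<psi> y) = y" if "y \<in> \<Gamma>\<^sub>2" for y
    unfolding \<psi>_def using bij that by (rule bij_betw_inv_into_right)
  have inv': "\<psi> (\<phi> x) = x" if "x \<in> \<Gamma>\<^sub>1" for x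
    unfolding \<psi>_def using bij that by (rule bij_betw_inv_into_left)
  have image: "\<phi> ` \<Delta>\<^sub>1 = \<Delta>\<^sub>2"
  proof (intro equalityI subsetI)
    fix y assume "y \<in> \<phi> ` \<Delta>\<^sub>1"
    then obtain x where x: "x \<in> \<Delta>\<^sub>1" "y = \<phi> x" by blast
    then have "x \<in> \<Gamma>\<^sub>1" "\<phi> x \<in> \<Gamma>\<^sub>2" by (auto simp: \<Delta>\<^sub>1_def)
    then show "y \<in> \<Delta>\<^sub>2" using x inv' by (simp add: \<Delta>\<^sub>2_def)
  next
    fix y assume "y \<in> \<Delta>\<^sub>2"
    then have "y \<in> \<Gamma>\<^sub>2" "\<psi> y \<in> \<Delta>\<^sub>1" by (auto simp: \<Delta>\<^sub>2_def)
    then show "y \<in> \<phi> ` \<Delta>\<^sub>1" using inv by (metis imageI)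
  qed
  show ?thesis
  proof (rule that[OF \<Delta>1 up[OF \<Delta>1 _ \<Gamma>1 sub1] up[OF \<Delta>2 _ \<Gamma>2 sub2]])
    show "\<Delta>\<^sub>1 \<subseteq> \<Gamma>\<^sub>0" by (auto simp: \<Delta>\<^sub>1_def)
    show "\<Delta>\<^sub>2 \<subseteq> \<Gamma>\<^sub>0" unfolding image[symmetric] by (auto simp: \<Delta>\<^sub>1_def)
    have "\<Delta>\<^sub>1 \<subseteq> \<Gamma>\<^sub>1" by (auto simp: \<Delta>\<^sub>1_def)
    then show "\<phi> \<in> iso (G\<lparr>carrier := \<Delta>\<^sub>1\<rparr>) (G\<lparr>carrier := \<Delta>\<^sub>2\<rparr>)"
      using hom bij image by (auto simp: iso_def hom_def bij_betw_def inj_on_subset)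
  qed
qed

lemma G2_elt_nth [simp]:
  "G2_elt r y z $ 1 $ 1 = 1" "G2_elt r y z $ 1 $ 2 = y ^ r" "G2_elt r y z $ 1 $ 3 = z"
  "G2_elt r y z $ 2 $ 1 = 0" "G2_elt r y z $ 2 $ 2 = 1" "G2_elt r y z $ 2 $ 3 = y"
  "G2_elt r y z $ 3 $ 1 = 0" "G2_elt r y z $ 3 $ 2 = 0" "G2_elt r y z $ 3 $ 3 = 1"
  by (simp_all add: G2_elt_def)

lemma G2_elt_eq_iff [simp]: "G2_elt r y z = G2_elt r y' z' \<longleftrightarrow> y = y' \<and> z = z'"
  by (metis G2_elt_nth(3,6))

lemma G2_elt_in_G2 [simp]: "G2_elt r y z \<in> G2 r"
  by (auto simp: G2_def)

lemma G2_elt_coordinates: "x \<in> G2 r \<Longrightarrow> G2_elt r (x $ 2 $ 3) (x $ 1 $ 3) = x"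
  by (auto simp: G2_def)

lemma GL_mult [simp]: "x \<otimes>\<^bsub>GL\<^esub> y = x ** y"
  by (simp add: GL_def)

lemma GL_one: "\<one>\<^bsub>GL\<^esub> = mat 1"
  by (simp add: GL_def)

definition int_elt :: "nat \<Rightarrow> 'k::field poly \<Rightarrow> 'k poly \<Rightarrow> 'k fls ^ 3 ^ 3" where
  "int_elt r p q = G2_elt r (inv_eval p) (inv_eval q)"

text \<open>
  The coordinates of an integral point. They are defined for all matrices, by taking polynomial parts,
  because \<open>y_poly\<close> is also needed on all of \<open>G\<^sub>2\<close>.
\<close>
definition y_poly :: "'k::field fls ^ 3 ^ 3 \<Rightarrow> 'k poly" where
  "y_poly x = poly_part (x $ 2 $ 3)"

definition z_poly :: "'k::field fls ^ 3 ^ 3 \<Rightarrow> 'k poly" where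
  "z_poly x = poly_part (x $ 1 $ 3)"

lemma coordinates_int_elt [simp]: "y_poly (int_elt r p q) = p" "z_poly (int_elt r p q) = q"
  by (simp_all add: int_elt_def y_poly_def z_poly_def)

locale char_power =
  fixes k_type :: "'k::{field,finite} itself" and p m s r :: nat
  assumes p: "prime p" and q: "CARD('k) = p ^ m" and r: "r = p ^ s"
begin

lemma char_k: "CHAR('k) = p"
proof -
  have "prime CHAR('k)"
    by (simp add: finite_imp_CHAR_pos prime_CHAR_semidom)
  moreover have "CHAR('k) dvd p ^ m"
    using CHAR_dvd_CARD[where ?'a = 'k] q by simp
  ultimately show ?thesis
    using p by (meson prime_dvd_power primes_dvd_imp_eq)
qed

lemma r_gt_0: "0 < r" using p r by (simp add: prime_gt_0_nat)

lemma fls_frob_add: "(x + y :: 'k fls) ^ r = x ^ r + y ^ r"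
  using p by (intro freshmans_dream'[where n = s]) (auto simp: r char_k)

lemma fls_frob_diff: "(x - y :: 'k fls) ^ r = x ^ r - y ^ r"
  using fls_frob_add[of "x - y" y] by simp

lemma fls_frob_minus: "(- x :: 'k fls) ^ r = - (x ^ r)"
  using fls_frob_diff[of 0 x] r_gt_0 by (simp add: zero_power)

lemma mult: "G2_elt r y z ** G2_elt r y' z' = G2_elt r (y + y') (z + z' + y ^ r * y' :: 'k fls)"
  by (rule G2_elt_mult[OF fls_frob_add])

lemma mat_1: "mat 1 = G2_elt r 0 (0 :: 'k fls)"
  using r_gt_0 by (simp add: mat_def vec_eq_iff forall_3 zero_power)

interpretation GL: group "GL :: ('k fls ^ 3 ^ 3) monoid" by (rule group_GL)

lemma subgroup_G2': "subgroup (G2 r) (GL :: ('k fls ^ 3 ^ 3) monoid)"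
  by (rule subgroup_G2[OF p q r])

lemma G2_elt_carrier: "G2_elt r y (z :: 'k fls) \<in> carrier GL"
  using subgroup.subset[OF subgroup_G2'] G2_elt_in_G2 by blast

lemma G2_elt_inv: "inv\<^bsub>GL\<^esub> (G2_elt r y (z :: 'k fls)) = G2_elt r (- y) (- z + y ^ r * y)"
  by (rule GL.inv_equality)
    (simp_all add: GL_one mult mat_1 fls_frob_minus G2_elt_carrier)

lemma G2_elt_mult_inv:
  "G2_elt r y z ** inv\<^bsub>GL\<^esub> (G2_elt r y' z') = G2_elt r (y - y') (z - z' - (y - y') ^ r * y' :: 'k fls)"
  by (simp add: G2_elt_inv mult fls_frob_diff algebra_simps)

lemma integral_points: "GL_minus \<inter> G2 r = {int_elt r a b | a b :: 'k poly. True}"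
proof (intro equalityI subsetI)
  fix x :: "'k fls ^ 3 ^ 3" assume x: "x \<in> GL_minus \<inter> G2 r"
  then have "x $ 2 $ 3 \<in> range inv_eval" "x $ 1 $ 3 \<in> range inv_eval"
    by (auto simp: GL_minus_def F_minus_eq_range_inv_eval)
  then obtain a b where "x $ 2 $ 3 = inv_eval a" "x $ 1 $ 3 = inv_eval b" by auto
  then have "x = int_elt r a b" using x G2_elt_coordinates[of x r] by (simp add: int_elt_def)
  then show "x \<in> {int_elt r a b | a b. True}" by blast
next
  fix x :: "'k fls ^ 3 ^ 3" assume "x \<in> {int_elt r a b | a b. True}"
  then obtain a b where x: "x = int_elt r a b" by blast
  have F: "\<forall>i j. int_elt r c d $ i $ j \<in> F_minus" for c d :: "'k poly"
    unfolding F_minus_eq_range_inv_eval int_elt_def forall_3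
    by (auto simp flip: inv_eval_power) (metis inv_eval_1 rangeI inv_eval_0)+
  define y where "y = int_elt r (- a) (- b + a ^ r * a)"
  have minus: "inv_eval (- c) = - inv_eval c" for c :: "'k poly"
    using inv_eval_diff[of 0 c] by simp
  have xy: "x ** y = mat 1" "y ** x = mat 1"
    by (simp_all add: x y_def int_elt_def mult mat_1 inv_eval_add inv_eval_diff minus inv_eval_mult inv_eval_power fls_frob_minus)
  have "\<forall>i j. x $ i $ j \<in> F_minus" "\<forall>i j. y $ i $ j \<in> F_minus"
    unfolding x y_def by (rule F)+
  with xy have "x \<in> GL_minus" unfolding GL_minus_def by blast
  moreover have "x \<in> G2 r" by (simp add: x int_elt_def)
  ultimately show "x \<in> GL_minus \<inter> G2 r" by blast
qed

abbreviation "\<Gamma>\<^sub>0 \<equiv> GL_minus \<inter> (G2 r :: ('k fls ^ 3 ^ 3) set)"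

lemma int_elt_mult: "int_elt r a b ** int_elt r a' b' = int_elt r (a + a') (b + b' + a ^ r * a' :: 'k poly)"
  by (simp add: int_elt_def mult inv_eval_add inv_eval_mult inv_eval_power)

lemma int_elt_mult_inv:
  "int_elt r a b ** inv\<^bsub>GL\<^esub> (int_elt r a' b') = int_elt r (a - a') (b - b' - (a - a') ^ r * a' :: 'k poly)"
  by (simp add: int_elt_def G2_elt_mult_inv inv_eval_diff inv_eval_mult inv_eval_power)

lemma int_elt_in [simp]: "int_elt r a (b :: 'k poly) \<in> \<Gamma>\<^sub>0"
  unfolding integral_points by blast

lemma integral_cases:
  assumes "x \<in> \<Gamma>\<^sub>0" obtains a b where "x = int_elt r a b"
  using assms unfolding integral_points by blast

lemma int_elt_coordinates: "x \<in> \<Gamma>\<^sub>0 \<Longrightarrow> int_elt r (y_poly x) (z_poly x) = x"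
  by (elim integral_cases) simp

lemma coordinates_of_integral:
  assumes "x \<in> \<Gamma>\<^sub>0"
  shows "x $ 2 $ 3 = inv_eval (y_poly x)" "x $ 1 $ 3 = inv_eval (z_poly x)"
  using assms by (elim integral_cases, simp add: int_elt_def y_poly_def z_poly_def)+

lemma poly_mult:
  assumes "x \<in> \<Gamma>\<^sub>0" "y \<in> \<Gamma>\<^sub>0"
  shows "y_poly (x ** y) = y_poly x + y_poly y"
    "z_poly (x ** y) = z_poly x + z_poly y + y_poly x ^ r * y_poly y"
proof -
  obtain a b a' b' where "x = int_elt r a b" "y = int_elt r a' b'"
    using assms by (meson integral_cases)
  then show "y_poly (x ** y) = y_poly x + y_poly y"
    "z_poly (x ** y) = z_poly x + z_poly y + y_poly x ^ r * y_poly y"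
    by (simp_all add: int_elt_mult)
qed

lemma y_poly_mult_inv:
  assumes "x \<in> \<Gamma>\<^sub>0" "y \<in> \<Gamma>\<^sub>0"
  shows "y_poly (x ** inv\<^bsub>GL\<^esub> y) = y_poly x - y_poly y"
proof -
  obtain a b a' b' where "x = int_elt r a b" "y = int_elt r a' b'"
    using assms by (meson integral_cases)
  then show ?thesis by (simp add: int_elt_mult_inv)
qed

lemma subgroup_integral_points: "subgroup \<Gamma>\<^sub>0 (GL :: ('k fls ^ 3 ^ 3) monoid)"
proof (rule GL.subgroupI)
  show "\<Gamma>\<^sub>0 \<subseteq> carrier (GL :: ('k fls ^ 3 ^ 3) monoid)"
    using subgroup.subset[OF subgroup_G2'] by blast
  show "\<Gamma>\<^sub>0 \<noteq> {}" using int_elt_in by blast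
  show "x \<otimes>\<^bsub>GL\<^esub> y \<in> \<Gamma>\<^sub>0" if "x \<in> \<Gamma>\<^sub>0" "y \<in> \<Gamma>\<^sub>0" for x y
  proof -
    obtain a b a' b' where "x = int_elt r a b" "y = int_elt r a' b'"
      using \<open>x \<in> \<Gamma>\<^sub>0\<close> \<open>y \<in> \<Gamma>\<^sub>0\<close> by (meson integral_cases)
    then have "x ** y \<in> \<Gamma>\<^sub>0" by (simp only: int_elt_mult int_elt_in)
    then show ?thesis by (simp only: GL_mult)
  qed
  show "inv\<^bsub>GL\<^esub> x \<in> \<Gamma>\<^sub>0" if "x \<in> \<Gamma>\<^sub>0" for x
  proof -
    obtain a b where x: "x = int_elt r a b" using \<open>x \<in> \<Gamma>\<^sub>0\<close> by (rule integral_cases)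
    have "mat 1 = int_elt r 0 (0 :: 'k poly)" by (simp add: mat_1 int_elt_def)
    then have "mat 1 ** inv\<^bsub>GL\<^esub> x \<in> \<Gamma>\<^sub>0" by (simp only: x int_elt_mult_inv int_elt_in)
    then show ?thesis by simp
  qed
qed

end

lemma int_elt_eq_iff [simp]: "int_elt r a b = int_elt r a' b' \<longleftrightarrow> a = a' \<and> b = b'"
  by (simp add: int_elt_def)

lemma finite_image_factor:
  assumes "finite (c ` A)" "\<And>x y. x \<in> A \<Longrightarrow> y \<in> A \<Longrightarrow> c x = c y \<Longrightarrow> f x = f y"
  shows "finite (f ` A)"
proof -
  have "f ` A \<subseteq> (\<lambda>d. f (SOME x. x \<in> A \<and> c x = d)) ` c ` A"
  proof
    fix z assume "z \<in> f ` A"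
    then obtain x where x: "x \<in> A" "z = f x" by blast
    define y where "y = (SOME y. y \<in> A \<and> c y = c x)"
    have "y \<in> A \<and> c y = c x" unfolding y_def by (rule someI[of _ x]) (use x in auto)
    then have "z = f y" using assms(2)[of x y] x by simp
    then show "z \<in> (\<lambda>d. f (SOME x. x \<in> A \<and> c x = d)) ` c ` A"
      using x(1) unfolding y_def by blast
  qed
  then show ?thesis using assms(1) by (meson finite_imageI finite_subset)
qed

lemma finite_index_add_ideal_multiple:
  fixes D :: "'k::{field,finite} poly"
  assumes V: "finite_index_add V" and D: "D \<noteq> 0"
  shows "finite_index_add ((*) D ` V)"
proof -
  obtain c :: "'k poly \<Rightarrow> 'k poly" where c: "finite (range c)" "\<And>x y. c x = c y \<Longrightarrow> x - y \<in> V"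
    by (rule finite_index_addE[OF V]) blast
  show ?thesis
  proof (rule finite_index_addI[where c = "\<lambda>q. (q mod D, c (q div D))"])
    show "0 \<in> (*) D ` V" using finite_index_add_zero[OF V] by force
    show "x - y \<in> (*) D ` V" if xy: "x \<in> (*) D ` V" "y \<in> (*) D ` V" for x y
    proof -
      obtain u v where "u \<in> V" "v \<in> V" "x = D * u" "y = D * v" using xy by blast
      then show ?thesis
        using finite_index_add_diff[OF V, of u v] by (intro image_eqI[of _ _ "u - v"]) (auto simp: algebra_simps)
    qed
    show "finite (range (\<lambda>q. (q mod D, c (q div D))))"
    proof (rule finite_subset)
      show "range (\<lambda>q. (q mod D, c (q div D))) \<subseteq> {p. degree p \<le> degree D} \<times> range c"
        using degree_mod_less[OF D] by (auto intro: less_imp_le) (metis degree_0 less_imp_le zero_le)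
      show "finite ({p :: 'k poly. degree p \<le> degree D} \<times> range c)"
        using c(1) finite_polys_bounded_degree by blast
    qed
    show "x - y \<in> (*) D ` V" if "(x mod D, c (x div D)) = (y mod D, c (y div D))" for x y
    proof (rule image_eqI)
      show "x div D - y div D \<in> V" using that by (intro c(2)) simp
      have "x = D * (x div D) + x mod D" "y = D * (y div D) + y mod D" by simp_all
      then show "x - y = D * (x div D - y div D)"
        using that by (metis (no_types, lifting) Pair_inject add_diff_cancel_right right_diff_distrib')
    qed
  qed
qed

section \<open>Isomorphisms between lattices in the noncommutative case\<close>

locale lattice_isomorphism = char_power k_type p m s r
  for k_type :: "'k::{field,finite} itself" and p m s r :: nat +
  fixes \<Delta>\<^sub>1 \<Delta>\<^sub>2 :: "('k fls ^ 3 ^ 3) set" and \<phi>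
  assumes s: "0 < s"
    and \<Delta>1: "finite_index_subgroup \<Delta>\<^sub>1 (GL\<lparr>carrier := GL_minus \<inter> G2 r\<rparr>)"
    and \<Delta>2: "finite_index_subgroup \<Delta>\<^sub>2 (GL\<lparr>carrier := GL_minus \<inter> G2 r\<rparr>)"
    and \<phi>: "\<phi> \<in> iso (GL\<lparr>carrier := \<Delta>\<^sub>1\<rparr>) (GL\<lparr>carrier := \<Delta>\<^sub>2\<rparr>)"
begin

interpretation GL: group "GL :: ('k fls ^ 3 ^ 3) monoid" by (rule group_GL)

sublocale frobenius_power k_type r s
  by unfold_locales (use s r char_k in auto)

context
  fixes \<Delta> :: "('k fls ^ 3 ^ 3) set"
  assumes \<Delta>: "finite_index_subgroup \<Delta> (GL\<lparr>carrier := \<Gamma>\<^sub>0\<rparr>)"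
begin

lemma lattice_subgroup: "subgroup \<Delta> GL" and lattice_integral: "x \<in> \<Delta> \<Longrightarrow> x \<in> \<Gamma>\<^sub>0"
  by (rule GL.finite_index_subgroupE[OF \<Delta> subgroup_integral_points], blast)+

lemma lattice_mult: "x \<in> \<Delta> \<Longrightarrow> y \<in> \<Delta> \<Longrightarrow> x ** y \<in> \<Delta>"
  using subgroup.m_closed[OF lattice_subgroup, of x y] by simp

lemma lattice_mult_inv: "x \<in> \<Delta> \<Longrightarrow> y \<in> \<Delta> \<Longrightarrow> x ** inv\<^bsub>GL\<^esub> y \<in> \<Delta>"
  using lattice_mult subgroup.m_inv_closed[OF lattice_subgroup] by blast

lemma lattice_mult_inv_cancel:
  assumes "x \<in> \<Delta>" "y \<in> \<Delta>"
  shows "(x ** inv\<^bsub>GL\<^esub> y) ** y = x"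
proof -
  have "(x \<otimes>\<^bsub>GL\<^esub> inv\<^bsub>GL\<^esub> y) \<otimes>\<^bsub>GL\<^esub> y = x"
    using assms subgroup.mem_carrier[OF lattice_subgroup] by (simp add: GL.m_assoc del: GL_mult)
  then show ?thesis by simp
qed

lemma lattice_carrier: "x \<in> \<Delta> \<Longrightarrow> x \<in> carrier GL"
  using subgroup.mem_carrier[OF lattice_subgroup] .

lemma projection_finite_index: "finite_index_add (y_poly ` \<Delta>)"
proof -
  obtain c :: "'k fls ^ 3 ^ 3 \<Rightarrow> 'k fls ^ 3 ^ 3" where c: "finite (c ` \<Gamma>\<^sub>0)"
    "\<And>x y. x \<in> \<Gamma>\<^sub>0 \<Longrightarrow> y \<in> \<Gamma>\<^sub>0 \<Longrightarrow> c x = c y \<Longrightarrow> x \<otimes>\<^bsub>GL\<^esub> inv\<^bsub>GL\<^esub> y \<in> \<Delta>"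
    by (rule GL.finite_index_subgroupE[OF \<Delta> subgroup_integral_points]) blast
  show ?thesis
  proof (rule finite_index_addI[where c = "\<lambda>a. c (int_elt r a 0)"])
    have "mat 1 \<in> \<Delta>" using subgroup.one_closed[OF lattice_subgroup] by (simp add: GL_one)
    moreover have "y_poly (mat 1 :: 'k fls ^ 3 ^ 3) = 0" by (simp add: mat_1 y_poly_def poly_part_eq_0_iff)
    ultimately show "0 \<in> y_poly ` \<Delta>" by force
    show "a - b \<in> y_poly ` \<Delta>" if ab: "a \<in> y_poly ` \<Delta>" "b \<in> y_poly ` \<Delta>" for a b
    proof -
      obtain x y where "x \<in> \<Delta>" "y \<in> \<Delta>" "a = y_poly x" "b = y_poly y" using ab by blast
      then show ?thesis
        using lattice_mult_inv y_poly_mult_inv lattice_integral by (intro image_eqI[of _ _ "x ** inv\<^bsub>GL\<^esub> y"]) auto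
    qed
    show "finite (range (\<lambda>a. c (int_elt r a 0)))"
      by (rule finite_subset[OF _ c(1)]) (use int_elt_in in blast)
    show "a - b \<in> y_poly ` \<Delta>" if "c (int_elt r a 0) = c (int_elt r b 0)" for a b
    proof -
      have "int_elt r a 0 ** inv\<^bsub>GL\<^esub> (int_elt r b 0) \<in> \<Delta>"
        using c(2)[OF int_elt_in int_elt_in that] by simp
      then show ?thesis
        by (rule rev_image_eqI) (simp add: int_elt_mult_inv)
    qed
  qed
qed

lemma commute_iff:
  assumes "x \<in> \<Gamma>\<^sub>0" "y \<in> \<Gamma>\<^sub>0"
  shows "x ** y = y ** x \<longleftrightarrow> G2_commutator r (y_poly x) (y_poly y) = 0"
proof -
  obtain a b a' b' where "x = int_elt r a b" "y = int_elt r a' b'"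
    using assms by (meson integral_cases)
  then show ?thesis
    by (auto simp: int_elt_mult G2_commutator_def algebra_simps)
qed

text \<open>
  If \<open>u = y_poly x\<close> is nonzero and \<open>x\<close> commutes with a point over \<open>v \<noteq> 0\<close>, then \<open>u\<^sup>r v = u v\<^sup>r\<close>, and
  as \<open>r > 1\<close>, the degrees of \<open>u\<close> and \<open>v\<close> agree. This leaves finitely many \<open>v\<close>, but the projection
  of \<open>\<Delta>\<close> is infinite. So the centre is described without reference to coordinates, and isomorphisms
  preserve it.
\<close>
lemma central_iff:
  assumes x: "x \<in> \<Delta>"
  shows "(\<forall>y\<in>\<Delta>. x ** y = y ** x) \<longleftrightarrow> y_poly x = 0"
proof
  assume *: "\<forall>y\<in>\<Delta>. x ** y = y ** x"
  show "y_poly x = 0"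
  proof (rule ccontr)
    define u where "u = y_poly x"
    assume "y_poly x \<noteq> 0"
    then have u: "u \<noteq> 0" by (simp add: u_def)
    have "degree v \<le> degree u" if "v \<in> y_poly ` \<Delta>" for v
    proof (cases "v = 0")
      case False
      have "G2_commutator r u v = 0" using that * x commute_iff lattice_integral by (auto simp: u_def)
      then have "u ^ r * v = u * v ^ r" by (simp add: G2_commutator_def)
      then have "degree (u ^ r * v) = degree (u * v ^ r)" by simp
      then have eq: "r * degree u + degree v = degree u + r * degree v"
        using u False by (simp add: degree_mult_eq degree_power_eq)
      define r' where "r' = r - 2"
      have r': "r = Suc (Suc r')" using r_ge_2 by (simp add: r'_def)
      have "Suc r' * degree u = Suc r' * degree v" using eq by (simp add: r')
      then show ?thesis by (simp only: mult_cancel1) simp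
    qed simp
    then have "y_poly ` \<Delta> \<subseteq> {v. degree v \<le> degree u}" by blast
    then have "finite (y_poly ` \<Delta>)" using finite_polys_bounded_degree finite_subset by blast
    then show False using finite_index_add_infinite[OF projection_finite_index infinite_UNIV_poly] by blast
  qed
next
  assume "y_poly x = 0"
  then show "\<forall>y\<in>\<Delta>. x ** y = y ** x"
    using commute_iff[of x] x lattice_integral r_pos by (auto simp: G2_commutator_def zero_power)
qed

definition commutator where
  "commutator x y = (x ** y) ** inv\<^bsub>GL\<^esub> (y ** x)"

lemma commutator_eq:
  assumes "x \<in> \<Delta>" "y \<in> \<Delta>"
  shows "commutator x y = int_elt r 0 (G2_commutator r (y_poly x) (y_poly y))"
    "commutator x y \<in> \<Delta>"
    "int_elt r 0 (G2_commutator r (y_poly x) (y_poly y)) ** (y ** x) = x ** y"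
proof -
  obtain a b a' b' where xy: "x = int_elt r a b" "y = int_elt r a' b'"
    using assms lattice_integral by (meson integral_cases)
  then show "commutator x y = int_elt r 0 (G2_commutator r (y_poly x) (y_poly y))"
    "int_elt r 0 (G2_commutator r (y_poly x) (y_poly y)) ** (y ** x) = x ** y"
    using r_pos by (simp_all add: commutator_def int_elt_mult int_elt_mult_inv G2_commutator_def zero_power algebra_simps)
  show "commutator x y \<in> \<Delta>"
    unfolding commutator_def using assms lattice_mult lattice_mult_inv by blast
qed

end

lemmas \<Delta>1_mult = lattice_mult[OF \<Delta>1] and \<Delta>1_mult_inv = lattice_mult_inv[OF \<Delta>1]
  and \<Delta>1_mult_inv_cancel = lattice_mult_inv_cancel[OF \<Delta>1]
  and \<Delta>1_integral = lattice_integral[OF \<Delta>1] and \<Delta>2_integral = lattice_integral[OF \<Delta>2]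

lemma \<phi>_mult: "x \<in> \<Delta>\<^sub>1 \<Longrightarrow> y \<in> \<Delta>\<^sub>1 \<Longrightarrow> \<phi> (x ** y) = \<phi> x ** \<phi> y"
  using \<phi> by (auto simp: iso_def hom_def)

lemma \<phi>_bij: "bij_betw \<phi> \<Delta>\<^sub>1 \<Delta>\<^sub>2"
  using \<phi> by (simp add: iso_def)

lemma \<phi>_mem: "x \<in> \<Delta>\<^sub>1 \<Longrightarrow> \<phi> x \<in> \<Delta>\<^sub>2"
  using \<phi>_bij by (auto simp: bij_betw_def)

lemma \<phi>_eq_iff: "x \<in> \<Delta>\<^sub>1 \<Longrightarrow> y \<in> \<Delta>\<^sub>1 \<Longrightarrow> \<phi> x = \<phi> y \<longleftrightarrow> x = y"
  using \<phi>_bij by (auto simp: bij_betw_def inj_on_eq_iff)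

lemma \<phi>_central:
  assumes x: "x \<in> \<Delta>\<^sub>1"
  shows "y_poly (\<phi> x) = 0 \<longleftrightarrow> y_poly x = 0"
proof -
  have "(\<forall>y\<in>\<Delta>\<^sub>2. \<phi> x ** y = y ** \<phi> x) \<longleftrightarrow> (\<forall>y\<in>\<Delta>\<^sub>1. \<phi> x ** \<phi> y = \<phi> y ** \<phi> x)"
    using \<phi>_bij by (auto simp: bij_betw_def)
  also have "\<dots> \<longleftrightarrow> (\<forall>y\<in>\<Delta>\<^sub>1. x ** y = y ** x)"
  proof (intro ball_cong refl)
    fix y assume y: "y \<in> \<Delta>\<^sub>1"
    show "\<phi> x ** \<phi> y = \<phi> y ** \<phi> x \<longleftrightarrow> x ** y = y ** x"
      using \<phi>_eq_iff[OF \<Delta>1_mult[OF x y] \<Delta>1_mult[OF y x]] \<phi>_mult x y by simp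
  qed
  finally show ?thesis
    using central_iff[OF \<Delta>1 x] central_iff[OF \<Delta>2 \<phi>_mem[OF x]] by blast
qed

definition V\<^sub>1 where "V\<^sub>1 = y_poly ` \<Delta>\<^sub>1"
definition V\<^sub>2 where "V\<^sub>2 = y_poly ` \<Delta>\<^sub>2"

lemma \<phi>_y_poly_eq_iff:
  assumes x: "x \<in> \<Delta>\<^sub>1" and y: "y \<in> \<Delta>\<^sub>1"
  shows "y_poly (\<phi> x) = y_poly (\<phi> y) \<longleftrightarrow> y_poly x = y_poly y"
proof -
  define u where "u = x ** inv\<^bsub>GL\<^esub> y"
  have u: "u \<in> \<Delta>\<^sub>1" using x y by (simp add: u_def \<Delta>1_mult_inv)
  have "u ** y = x" using \<Delta>1_mult_inv_cancel[OF x y] by (simp add: u_def)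
  then have "\<phi> x = \<phi> u ** \<phi> y" using \<phi>_mult[OF u y] by simp
  then have "y_poly (\<phi> x) = y_poly (\<phi> u) + y_poly (\<phi> y)"
    using poly_mult(1)[OF \<Delta>2_integral \<Delta>2_integral] \<phi>_mem u y by simp
  moreover have "y_poly u = y_poly x - y_poly y"
    using y_poly_mult_inv[OF \<Delta>1_integral \<Delta>1_integral] x y by (simp add: u_def)
  ultimately show ?thesis using \<phi>_central[OF u] by auto
qed

text \<open>
  The map induced by \<open>\<phi>\<close> modulo the centres.
\<close>
definition T where "T v = y_poly (\<phi> (SOME x. x \<in> \<Delta>\<^sub>1 \<and> y_poly x = v))"

lemma T_y_poly: "x \<in> \<Delta>\<^sub>1 \<Longrightarrow> T (y_poly x) = y_poly (\<phi> x)"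
proof -
  assume x: "x \<in> \<Delta>\<^sub>1"
  define x' where "x' = (SOME x'. x' \<in> \<Delta>\<^sub>1 \<and> y_poly x' = y_poly x)"
  have "x' \<in> \<Delta>\<^sub>1 \<and> y_poly x' = y_poly x"
    unfolding x'_def by (rule someI[of _ x]) (use x in auto)
  then show ?thesis
    using \<phi>_y_poly_eq_iff[of x' x] x unfolding T_def x'_def[symmetric] by blast
qed

lemma \<phi>_commutator:
  assumes x: "x \<in> \<Delta>\<^sub>1" and y: "y \<in> \<Delta>\<^sub>1"
  shows "\<phi> (int_elt r 0 (G2_commutator r (y_poly x) (y_poly y))) =
    int_elt r 0 (G2_commutator r (y_poly (\<phi> x)) (y_poly (\<phi> y)))"
proof -
  let ?c = "int_elt r 0 (G2_commutator r (y_poly x) (y_poly y))"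
  let ?d = "int_elt r 0 (G2_commutator r (y_poly (\<phi> x)) (y_poly (\<phi> y)))"
  have c: "?c \<in> \<Delta>\<^sub>1" using commutator_eq(1,2)[OF \<Delta>1 x y] by simp
  have d: "?d \<in> \<Delta>\<^sub>2" using commutator_eq(1,2)[OF \<Delta>2 \<phi>_mem[OF x] \<phi>_mem[OF y]] by simp
  have yx: "\<phi> (y ** x) \<in> \<Delta>\<^sub>2" by (rule \<phi>_mem[OF \<Delta>1_mult[OF y x]])
  have "\<phi> ?c ** \<phi> (y ** x) = \<phi> (x ** y)"
    using \<phi>_mult[OF c \<Delta>1_mult[OF y x]] commutator_eq(3)[OF \<Delta>1 x y] by simp
  also have "\<dots> = ?d ** \<phi> (y ** x)"
    using commutator_eq(3)[OF \<Delta>2 \<phi>_mem[OF x] \<phi>_mem[OF y]] \<phi>_mult x y by simp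
  finally show ?thesis
    using GL.right_cancel[of "\<phi> (y ** x)" "\<phi> ?c" ?d] lattice_carrier[OF \<Delta>2] \<phi>_mem[OF c] d yx by simp
qed

lemma T_commutator_isomorphism: "commutator_isomorphism V\<^sub>1 V\<^sub>2 T"
  unfolding commutator_isomorphism_def
proof (intro conjI ballI)
  show "finite_index_add V\<^sub>1" "finite_index_add V\<^sub>2"
    using projection_finite_index \<Delta>1 \<Delta>2 by (simp_all add: V\<^sub>1_def V\<^sub>2_def)
  show "bij_betw T V\<^sub>1 V\<^sub>2"
  proof (rule bij_betw_imageI)
    show "inj_on T V\<^sub>1"
      by (auto simp: inj_on_def V\<^sub>1_def T_y_poly \<phi>_y_poly_eq_iff)
    have "T ` V\<^sub>1 = y_poly ` \<phi> ` \<Delta>\<^sub>1" by (auto simp: V\<^sub>1_def T_y_poly image_image intro!: image_cong)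
    then show "T ` V\<^sub>1 = V\<^sub>2" using \<phi>_bij by (simp add: V\<^sub>2_def bij_betw_def)
  qed
  fix v w assume "v \<in> V\<^sub>1" "w \<in> V\<^sub>1"
  then obtain x y where xy: "x \<in> \<Delta>\<^sub>1" "y \<in> \<Delta>\<^sub>1" "v = y_poly x" "w = y_poly y"
    by (auto simp: V\<^sub>1_def)
  show "T (v + w) = T v + T w"
  proof -
    have "v + w = y_poly (x ** y)" using poly_mult(1)[OF \<Delta>1_integral \<Delta>1_integral] xy by simp
    then have "T (v + w) = y_poly (\<phi> x ** \<phi> y)"
      using T_y_poly[OF \<Delta>1_mult] \<phi>_mult xy by simp
    also have "\<dots> = T v + T w"
      using poly_mult(1)[OF \<Delta>2_integral \<Delta>2_integral] \<phi>_mem T_y_poly xy by simp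
    finally show ?thesis .
  qed
  fix v' w' assume "v' \<in> V\<^sub>1" "w' \<in> V\<^sub>1"
  then obtain x' y' where xy': "x' \<in> \<Delta>\<^sub>1" "y' \<in> \<Delta>\<^sub>1" "v' = y_poly x'" "w' = y_poly y'"
    by (auto simp: V\<^sub>1_def)
  show "G2_commutator r (T v) (T v') = G2_commutator r (T w) (T w') \<longleftrightarrow>
    G2_commutator r v v' = G2_commutator r w w'"
  proof -
    let ?c = "\<lambda>u u'. int_elt r 0 (G2_commutator r u u')"
    have inj: "?c a b = ?c c d \<longleftrightarrow> G2_commutator r a b = G2_commutator r c d" for a b c d :: "'k poly"
      by simp
    have mem: "?c v v' \<in> \<Delta>\<^sub>1" "?c w w' \<in> \<Delta>\<^sub>1"
      using commutator_eq(1,2)[OF \<Delta>1] xy xy' by auto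
    have "?c (T v) (T v') = ?c (T w) (T w') \<longleftrightarrow> \<phi> (?c v v') = \<phi> (?c w w')"
      using \<phi>_commutator xy xy' T_y_poly by simp
    also have "\<dots> \<longleftrightarrow> ?c v v' = ?c w w'" using mem by (rule \<phi>_eq_iff)
    finally show ?thesis unfolding inj .
  qed
qed

end

context lattice_isomorphism begin

interpretation GL: group "GL :: ('k fls ^ 3 ^ 3) monoid" by (rule group_GL)

text \<open>
  The reason is the identity \<open>[X\<^sup>r w, v] - [w, X v] = (X ^ (r * r) - X) w\<^sup>r v\<close>, with \<open>w\<close> fixed. Consequently
  the commutators generate a subgroup of finite index in the centre.
\<close>
lemma commutators_contain_ideal_multiple:
  obtains D V' where "D \<noteq> 0" "finite_index_add V'"
    "\<And>v. v \<in> V' \<Longrightarrow> \<exists>x\<in>\<Delta>\<^sub>1. \<exists>y\<in>\<Delta>\<^sub>1. \<exists>x'\<in>\<Delta>\<^sub>1. \<exists>y'\<in>\<Delta>\<^sub>1.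
      D * v = G2_commutator r (y_poly x) (y_poly y) - G2_commutator r (y_poly x') (y_poly y')"
proof -
  define X where "X = monom (1::'k) 1"
  have V1: "finite_index_add V\<^sub>1" using projection_finite_index[OF \<Delta>1] by (simp add: V\<^sub>1_def)
  have "infinite {w. \<forall>c\<in>{1, X ^ r}. c * w \<in> V\<^sub>1}"
    using V1 infinite_UNIV_poly
    by (rule finite_index_add_common_element) (simp_all add: right_diff_distrib)
  then have "\<not> {w. \<forall>c\<in>{1, X ^ r}. c * w \<in> V\<^sub>1} \<subseteq> {0}" by (meson finite.emptyI finite.insertI finite_subset)
  then obtain w where w: "w \<noteq> 0" "w \<in> V\<^sub>1" "X ^ r * w \<in> V\<^sub>1" by auto
  define D where "D = (X ^ (r * r) - X) * w ^ r"
  define V' where "V' = V\<^sub>1 \<inter> {v. X * v \<in> V\<^sub>1}"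
  have "r * r \<noteq> 1" using r_ge_2 by simp
  then have "X ^ (r * r) \<noteq> X" by (simp add: X_def monom_power monom_eq_iff')
  then have "D \<noteq> 0" using w by (simp add: D_def)
  moreover have "finite_index_add V'"
    unfolding V'_def
    by (intro finite_index_add_Int finite_index_add_vimage V1) (simp add: right_diff_distrib)
  moreover have "\<exists>x\<in>\<Delta>\<^sub>1. \<exists>y\<in>\<Delta>\<^sub>1. \<exists>x'\<in>\<Delta>\<^sub>1. \<exists>y'\<in>\<Delta>\<^sub>1.
      D * v = G2_commutator r (y_poly x) (y_poly y) - G2_commutator r (y_poly x') (y_poly y')"
    if "v \<in> V'" for v
  proof -
    have "X ^ r * w \<in> V\<^sub>1" "v \<in> V\<^sub>1" "w \<in> V\<^sub>1" "X * v \<in> V\<^sub>1" using w that by (auto simp: V'_def)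
    then obtain x y x' y' where "x \<in> \<Delta>\<^sub>1" "y \<in> \<Delta>\<^sub>1" "x' \<in> \<Delta>\<^sub>1" "y' \<in> \<Delta>\<^sub>1"
      "X ^ r * w = y_poly x" "v = y_poly y" "w = y_poly x'" "X * v = y_poly y'"
      unfolding V\<^sub>1_def by (elim imageE)
    moreover have "D * v = G2_commutator r (X ^ r * w) v - G2_commutator r w (X * v)"
      by (simp add: D_def G2_commutator_def algebra_simps power_mult_distrib power_mult)
    ultimately show ?thesis by metis
  qed
  ultimately show ?thesis by (rule that)
qed

text \<open>
  The ring automorphism found for \<open>T\<close> provides \<open>\<Phi>\<close> and \<open>a\<close> such that \<open>\<phi>\<close> acts on the coordinate
  \<open>y\<close> by \<open>y \<mapsto> a \<Phi>(y)\<close>. The deviation \<open>k\<close> of \<open>\<phi>\<close> from \<open>z \<mapsto> a\<^sup>r\<^sup>+\<^sup>1 \<Phi>(z)\<close> is a homomorphism to \<open>F\<close>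
  that vanishes on commutators. Hence it takes finitely many values on the centre \<open>C\<close>. Finitely many
  coefficients suffice to distinguish these values from zero; where these coefficients of \<open>k\<close>
  vanish, \<open>k\<close> is trivial on central elements and depends on \<open>y\<close> only.
\<close>
theorem structure_of_isomorphism:
  obtains \<Phi> :: "'k fls \<Rightarrow> 'k fls" and a \<Delta> h where
    "\<And>x y. \<Phi> (x + y) = \<Phi> x + \<Phi> y" "\<And>x y. \<Phi> (x * y) = \<Phi> x * \<Phi> y" "bij \<Phi>"
    "\<And>y. fls_subdegree (\<Phi> y) = fls_subdegree y" "a \<noteq> 0"
    "finite_index_subgroup \<Delta> (GL\<lparr>carrier := \<Delta>\<^sub>1\<rparr>)" "finite_index_add (y_poly ` \<Delta>)"
    "\<And>v w. v \<in> y_poly ` \<Delta> \<Longrightarrow> w \<in> y_poly ` \<Delta> \<Longrightarrow> h (v + w) = h v + h w"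
    "\<And>x. x \<in> \<Delta> \<Longrightarrow> \<phi> x = G2_elt r (a * \<Phi> (x $ 2 $ 3)) (a ^ Suc r * \<Phi> (x $ 1 $ 3) + h (y_poly x))"
proof -
  obtain \<sigma> where \<sigma>: "\<And>x y. \<sigma> (x + y) = \<sigma> x + \<sigma> y" "\<And>x y. \<sigma> (x * y) = \<sigma> x * \<sigma> y" "bij \<sigma>"
    "\<And>v w. v \<in> V\<^sub>1 \<Longrightarrow> w \<in> V\<^sub>1 \<Longrightarrow> T v * \<sigma> w = T w * \<sigma> v"
    by (rule commutator_isomorphism_is_ring_automorphism[OF T_commutator_isomorphism]) blast
  obtain \<Phi> :: "'k fls \<Rightarrow> 'k fls" where \<Phi>: "\<And>x y. \<Phi> (x + y) = \<Phi> x + \<Phi> y"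
    "\<And>x y. \<Phi> (x * y) = \<Phi> x * \<Phi> y" "bij \<Phi>"
    "\<And>y. fls_subdegree (\<Phi> y) = fls_subdegree y" "\<And>p. \<Phi> (inv_eval p) = inv_eval (\<sigma> p)"
    by (rule ring_automorphism_extends_to_Laurent_series[OF \<sigma>(1-3)]) blast
  have \<Phi>0: "\<Phi> 0 = 0" using \<Phi>(1)[of 0 0] by (metis add_cancel_left_left add_0)
  have \<Phi>_inj: "\<Phi> x = \<Phi> y \<longleftrightarrow> x = y" for x y using \<Phi>(3) by (auto simp: bij_def inj_eq)
  have \<Phi>_pow: "\<Phi> (x ^ r) = \<Phi> x ^ r" for x
  proof -
    have "\<Phi> 1 = 1" using \<Phi>(2)[of 1 1] \<Phi>_inj[of 1 0] \<Phi>0 by (simp add: mult_cancel_left1)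
    then show ?thesis by (induction r) (simp_all add: \<Phi>(2))
  qed
  have V1: "finite_index_add V\<^sub>1" using projection_finite_index[OF \<Delta>1] by (simp add: V\<^sub>1_def)
  have "\<not> V\<^sub>1 \<subseteq> {0}"
    using finite_index_add_infinite[OF V1 infinite_UNIV_poly] by (meson finite.emptyI finite.insertI finite_subset)
  then obtain x\<^sub>0 where x0: "x\<^sub>0 \<in> \<Delta>\<^sub>1" "y_poly x\<^sub>0 \<noteq> 0" unfolding V\<^sub>1_def by blast
  define v\<^sub>0 where "v\<^sub>0 = y_poly x\<^sub>0"
  have v0: "v\<^sub>0 \<in> V\<^sub>1" "v\<^sub>0 \<noteq> 0" "T v\<^sub>0 \<noteq> 0"
    using x0 \<phi>_central[OF x0(1)] by (simp_all add: v\<^sub>0_def V\<^sub>1_def T_y_poly)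
  \<comment> \<open>The quotient \<open>T v / \<sigma> v\<close> does not depend on \<open>v\<close>.\<close>
  define a where "a = inv_eval (T v\<^sub>0) / \<Phi> (inv_eval v\<^sub>0)"
  have nz: "\<Phi> (inv_eval v\<^sub>0) \<noteq> 0" using \<Phi>_inj[of "inv_eval v\<^sub>0" 0] \<Phi>0 v0 by simp
  then have a: "a \<noteq> 0" using v0 by (simp add: a_def)
  have \<phi>_y: "\<phi> x $ 2 $ 3 = a * \<Phi> (x $ 2 $ 3)" if x: "x \<in> \<Delta>\<^sub>1" for x
  proof -
    have "T (y_poly x) * \<sigma> v\<^sub>0 = T v\<^sub>0 * \<sigma> (y_poly x)"
      using x v0 by (intro \<sigma>(4)) (auto simp: V\<^sub>1_def)
    then have "inv_eval (T (y_poly x)) * \<Phi> (inv_eval v\<^sub>0) = inv_eval (T v\<^sub>0) * \<Phi> (inv_eval (y_poly x))"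
      by (simp only: \<Phi>(5) flip: inv_eval_mult)
    then have "inv_eval (T (y_poly x)) = a * \<Phi> (inv_eval (y_poly x))"
      using nz by (simp add: a_def field_simps)
    then show ?thesis
      using coordinates_of_integral(1)[OF \<Delta>1_integral[OF x]]
        coordinates_of_integral(1)[OF \<Delta>2_integral[OF \<phi>_mem[OF x]]] T_y_poly[OF x] by simp
  qed
  have z_mult: "(x ** y) $ 1 $ 3 = x $ 1 $ 3 + y $ 1 $ 3 + (x $ 2 $ 3) ^ r * y $ 2 $ 3"
    if "x \<in> \<Gamma>\<^sub>0" "y \<in> \<Gamma>\<^sub>0" for x y
  proof -
    have "x = G2_elt r (x $ 2 $ 3) (x $ 1 $ 3)" "y = G2_elt r (y $ 2 $ 3) (y $ 1 $ 3)"
      using that by (simp_all add: G2_elt_coordinates)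
    then show ?thesis by (metis mult G2_elt_nth(3))
  qed
  define k where "k x = \<phi> x $ 1 $ 3 - a ^ Suc r * \<Phi> (x $ 1 $ 3)" for x
  have k_mult: "k (x ** y) = k x + k y" if xy: "x \<in> \<Delta>\<^sub>1" "y \<in> \<Delta>\<^sub>1" for x y
  proof -
    have "\<phi> (x ** y) $ 1 $ 3 =
        \<phi> x $ 1 $ 3 + \<phi> y $ 1 $ 3 + (a * \<Phi> (x $ 2 $ 3)) ^ r * (a * \<Phi> (y $ 2 $ 3))"
      using z_mult[OF \<Delta>2_integral \<Delta>2_integral] \<phi>_mem xy by (simp add: \<phi>_mult \<phi>_y)
    moreover have "(x ** y) $ 1 $ 3 = x $ 1 $ 3 + y $ 1 $ 3 + (x $ 2 $ 3) ^ r * y $ 2 $ 3"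
      using z_mult[OF \<Delta>1_integral \<Delta>1_integral] xy by simp
    ultimately show ?thesis
      by (simp add: k_def \<Phi>(1,2) \<Phi>_pow algebra_simps power_mult_distrib)
  qed
  have k_commutator: "k (int_elt r 0 (G2_commutator r (y_poly x) (y_poly y))) = 0"
    if xy: "x \<in> \<Delta>\<^sub>1" "y \<in> \<Delta>\<^sub>1" for x y
  proof -
    have T: "inv_eval (y_poly (\<phi> x)) = a * \<Phi> (inv_eval (y_poly x))" if "x \<in> \<Delta>\<^sub>1" for x
      using \<phi>_y[OF that] coordinates_of_integral(1)[OF \<Delta>1_integral[OF that]]
        coordinates_of_integral(1)[OF \<Delta>2_integral[OF \<phi>_mem[OF that]]] by simp
    have ev: "inv_eval (G2_commutator r u v) = G2_commutator r (inv_eval u) (inv_eval v)" for u v :: "'k poly"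
      by (simp add: G2_commutator_def inv_eval_diff inv_eval_mult inv_eval_power)
    have minus: "\<Phi> (u - v) = \<Phi> u - \<Phi> v" for u v
      using \<Phi>(1)[of "u - v" v] by (simp add: algebra_simps)
    have "k (int_elt r 0 (G2_commutator r (y_poly x) (y_poly y))) =
        inv_eval (G2_commutator r (y_poly (\<phi> x)) (y_poly (\<phi> y))) -
        a ^ Suc r * \<Phi> (inv_eval (G2_commutator r (y_poly x) (y_poly y)))"
      unfolding k_def \<phi>_commutator[OF xy] by (simp add: int_elt_def)
    also have "\<dots> = 0"
      unfolding ev T[OF xy(1)] T[OF xy(2)]
      by (simp add: G2_commutator_def minus \<Phi>(2) \<Phi>_pow algebra_simps power_mult_distrib)
    finally show ?thesis .
  qed
  define C where "C = {x \<in> \<Delta>\<^sub>1. y_poly x = 0}"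
  have fin: "finite (k ` C)"
  proof -
    obtain D V' where D: "D \<noteq> 0" and V': "finite_index_add V'"
      and com: "\<And>v. v \<in> V' \<Longrightarrow> \<exists>x\<in>\<Delta>\<^sub>1. \<exists>y\<in>\<Delta>\<^sub>1. \<exists>x'\<in>\<Delta>\<^sub>1. \<exists>y'\<in>\<Delta>\<^sub>1.
        D * v = G2_commutator r (y_poly x) (y_poly y) - G2_commutator r (y_poly x') (y_poly y')"
      by (rule commutators_contain_ideal_multiple) blast
    have kD: "int_elt r 0 (D * v) \<in> \<Delta>\<^sub>1 \<and> k (int_elt r 0 (D * v)) = 0" if v: "v \<in> V'" for v
    proof -
      obtain x y x' y' where xy: "x \<in> \<Delta>\<^sub>1" "y \<in> \<Delta>\<^sub>1" "x' \<in> \<Delta>\<^sub>1" "y' \<in> \<Delta>\<^sub>1"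
        and Dv: "D * v = G2_commutator r (y_poly x) (y_poly y) - G2_commutator r (y_poly x') (y_poly y')"
        using com[OF v] by blast
      define c c' where "c = int_elt r 0 (G2_commutator r (y_poly x) (y_poly y))"
        and "c' = int_elt r 0 (G2_commutator r (y_poly x') (y_poly y'))"
      have c: "c \<in> \<Delta>\<^sub>1" "c' \<in> \<Delta>\<^sub>1"
        using commutator_eq(1,2)[OF \<Delta>1] xy by (auto simp: c_def c'_def)
      have eq: "int_elt r 0 (D * v) = c ** inv\<^bsub>GL\<^esub> c'"
        using r_pos by (simp add: c_def c'_def int_elt_mult_inv Dv zero_power)
      then have mem: "int_elt r 0 (D * v) \<in> \<Delta>\<^sub>1" using \<Delta>1_mult_inv c by simp
      have "k c = k (int_elt r 0 (D * v)) + k c'"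
        using k_mult[OF mem c(2)] \<Delta>1_mult_inv_cancel[OF c] by (simp add: eq)
      then show ?thesis using k_commutator xy mem by (simp add: c_def c'_def)
    qed
    obtain c :: "'k poly \<Rightarrow> 'k poly" where c: "finite (range c)"
      "\<And>x y. c x = c y \<Longrightarrow> x - y \<in> (*) D ` V'"
      by (rule finite_index_addE[OF finite_index_add_ideal_multiple[OF V' D]]) blast
    show ?thesis
    proof (rule finite_image_factor[where c = "\<lambda>x. c (z_poly x)"])
      show "finite ((\<lambda>x. c (z_poly x)) ` C)" by (rule finite_subset[OF _ c(1)]) auto
      fix x y assume x: "x \<in> C" and y: "y \<in> C" and eq: "c (z_poly x) = c (z_poly y)"
      obtain v where v: "v \<in> V'" "z_poly x - z_poly y = D * v" using c(2)[OF eq] by blast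
      have "x = int_elt r 0 (z_poly x)" "y = int_elt r 0 (z_poly y)"
        using x y int_elt_coordinates \<Delta>1_integral unfolding C_def by (metis (mono_tags, lifting) mem_Collect_eq)+
      moreover have "int_elt r 0 (D * v) ** int_elt r 0 (z_poly y) = int_elt r 0 (z_poly x)"
        using r_pos v(2) by (simp add: int_elt_mult zero_power algebra_simps)
      ultimately have "x = int_elt r 0 (D * v) ** y" by simp
      then show "k x = k y"
        using k_mult[of "int_elt r 0 (D * v)" y] kD[OF v(1)] y by (simp add: C_def)
    qed
  qed
  \<comment> \<open>A position of a nonzero coefficient, for each nonzero series.\<close>
  obtain n where n: "\<And>\<rho>. \<rho> \<noteq> 0 \<Longrightarrow> fls_nth \<rho> (n \<rho>) \<noteq> (0 :: 'k)"
    using nth_fls_subdegree_nonzero by blast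
  define J where "J = n ` (k ` C)"
  have J: "finite J" using fin by (simp add: J_def)
  define \<Delta> where "\<Delta> = {x \<in> \<Delta>\<^sub>1. \<forall>j\<in>J. fls_nth (k x) j = 0}"
  have k_mult_inv: "k (x ** inv\<^bsub>GL\<^esub> y) = k x - k y" if "x \<in> \<Delta>\<^sub>1" "y \<in> \<Delta>\<^sub>1" for x y
    using k_mult[OF \<Delta>1_mult_inv[OF that] that(2)] \<Delta>1_mult_inv_cancel[OF that] by simp
  have \<Delta>_mult_inv: "x ** inv\<^bsub>GL\<^esub> y \<in> \<Delta>" if "x \<in> \<Delta>" "y \<in> \<Delta>" for x y
    using that \<Delta>1_mult_inv k_mult_inv by (simp add: \<Delta>_def)
  have one: "mat 1 \<in> \<Delta>\<^sub>1" using subgroup.one_closed[OF lattice_subgroup[OF \<Delta>1]] by (simp add: GL_one)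
  have "k (mat 1) = 0" using k_mult[OF one one] by (metis matrix_mul_lid add_cancel_left_left)
  then have one_\<Delta>: "mat 1 \<in> \<Delta>" using one by (simp add: \<Delta>_def)
  have \<Delta>_subgroup: "subgroup \<Delta> GL"
  proof (rule GL.subgroupI)
    show "\<Delta> \<subseteq> carrier GL" using lattice_carrier[OF \<Delta>1] by (auto simp: \<Delta>_def)
    show "\<Delta> \<noteq> {}" using one_\<Delta> by blast
    show "inv\<^bsub>GL\<^esub> x \<in> \<Delta>" if "x \<in> \<Delta>" for x
      using \<Delta>_mult_inv[OF one_\<Delta> that] by simp
    show "x \<otimes>\<^bsub>GL\<^esub> y \<in> \<Delta>" if "x \<in> \<Delta>" "y \<in> \<Delta>" for x y
      using that \<Delta>1_mult k_mult by (simp add: \<Delta>_def)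
  qed
  have \<Delta>_fi: "finite_index_subgroup \<Delta> (GL\<lparr>carrier := \<Delta>\<^sub>1\<rparr>)"
  proof (rule GL.finite_index_subgroupI[where c = "\<lambda>x. restrict (fls_nth (k x)) J"])
    show "finite ((\<lambda>x. restrict (fls_nth (k x)) J) ` \<Delta>\<^sub>1)"
      by (rule finite_subset[of _ "PiE J (\<lambda>_. UNIV)"]) (use J in \<open>auto intro: finite_PiE\<close>)
    show "x \<otimes>\<^bsub>GL\<^esub> inv\<^bsub>GL\<^esub> y \<in> \<Delta>"
      if "x \<in> \<Delta>\<^sub>1" "y \<in> \<Delta>\<^sub>1" "restrict (fls_nth (k x)) J = restrict (fls_nth (k y)) J" for x y
      using that \<Delta>1_mult_inv k_mult_inv by (simp add: \<Delta>_def) (metis restrict_apply')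
  qed (use \<Delta>_subgroup lattice_subgroup[OF \<Delta>1] in \<open>auto simp: \<Delta>_def\<close>)
  have \<Delta>_sub: "x \<in> \<Delta>\<^sub>1" if "x \<in> \<Delta>" for x using that by (simp add: \<Delta>_def)
  have k_eq: "k x = k y" if xy: "x \<in> \<Delta>" "y \<in> \<Delta>" "y_poly x = y_poly y" for x y
  proof -
    define u where "u = x ** inv\<^bsub>GL\<^esub> y"
    have u: "u \<in> \<Delta>" using xy \<Delta>_mult_inv by (simp add: u_def)
    moreover have "y_poly u = 0"
      using y_poly_mult_inv[OF \<Delta>1_integral \<Delta>1_integral] xy \<Delta>_sub by (simp add: u_def)
    ultimately have "n (k u) \<in> J" using \<Delta>_sub by (auto simp: J_def C_def)
    then have "fls_nth (k u) (n (k u)) = 0" using u by (simp add: \<Delta>_def)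
    then have "k u = 0" using n by blast
    then show ?thesis using k_mult_inv[of x y] \<Delta>_sub xy by (simp add: u_def)
  qed
  define h where "h v = k (SOME x. x \<in> \<Delta> \<and> y_poly x = v)" for v
  have h: "h (y_poly x) = k x" if x: "x \<in> \<Delta>" for x
  proof -
    define x' where "x' = (SOME x'. x' \<in> \<Delta> \<and> y_poly x' = y_poly x)"
    have "x' \<in> \<Delta> \<and> y_poly x' = y_poly x"
      unfolding x'_def by (rule someI[of _ x]) (use x in auto)
    then show ?thesis using k_eq[of x' x] x unfolding h_def x'_def[symmetric] by blast
  qed
  show ?thesis
  proof (rule that[OF \<Phi>(1-4) a \<Delta>_fi])
    show "finite_index_add (y_poly ` \<Delta>)"
      by (rule projection_finite_index)
        (rule GL.finite_index_subgroup_trans[OF subgroup_integral_points \<Delta>1 \<Delta>_fi])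
    show "h (v + w) = h v + h w" if vw: "v \<in> y_poly ` \<Delta>" "w \<in> y_poly ` \<Delta>" for v w
    proof -
      obtain x y where xy: "x \<in> \<Delta>" "y \<in> \<Delta>" "v = y_poly x" "w = y_poly y" using vw by blast
      have "x ** y \<in> \<Delta>" using subgroup.m_closed[OF \<Delta>_subgroup xy(1,2)] by simp
      then have "h (y_poly (x ** y)) = k (x ** y)" by (rule h)
      then show ?thesis
        using k_mult poly_mult(1)[OF \<Delta>1_integral \<Delta>1_integral] \<Delta>_sub xy h by simp
    qed
    show "\<phi> x = G2_elt r (a * \<Phi> (x $ 2 $ 3)) (a ^ Suc r * \<Phi> (x $ 1 $ 3) + h (y_poly x))" if x: "x \<in> \<Delta>" for x
    proof -
      have "\<phi> x \<in> G2 r" using \<Delta>2_integral[OF \<phi>_mem[OF \<Delta>_sub[OF x]]] by blast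
      then have "\<phi> x = G2_elt r (\<phi> x $ 2 $ 3) (\<phi> x $ 1 $ 3)" by (simp add: G2_elt_coordinates)
      then show ?thesis using \<phi>_y[OF \<Delta>_sub[OF x]] h[OF x] by (simp add: k_def)
    qed
  qed
qed

end

section \<open>From formulas to virtual automorphisms\<close>

definition locally_constant_on :: "'a::topological_space set \<Rightarrow> ('a \<Rightarrow> 'b) \<Rightarrow> bool" where
  "locally_constant_on S c \<longleftrightarrow> (\<forall>x\<in>S. eventually (\<lambda>y. c y = c x) (at x within S))"

lemma locally_constant_on_compose: "locally_constant_on S c \<Longrightarrow> locally_constant_on S (\<lambda>x. f (c x))"
  unfolding locally_constant_on_def by (auto elim!: eventually_mono)

lemma locally_constant_on_Pair:
  "locally_constant_on S c \<Longrightarrow> locally_constant_on S d \<Longrightarrow> locally_constant_on S (\<lambda>x. (c x, d x))"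
  unfolding locally_constant_on_def by (auto intro: eventually_conj)

lemma openin_locally_constant_vimage:
  assumes "locally_constant_on S c"
  shows "openin (top_of_set S) {x \<in> S. c x \<in> A}"
proof (subst openin_subopen, intro ballI)
  fix x assume x: "x \<in> {x \<in> S. c x \<in> A}"
  then have "eventually (\<lambda>y. c y = c x) (at x within S)"
    using assms by (auto simp: locally_constant_on_def)
  then obtain T where T: "open T" "x \<in> T" "\<And>y. y \<in> T \<Longrightarrow> y \<noteq> x \<Longrightarrow> y \<in> S \<Longrightarrow> c y = c x"
    unfolding eventually_at_topological by blast
  have "S \<inter> T \<subseteq> {x \<in> S. c x \<in> A}"
  proof
    fix y assume "y \<in> S \<inter> T"
    then have "c y = c x" using T(3)[of y] by blast
    then show "y \<in> {x \<in> S. c x \<in> A}" using x \<open>y \<in> S \<inter> T\<close> by simp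
  qed
  then show "\<exists>T. openin (top_of_set S) T \<and> x \<in> T \<and> T \<subseteq> {x \<in> S. c x \<in> A}"
    using T x by (intro exI[of _ "S \<inter> T"]) auto
qed

text \<open>
  Continuity is a local matter, so a parameter that is locally constant may be treated as fixed.
\<close>
lemma continuous_on_locally_constant_parameter:
  assumes c: "locally_constant_on S c" and g: "\<And>x\<^sub>0. x\<^sub>0 \<in> S \<Longrightarrow> continuous_on S (g (c x\<^sub>0))"
  shows "continuous_on S (\<lambda>x. g (c x) x)"
  unfolding continuous_on_def
proof
  fix x assume x: "x \<in> S"
  have "(g (c x) \<longlongrightarrow> g (c x) x) (at x within S)"
    using g[OF x] x by (simp add: continuous_on_def)
  moreover have "eventually (\<lambda>y. g (c x) y = g (c y) y) (at x within S)"
    using c x unfolding locally_constant_on_def by (auto elim!: eventually_mono)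
  ultimately show "((\<lambda>x. g (c x) x) \<longlongrightarrow> g (c x) x) (at x within S)"
    by (rule Lim_transform_eventually)
qed

lemma locally_constant_poly_part:
  fixes f :: "'a::topological_space \<Rightarrow> 'k::field fls"
  assumes "continuous_on S f"
  shows "locally_constant_on S (\<lambda>x. poly_part (f x))"
  unfolding locally_constant_on_def
proof
  fix x assume x: "x \<in> S"
  have "eventually (\<lambda>y. vanishes_upto 0 (f y - f x)) (at x within S)"
    using assms x unfolding continuous_on_def tendsto_fls_iff by blast
  then show "eventually (\<lambda>y. poly_part (f y) = poly_part (f x)) (at x within S)"
  proof eventually_elim
    case (elim y)
    then have "poly_part (f y - f x) = 0" by (simp add: poly_part_eq_0_iff vanishes_upto_def)
    then show ?case using poly_part_add[of "f y - f x" "f x"] by simp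
  qed
qed

lemma continuous_on_fls_locally_constant:
  fixes c :: "'a::topological_space \<Rightarrow> 'b::topological_space"
  assumes "locally_constant_on S c"
  shows "continuous_on S c"
  using continuous_on_locally_constant_parameter[OF assms, of "\<lambda>d x. d"] by simp

lemma continuous_on_fls_mult_const:
  fixes f :: "'a::topological_space \<Rightarrow> 'k::field fls"
  assumes "continuous_on S f"
  shows "continuous_on S (\<lambda>x. a * f x)"
  using continuous_on_compose2[OF continuous_on_fls_mult_left[of UNIV a] assms] by simp

lemma continuous_on_fls_diff:
  fixes f g :: "'a::topological_space \<Rightarrow> 'k::field fls"
  assumes "continuous_on S f" "continuous_on S g"
  shows "continuous_on S (\<lambda>x. f x - g x)"
  using continuous_on_fls_add[OF assms(1) continuous_on_fls_mult_const[OF assms(2), of "-1"]] by simp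

lemma continuous_on_fls_isometry:
  fixes \<Phi> :: "'k::field fls \<Rightarrow> 'k fls"
  assumes add: "\<And>x y. \<Phi> (x + y) = \<Phi> x + \<Phi> y" and subdeg: "\<And>y. fls_subdegree (\<Phi> y) = fls_subdegree y"
    and f: "continuous_on S f"
  shows "continuous_on S (\<lambda>x. \<Phi> (f x))"
proof (rule continuous_on_compose2[OF continuous_on_flsI f subset_UNIV])
  fix N
  have "\<Phi> 0 = 0" using add[of 0 0] by (metis add_cancel_left_left add_0)
  then have "vanishes_upto N (\<Phi> w)" if "vanishes_upto N w" for w
    using that subdeg[of w] by (auto simp: vanishes_upto_iff)
  moreover have "\<Phi> u - \<Phi> v = \<Phi> (u - v)" for u v using add[of "u - v" v] by simp
  ultimately show "\<exists>M. \<forall>u\<in>UNIV. \<forall>v\<in>UNIV. vanishes_upto M (u - v) \<longrightarrow> vanishes_upto N (\<Phi> u - \<Phi> v)"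
    by auto
qed

context char_power begin

interpretation GL: group "GL :: ('k fls ^ 3 ^ 3) monoid" by (rule group_GL)

lemma continuous_on_fls_power_r:
  fixes f :: "'a::topological_space \<Rightarrow> 'k fls"
  assumes "continuous_on S f"
  shows "continuous_on S (\<lambda>x. f x ^ r)"
proof (rule continuous_on_compose2[OF continuous_on_flsI assms subset_UNIV])
  fix N
  have "vanishes_upto N ((u :: 'k fls) ^ r)" if "vanishes_upto (max 0 N) u" for u
  proof (cases "u = 0")
    case False
    then have sub: "max 0 N < fls_subdegree u" using that by (simp add: vanishes_upto_iff)
    then have "1 * fls_subdegree u \<le> int r * fls_subdegree u"
      using r_gt_0 by (intro mult_right_mono) auto
    then have "N < int r * fls_subdegree u" using sub by linarith
    then show ?thesis by (simp add: vanishes_upto_iff fls_subdegree_pow)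
  qed (use r_gt_0 in \<open>simp add: zero_power vanishes_upto_def\<close>)
  then show "\<exists>M. \<forall>u\<in>UNIV. \<forall>v\<in>UNIV. vanishes_upto M (u - v) \<longrightarrow> vanishes_upto N (u ^ r - v ^ r :: 'k fls)"
    by (intro exI[of _ "max 0 N"]) (auto simp flip: fls_frob_diff)
qed

lemma continuous_on_G2_elt:
  fixes f g :: "'a::topological_space \<Rightarrow> 'k fls"
  assumes "continuous_on S f" "continuous_on S g"
  shows "continuous_on S (\<lambda>x. G2_elt r (f x) (g x))"
proof -
  have "G2_elt r y z = (\<chi> i j. if i = 1 \<and> j = 2 then y ^ r else if i = 1 \<and> j = 3 then z
      else if i = 2 \<and> j = 3 then y else if i = j then 1 else 0)" for y z :: "'k fls"
    by (simp add: vec_eq_iff forall_3)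
  moreover have "continuous_on S (\<lambda>x. if i = 1 \<and> j = 2 then f x ^ r else if i = 1 \<and> j = 3 then g x
      else if i = 2 \<and> j = 3 then f x else if i = j then 1 else 0)" for i j :: 3
    using assms continuous_on_fls_power_r[OF assms(1)] exhaust_3[of i] exhaust_3[of j]
    by (elim disjE) simp_all
  ultimately show ?thesis by (auto intro!: continuous_on_vec_lambda)
qed

text \<open>
  The two continuous maps \<open>\<Lambda>\<close> and \<open>\<Lambda>'\<close> are inverse to each other, which covers both the bijectivity of
  the homomorphism and the homeomorphism.
\<close>
lemma virtual_automorphism_G2I:
  fixes \<Lambda> :: "'k fls ^ 3 ^ 3 \<Rightarrow> 'k fls ^ 3 ^ 3"
  assumes G': "finite_index_subgroup G' (GL\<lparr>carrier := G2 r\<rparr>)" "openin (G2_topology r) G'"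
    and G'': "finite_index_subgroup G'' (GL\<lparr>carrier := G2 r\<rparr>)" "openin (G2_topology r) G''"
    and hom: "\<And>x y. x \<in> G' \<Longrightarrow> y \<in> G' \<Longrightarrow> \<Lambda> (x ** y) = \<Lambda> x ** \<Lambda> y"
    and \<Lambda>: "\<And>x. x \<in> G' \<Longrightarrow> \<Lambda> x \<in> G''" "\<And>x. x \<in> G' \<Longrightarrow> \<Lambda>' (\<Lambda> x) = x" "continuous_on G' \<Lambda>"
    and \<Lambda>': "\<And>x. x \<in> G'' \<Longrightarrow> \<Lambda>' x \<in> G'" "\<And>x. x \<in> G'' \<Longrightarrow> \<Lambda> (\<Lambda>' x) = x" "continuous_on G'' \<Lambda>'"
  shows "virtual_automorphism (G2_group r) (G2_topology r) G' G'' \<Lambda>"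
proof -
  have sub: "G' \<subseteq> G2 r" "G'' \<subseteq> G2 r" using G'(2) G''(2) openin_imp_subset by blast+
  have "bij_betw \<Lambda> G' G''"
    by (rule bij_betw_byWitness[where f' = \<Lambda>']) (use \<Lambda> \<Lambda>' in auto)
  then have iso: "\<Lambda> \<in> iso (GL\<lparr>carrier := G'\<rparr>) (GL\<lparr>carrier := G''\<rparr>)"
    using hom \<Lambda>(1) by (auto simp: iso_def hom_def)
  have "homeomorphic_maps (top_of_set G') (top_of_set G'') \<Lambda> \<Lambda>'"
    using \<Lambda> \<Lambda>' by (auto simp: homeomorphic_maps_def)
  then have "homeomorphic_map (top_of_set G') (top_of_set G'') \<Lambda>"
    by (rule homeomorphic_maps_imp_map)
  moreover have "subtopology (G2_topology r) G' = top_of_set G'" "subtopology (G2_topology r) G'' = top_of_set G''"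
    using sub by (simp_all add: subtopology_subtopology Int_absorb1)
  ultimately show ?thesis
    unfolding virtual_automorphism_def using G' G'' iso by simp
qed

lemma finite_index_subgroup_of_G2:
  assumes U: "finite_index_add U"
  shows "finite_index_subgroup {x \<in> G2 r. (x :: 'k fls ^ 3 ^ 3) $ 2 $ 3 \<in> U} (GL\<lparr>carrier := G2 r\<rparr>)"
proof -
  let ?H = "{x \<in> G2 r. (x :: 'k fls ^ 3 ^ 3) $ 2 $ 3 \<in> U}"
  obtain c :: "'k fls \<Rightarrow> 'k fls" where c: "finite (range c)" "\<And>x y. c x = c y \<Longrightarrow> x - y \<in> U"
    by (rule finite_index_addE[OF U]) blast
  have mult_inv: "x ** inv\<^bsub>GL\<^esub> y \<in> G2 r \<and> (x ** inv\<^bsub>GL\<^esub> y) $ 2 $ 3 = x $ 2 $ 3 - y $ 2 $ 3"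
    if xy: "x \<in> G2 r" "y \<in> G2 r" for x y :: "'k fls ^ 3 ^ 3"
  proof -
    obtain a b a' b' where "x = G2_elt r a b" "y = G2_elt r a' b'" using xy by (auto simp: G2_def)
    then show ?thesis by (simp add: G2_elt_mult_inv)
  qed
  have inv: "inv\<^bsub>GL\<^esub> x \<in> ?H" if x: "x \<in> ?H" for x
  proof -
    obtain a b where "x = G2_elt r a b" using x by (auto simp: G2_def)
    then show ?thesis using x finite_index_add_minus[OF U] by (simp add: G2_elt_inv)
  qed
  show ?thesis
  proof (rule GL.finite_index_subgroupI[where c = "\<lambda>x :: 'k fls ^ 3 ^ 3. c (x $ 2 $ 3)"])
    show "subgroup ?H GL"
    proof (rule GL.subgroupI)
      show "?H \<subseteq> carrier GL" using subgroup.subset[OF subgroup_G2'] by blast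
      have "G2_elt r 0 0 \<in> ?H" using finite_index_add_zero[OF U] by simp
      then show "?H \<noteq> {}" by blast
      show "inv\<^bsub>GL\<^esub> x \<in> ?H" if "x \<in> ?H" for x using inv[OF that] .
      show "x \<otimes>\<^bsub>GL\<^esub> y \<in> ?H" if xy: "x \<in> ?H" "y \<in> ?H" for x y
      proof -
        obtain a b a' b' where "x = G2_elt r a b" "y = G2_elt r a' b'" using xy by (auto simp: G2_def)
        then show ?thesis using xy finite_index_add_add[OF U] by (simp add: mult)
      qed
    qed
    show "finite ((\<lambda>x. c (x $ 2 $ 3)) ` G2 r)" by (rule finite_subset[OF _ c(1)]) auto
    show "x \<otimes>\<^bsub>GL\<^esub> inv\<^bsub>GL\<^esub> y \<in> ?H" if "x \<in> G2 r" "y \<in> G2 r" "c (x $ 2 $ 3) = c (y $ 2 $ 3)" for x y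
      using mult_inv[OF that(1,2)] c(2)[OF that(3)] by simp
  qed (use subgroup_G2' in auto)
qed

text \<open>
  The function \<open>h\<close> is additive on \<open>V\<close> only, so the domain is the open subgroup where the polynomial
  part of \<open>y\<close> lies in \<open>V\<close>. Evaluating \<open>h\<close> at the polynomial part is locally constant and hence continuous,
  because the polynomial part is unchanged by adding elements of \<open>t\<bbbF>\<^sub>q[[t]]\<close>.
\<close>
theorem semilinear_map_is_virtual_automorphism:
  fixes \<Phi> :: "'k fls \<Rightarrow> 'k fls" and h :: "'k poly \<Rightarrow> 'k fls"
  assumes \<Phi>: "\<And>x y. \<Phi> (x + y) = \<Phi> x + \<Phi> y" "\<And>x y. \<Phi> (x * y) = \<Phi> x * \<Phi> y" "bij \<Phi>"
    "\<And>y. fls_subdegree (\<Phi> y) = fls_subdegree y"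
    and a: "a \<noteq> 0" and V: "finite_index_add V"
    and h: "\<And>v w. v \<in> V \<Longrightarrow> w \<in> V \<Longrightarrow> h (v + w) = h v + h w"
  shows "\<exists>G''. virtual_automorphism (G2_group r) (G2_topology r) {x \<in> G2 r. y_poly x \<in> V} G''
    (\<lambda>x. G2_elt r (a * \<Phi> (x $ 2 $ 3)) (a ^ Suc r * \<Phi> (x $ 1 $ 3) + h (y_poly x)))"
proof -
  define \<Psi> where "\<Psi> = inv_into UNIV \<Phi>"
  have \<Psi>\<Phi>: "\<Psi> (\<Phi> y) = y" and \<Phi>\<Psi>: "\<Phi> (\<Psi> y) = y" for y
    using \<Phi>(3) by (simp_all add: \<Psi>_def bij_is_inj bij_is_surj inv_f_f surj_f_inv_f)
  have \<Psi>_add: "\<Psi> (x + y) = \<Psi> x + \<Psi> y" for x y by (metis \<Psi>\<Phi> \<Phi>\<Psi> \<Phi>(1))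
  have \<Psi>_subdeg: "fls_subdegree (\<Psi> y) = fls_subdegree y" for y by (metis \<Phi>\<Psi> \<Phi>(4))
  have \<Psi>_diff: "\<Psi> (x - y) = \<Psi> x - \<Psi> y" for x y using \<Psi>_add[of "x - y" y] by simp
  have \<Phi>_pow: "\<Phi> (x ^ r) = \<Phi> x ^ r" for x
  proof -
    have "\<Phi> 1 = 1" by (metis \<Phi>(2) \<Phi>\<Psi> mult.right_neutral mult_1)
    then show ?thesis by (induction r) (simp_all add: \<Phi>(2))
  qed
  have pp_diff: "poly_part (x - y) = poly_part x - poly_part y" for x y :: "'k fls"
    using poly_part_add[of "x - y" y] by simp
  \<comment> \<open>The polynomial part of \<open>y\<close> of the preimage of \<open>x\<close>.\<close>
  define c where "c x = poly_part (\<Psi> ((x :: 'k fls ^ 3 ^ 3) $ 2 $ 3 / a))" for x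
  define G' where "G' = {x \<in> G2 r. y_poly (x :: 'k fls ^ 3 ^ 3) \<in> V}"
  define G'' where "G'' = {x \<in> G2 r. c x \<in> V}"
  define \<Lambda> where "\<Lambda> (x :: 'k fls ^ 3 ^ 3) = G2_elt r (a * \<Phi> (x $ 2 $ 3)) (a ^ Suc r * \<Phi> (x $ 1 $ 3) + h (y_poly x))" for x
  define \<Lambda>' where "\<Lambda>' (x :: 'k fls ^ 3 ^ 3) = G2_elt r (\<Psi> (x $ 2 $ 3 / a)) (\<Psi> ((x $ 1 $ 3 - h (c x)) / a ^ Suc r))" for x
  have comp: "continuous_on S (\<lambda>x. x $ i $ j)" for i j and S :: "('k fls ^ 3 ^ 3) set"
    by (intro continuous_on_component continuous_on_id)
  have cont_div: "continuous_on S (\<lambda>x. f x / b)" if "continuous_on S f"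
    for S and f :: "'k fls ^ 3 ^ 3 \<Rightarrow> 'k fls" and b
    using continuous_on_fls_mult_const[OF that, of "inverse b"] by (simp add: divide_inverse ac_simps)
  have lc_y: "locally_constant_on S y_poly" for S :: "('k fls ^ 3 ^ 3) set"
    unfolding y_poly_def by (intro locally_constant_poly_part comp)
  have cont_\<Psi>: "continuous_on S (\<lambda>x. \<Psi> (f x))" if "continuous_on S f"
    for S and f :: "'k fls ^ 3 ^ 3 \<Rightarrow> 'k fls"
    using \<Psi>_add \<Psi>_subdeg that by (rule continuous_on_fls_isometry)
  have lc_c: "locally_constant_on S c" for S
    unfolding c_def by (intro locally_constant_poly_part cont_\<Psi> cont_div comp)
  have "virtual_automorphism (G2_group r) (G2_topology r) G' G'' \<Lambda>"
  proof (rule virtual_automorphism_G2I[where \<Lambda>' = \<Lambda>'])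
    have "finite_index_add {y. poly_part y \<in> V}"
      using V pp_diff by (rule finite_index_add_vimage)
    from finite_index_subgroup_of_G2[OF this] show "finite_index_subgroup G' (GL\<lparr>carrier := G2 r\<rparr>)"
      by (simp add: G'_def y_poly_def)
    have "finite_index_add {y. poly_part (\<Psi> (y / a)) \<in> V}"
      using V by (rule finite_index_add_vimage) (simp add: diff_divide_distrib \<Psi>_diff pp_diff)
    from finite_index_subgroup_of_G2[OF this] show "finite_index_subgroup G'' (GL\<lparr>carrier := G2 r\<rparr>)"
      by (simp add: G''_def c_def)
    show "openin (G2_topology r) G'" unfolding G'_def by (intro openin_locally_constant_vimage lc_y)
    show "openin (G2_topology r) G''" unfolding G''_def by (intro openin_locally_constant_vimage lc_c)
    show "continuous_on G' \<Lambda>"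
      unfolding \<Lambda>_def
      by (intro continuous_on_G2_elt continuous_on_fls_add continuous_on_fls_mult_const
          continuous_on_fls_isometry[OF \<Phi>(1,4)] comp continuous_on_fls_locally_constant
          locally_constant_on_compose[of _ _ h] lc_y)
    show "continuous_on G'' \<Lambda>'"
      unfolding \<Lambda>'_def
      by (intro continuous_on_G2_elt continuous_on_fls_diff cont_\<Psi> cont_div comp
          continuous_on_fls_locally_constant locally_constant_on_compose[of _ _ h] lc_c)
    have c\<Lambda>: "c (\<Lambda> x) = y_poly x" for x using a by (simp add: c_def \<Lambda>_def \<Psi>\<Phi> y_poly_def)
    have y\<Lambda>': "y_poly (\<Lambda>' x) = c x" for x by (simp add: c_def \<Lambda>'_def y_poly_def)
    show "\<Lambda> x \<in> G''" if "x \<in> G'" for x using that c\<Lambda> by (simp add: G'_def G''_def) (simp add: \<Lambda>_def)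
    show "\<Lambda>' x \<in> G'" if "x \<in> G''" for x using that y\<Lambda>' by (simp add: G'_def G''_def) (simp add: \<Lambda>'_def)
    show "\<Lambda>' (\<Lambda> x) = x" if "x \<in> G'" for x
    proof -
      have "\<Lambda>' (\<Lambda> x) = G2_elt r (x $ 2 $ 3) (x $ 1 $ 3)"
        unfolding \<Lambda>'_def c\<Lambda> using a by (simp add: \<Lambda>_def \<Psi>\<Phi>)
      then show ?thesis using that G2_elt_coordinates[of x r] by (simp add: G'_def)
    qed
    show "\<Lambda> (\<Lambda>' x) = x" if "x \<in> G''" for x
    proof -
      have "\<Lambda> (\<Lambda>' x) = G2_elt r (x $ 2 $ 3) (x $ 1 $ 3)"
        unfolding \<Lambda>_def y\<Lambda>' using a by (simp add: \<Lambda>'_def \<Phi>\<Psi>)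
      then show ?thesis using that G2_elt_coordinates[of x r] by (simp add: G''_def)
    qed
    show "\<Lambda> (x ** y) = \<Lambda> x ** \<Lambda> y" if xy: "x \<in> G'" "y \<in> G'" for x y
    proof -
      obtain u v u' v' where uv: "x = G2_elt r u v" "y = G2_elt r u' v'"
        using xy by (auto simp: G'_def G2_def)
      have h': "h (poly_part u' + poly_part u) = h (poly_part u') + h (poly_part u)"
        using xy h by (simp add: G'_def uv y_poly_def)
      show ?thesis
        unfolding uv \<Lambda>_def
        by (simp add: mult \<Phi>(1,2) \<Phi>_pow y_poly_def poly_part_add h' algebra_simps power_mult_distrib)
    qed
  qed
  then show ?thesis unfolding G'_def \<Lambda>_def by blast
qed

end

section \<open>The commutative case\<close>

text \<open>
  If \<open>\<gamma>\<close> is an idempotent endomorphism of a commutative group, every \<open>x\<close> is the product of \<open>\<gamma> x\<close> in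
  the image and \<open>(\<gamma> x)\<^sup>-\<^sup>1 x\<close> in the kernel. The map \<open>\<Lambda>\<close> applies \<open>\<phi>\<close> to the first factor and the
  identity to the second; the same construction with \<open>\<phi>'\<close> undoes it.
\<close>
lemma (in comm_group) retraction_twist:
  assumes \<gamma>: "\<gamma> \<in> hom G G" and idem: "\<And>x. x \<in> carrier G \<Longrightarrow> \<gamma> (\<gamma> x) = \<gamma> x"
    and \<Delta>: "\<Delta> \<subseteq> carrier G" "\<Delta>' \<subseteq> carrier G" and fixed: "\<And>x. x \<in> \<Delta>' \<Longrightarrow> \<gamma> x = x"
    and \<phi>: "\<And>x y. x \<in> \<Delta> \<Longrightarrow> y \<in> \<Delta> \<Longrightarrow> \<phi> (x \<otimes> y) = \<phi> x \<otimes> \<phi> y"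
      "\<And>x. x \<in> \<Delta> \<Longrightarrow> \<phi> x \<in> \<Delta>'" "\<And>x. x \<in> \<Delta> \<Longrightarrow> \<phi>' (\<phi> x) = x"
  defines "\<Lambda> \<equiv> \<lambda>x. \<phi> (\<gamma> x) \<otimes> inv (\<gamma> x) \<otimes> x"
  assumes x: "x \<in> carrier G" "\<gamma> x \<in> \<Delta>"
  shows "\<Lambda> x \<in> carrier G" "\<gamma> (\<Lambda> x) = \<phi> (\<gamma> x)" "\<phi>' (\<gamma> (\<Lambda> x)) \<otimes> inv (\<gamma> (\<Lambda> x)) \<otimes> \<Lambda> x = x"
    "\<And>y. y \<in> carrier G \<Longrightarrow> \<gamma> y \<in> \<Delta> \<Longrightarrow> \<Lambda> (x \<otimes> y) = \<Lambda> x \<otimes> \<Lambda> y"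
proof -
  interpret \<gamma>: group_hom G G \<gamma> by unfold_locales (rule \<gamma>)
  have mem: "\<gamma> u \<in> carrier G" "\<phi> (\<gamma> u) \<in> carrier G" if "u \<in> carrier G" "\<gamma> u \<in> \<Delta>" for u
    using that \<phi>(2) \<Delta> by auto
  note mem_x = mem[OF x]
  show closed: "\<Lambda> x \<in> carrier G" using mem_x x by (simp add: \<Lambda>_def)
  have "\<gamma> (\<Lambda> x) = \<gamma> (\<phi> (\<gamma> x)) \<otimes> inv (\<gamma> (\<gamma> x)) \<otimes> \<gamma> x"
    using mem_x x by (simp add: \<Lambda>_def)
  also have "\<dots> = \<phi> (\<gamma> x)" using fixed[OF \<phi>(2)[OF x(2)]] idem[OF x(1)] mem_x by (simp add: m_assoc)
  finally show eq: "\<gamma> (\<Lambda> x) = \<phi> (\<gamma> x)" .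
  have "\<phi>' (\<gamma> (\<Lambda> x)) \<otimes> inv (\<gamma> (\<Lambda> x)) \<otimes> \<Lambda> x =
      \<gamma> x \<otimes> inv (\<phi> (\<gamma> x)) \<otimes> (\<phi> (\<gamma> x) \<otimes> inv (\<gamma> x) \<otimes> x)"
    unfolding eq \<phi>(3)[OF x(2)] by (simp add: \<Lambda>_def)
  also have "\<dots> = (\<gamma> x \<otimes> inv (\<gamma> x)) \<otimes> (inv (\<phi> (\<gamma> x)) \<otimes> \<phi> (\<gamma> x)) \<otimes> x"
    using mem_x x(1) by (simp only: m_ac m_closed inv_closed)
  also have "\<dots> = x" using mem_x x(1) by simp
  finally show "\<phi>' (\<gamma> (\<Lambda> x)) \<otimes> inv (\<gamma> (\<Lambda> x)) \<otimes> \<Lambda> x = x" .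
  fix y assume y: "y \<in> carrier G" "\<gamma> y \<in> \<Delta>"
  note mem_y = mem[OF y]
  have "\<Lambda> (x \<otimes> y) = (\<phi> (\<gamma> x) \<otimes> \<phi> (\<gamma> y)) \<otimes> (inv (\<gamma> x) \<otimes> inv (\<gamma> y)) \<otimes> (x \<otimes> y)"
    using x y mem_x mem_y by (simp add: \<Lambda>_def \<phi>(1) inv_mult)
  also have "\<dots> = \<Lambda> x \<otimes> \<Lambda> y"
    unfolding \<Lambda>_def using x(1) y(1) mem_x mem_y by (simp only: m_ac m_closed inv_closed)
  finally show "\<Lambda> (x \<otimes> y) = \<Lambda> x \<otimes> \<Lambda> y" .
qed

context char_power begin

interpretation GL: group "GL :: ('k fls ^ 3 ^ 3) monoid" by (rule group_GL)

text \<open>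
  If \<open>r = 1\<close> and \<open>y = p + u\<close> with a polynomial \<open>p\<close> and \<open>u\<close> in \<open>t\<bbbF>\<^sub>q[[t]]\<close>, then
  \<open>(p, w) (u, w') = (p + u, w + w' + p u)\<close>. To find \<open>w\<close> and \<open>w'\<close> for a given \<open>(y, z)\<close>, the term
  \<open>p u\<close> has to be removed from \<open>z\<close> before it is decomposed.
\<close>
definition z_twisted :: "'k fls ^ 3 ^ 3 \<Rightarrow> 'k fls" where
  "z_twisted x = x $ 1 $ 3 - inv_eval (y_poly x) * (x $ 2 $ 3 - inv_eval (y_poly x))"

definition integral_part :: "'k fls ^ 3 ^ 3 \<Rightarrow> 'k fls ^ 3 ^ 3" where
  "integral_part x = int_elt r (y_poly x) (poly_part (z_twisted x))"

lemma integral_part_integral: "x \<in> \<Gamma>\<^sub>0 \<Longrightarrow> integral_part x = x"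
  using coordinates_of_integral[of x] int_elt_coordinates[of x]
  by (simp add: integral_part_def z_twisted_def z_poly_def)

lemma locally_constant_integral_part: "locally_constant_on S integral_part"
proof -
  have comp: "continuous_on S (\<lambda>x. x $ i $ j)" for i j and S :: "('k fls ^ 3 ^ 3) set"
    by (intro continuous_on_component continuous_on_id)
  have y: "locally_constant_on S y_poly"
    unfolding y_poly_def by (intro locally_constant_poly_part comp)
  have "continuous_on S z_twisted"
    unfolding z_twisted_def
    by (rule continuous_on_locally_constant_parameter
        [OF y, where g = "\<lambda>q x. x $ 1 $ 3 - inv_eval q * (x $ 2 $ 3 - inv_eval q)"])
      (intro continuous_on_fls_diff continuous_on_fls_mult_const comp continuous_on_const)
  then have "locally_constant_on S (\<lambda>x. (y_poly x, poly_part (z_twisted x)))"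
    by (intro locally_constant_on_Pair y locally_constant_poly_part)
  from locally_constant_on_compose[OF this, of "\<lambda>(a, b). int_elt r a b"]
  show ?thesis by (simp add: integral_part_def [abs_def])
qed

lemma integral_part_mult:
  assumes r1: "r = 1" and "x \<in> G2 r" "y \<in> G2 r"
  shows "integral_part (x ** y) = integral_part x ** integral_part y"
proof -
  obtain a b a' b' where xy: "x = G2_elt r a b" "y = G2_elt r a' b'" using assms by (auto simp: G2_def)
  define u u' where "u = a - inv_eval (poly_part a)" and "u' = a' - inv_eval (poly_part a')"
  have a: "a = inv_eval (poly_part a) + u" "a' = inv_eval (poly_part a') + u'"
    by (simp_all add: u_def u'_def)
  have pp_diff: "poly_part (v - w) = poly_part v - poly_part w" for v w :: "'k fls"
    using poly_part_add[of "v - w" w] by simp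
  have "poly_part u = 0" "poly_part u' = 0" by (simp_all add: u_def u'_def pp_diff)
  then have "vanishes_upto 0 u" "vanishes_upto 0 u'"
    by (simp_all add: vanishes_upto_def poly_part_eq_0_iff)
  then have "vanishes_upto 0 (u * u')"
    by (cases "u = 0 \<or> u' = 0") (auto simp: vanishes_upto_iff)
  then have uu: "poly_part (u * u') = 0" by (simp add: vanishes_upto_def poly_part_eq_0_iff)
  have pow: "v ^ r = v" "w ^ r = w" for v :: "'k fls" and w :: "'k poly" using r1 by simp_all
  have "z_twisted (x ** y) =
      z_twisted x + z_twisted y + inv_eval (poly_part a * poly_part a') + u * u'"
    by (simp add: z_twisted_def xy mult pow y_poly_def poly_part_add inv_eval_add inv_eval_mult
        u_def u'_def algebra_simps)
  then show ?thesis
    by (simp add: integral_part_def xy int_elt_mult mult pow y_poly_def poly_part_add uu)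
qed

text \<open>
  The decomposition of \<open>G\<^sub>2\<close> into integral points and a compact open factor makes \<open>integral_part\<close> an
  idempotent endomorphism, and it is locally constant. So the extension by the identity on the compact
  factor is locally a translation and therefore continuous.
\<close>
theorem commutative_isomorphism_extends:
  fixes \<Delta>\<^sub>1 \<Delta>\<^sub>2 :: "('k fls ^ 3 ^ 3) set"
  assumes r1: "r = 1"
    and \<Delta>1: "finite_index_subgroup \<Delta>\<^sub>1 (GL\<lparr>carrier := \<Gamma>\<^sub>0\<rparr>)"
    and \<Delta>2: "finite_index_subgroup \<Delta>\<^sub>2 (GL\<lparr>carrier := \<Gamma>\<^sub>0\<rparr>)"
    and \<phi>: "\<phi> \<in> iso (GL\<lparr>carrier := \<Delta>\<^sub>1\<rparr>) (GL\<lparr>carrier := \<Delta>\<^sub>2\<rparr>)"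
  shows "\<exists>G' G'' \<Lambda>. virtual_automorphism (G2_group r) (G2_topology r) G' G'' \<Lambda> \<and>
    \<Delta>\<^sub>1 \<subseteq> G' \<and> (\<forall>x\<in>\<Delta>\<^sub>1. \<Lambda> x = \<phi> x)"
proof -
  let ?H = "GL\<lparr>carrier := G2 r\<rparr> :: ('k fls ^ 3 ^ 3) monoid"
  interpret H: group ?H by (rule GL.subgroup_imp_group[OF subgroup_G2'])
  have pow: "a ^ r = a" for a :: "'k fls" using r1 by simp
  interpret H: comm_group ?H
  proof (rule H.group_comm_groupI)
    show "x \<otimes>\<^bsub>?H\<^esub> y = y \<otimes>\<^bsub>?H\<^esub> x" if "x \<in> carrier ?H" "y \<in> carrier ?H" for x y
      using that by (auto simp: G2_def mult pow ac_simps)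
  qed
  have int: "integral_part x \<in> \<Gamma>\<^sub>0" for x :: "'k fls ^ 3 ^ 3" by (simp add: integral_part_def del: Int_iff)
  have int_G2: "integral_part x \<in> G2 r" for x :: "'k fls ^ 3 ^ 3" using int by blast
  have \<gamma>: "integral_part \<in> hom ?H ?H"
    using integral_part_mult[OF r1] int_G2 by (auto simp: hom_def)
  have \<gamma>': "integral_part \<in> hom (GL\<lparr>carrier := G2 r\<rparr>) (GL\<lparr>carrier := \<Gamma>\<^sub>0\<rparr>)"
    using integral_part_mult[OF r1] int by (auto simp: hom_def simp del: Int_iff)
  have sub1: "subgroup \<Delta>\<^sub>1 GL" "\<Delta>\<^sub>1 \<subseteq> \<Gamma>\<^sub>0"
    by (rule GL.finite_index_subgroupE[OF \<Delta>1 subgroup_integral_points], blast)+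
  have sub2: "subgroup \<Delta>\<^sub>2 GL" "\<Delta>\<^sub>2 \<subseteq> \<Gamma>\<^sub>0"
    by (rule GL.finite_index_subgroupE[OF \<Delta>2 subgroup_integral_points], blast)+
  define \<psi> where "\<psi> = inv_into \<Delta>\<^sub>1 \<phi>"
  have bij: "bij_betw \<phi> \<Delta>\<^sub>1 \<Delta>\<^sub>2" using \<phi> by (simp add: iso_def)
  have "\<psi> \<in> iso (GL\<lparr>carrier := \<Delta>\<^sub>2\<rparr>) (GL\<lparr>carrier := \<Delta>\<^sub>1\<rparr>)"
    using group.iso_set_sym[OF GL.subgroup_imp_group[OF sub1(1)] \<phi>] by (simp add: \<psi>_def)
  then have \<psi>: "\<psi> (x ** y) = \<psi> x ** \<psi> y" if "x \<in> \<Delta>\<^sub>2" "y \<in> \<Delta>\<^sub>2" for x y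
    using that by (auto simp: iso_def hom_def)
  have \<phi>_mult: "\<phi> (x ** y) = \<phi> x ** \<phi> y" if "x \<in> \<Delta>\<^sub>1" "y \<in> \<Delta>\<^sub>1" for x y
    using \<phi> that by (auto simp: iso_def hom_def)
  have \<phi>_mem: "\<phi> x \<in> \<Delta>\<^sub>2" if "x \<in> \<Delta>\<^sub>1" for x using bij that by (auto simp: bij_betw_def)
  have \<psi>_mem: "\<psi> x \<in> \<Delta>\<^sub>1" if "x \<in> \<Delta>\<^sub>2" for x
    using bij that by (auto simp: \<psi>_def bij_betw_def inv_into_into)
  have \<psi>\<phi>: "\<psi> (\<phi> x) = x" if "x \<in> \<Delta>\<^sub>1" for x
    using bij that by (simp add: \<psi>_def bij_betw_inv_into_left)
  have \<phi>\<psi>: "\<phi> (\<psi> x) = x" if "x \<in> \<Delta>\<^sub>2" for x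
    using bij that by (simp add: \<psi>_def bij_betw_inv_into_right)
  define tw where "tw f x = f (integral_part x) ** inv\<^bsub>GL\<^esub> (integral_part x) ** x"
    for f :: "'k fls ^ 3 ^ 3 \<Rightarrow> 'k fls ^ 3 ^ 3" and x
  have inv: "inv\<^bsub>?H\<^esub> x = inv\<^bsub>GL\<^esub> x" if "x \<in> G2 r" for x
    using GL.m_inv_consistent[OF subgroup_G2' that] .
  have sub_G2: "\<Delta>\<^sub>1 \<subseteq> carrier ?H" "\<Delta>\<^sub>2 \<subseteq> carrier ?H" using sub1(2) sub2(2) by auto
  have idem: "integral_part (integral_part x) = integral_part x" for x
    by (rule integral_part_integral[OF int])
  have fix1: "integral_part x = x" if "x \<in> \<Delta>\<^sub>1" for x using integral_part_integral sub1(2) that by blast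
  have fix2: "integral_part x = x" if "x \<in> \<Delta>\<^sub>2" for x using integral_part_integral sub2(2) that by blast
  note twist1 = H.retraction_twist[where \<Delta> = \<Delta>\<^sub>1 and \<Delta>' = \<Delta>\<^sub>2 and \<phi> = \<phi> and \<phi>' = \<psi>,
      OF \<gamma> idem sub_G2 fix2 _ \<phi>_mem \<psi>\<phi>, simplified, simplified inv[OF int_G2], folded tw_def]
  note twist2 = H.retraction_twist[where \<Delta> = \<Delta>\<^sub>2 and \<Delta>' = \<Delta>\<^sub>1 and \<phi> = \<psi> and \<phi>' = \<phi>,
      OF \<gamma> idem sub_G2(2,1) fix1 _ \<psi>_mem \<phi>\<psi>, simplified, simplified inv[OF int_G2], folded tw_def]
  have cont: "continuous_on S (tw f)" if S: "S \<subseteq> G2 r" and f: "\<And>x. x \<in> S \<Longrightarrow> f (integral_part x) \<in> G2 r" for S f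
    unfolding tw_def
  proof (rule continuous_on_locally_constant_parameter
      [OF locally_constant_integral_part, where g = "\<lambda>d x. f d ** inv\<^bsub>GL\<^esub> d ** x"])
    fix x\<^sub>0 assume x0: "x\<^sub>0 \<in> S"
    define e where "e = f (integral_part x\<^sub>0) ** inv\<^bsub>GL\<^esub> (integral_part x\<^sub>0)"
    have "inv\<^bsub>GL\<^esub> (integral_part x\<^sub>0) \<in> G2 r"
      using subgroup.m_inv_closed[OF subgroup_G2' int_G2] .
    then have "e \<in> G2 r"
      using subgroup.m_closed[OF subgroup_G2' f[OF x0]] by (simp add: e_def)
    then obtain a b where e: "e = G2_elt r a b" by (auto simp: G2_def)
    have "continuous_on S (\<lambda>x. G2_elt r (a + x $ 2 $ 3) (b + x $ 1 $ 3 + a ^ r * x $ 2 $ 3))"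
      by (intro continuous_on_G2_elt continuous_on_fls_add continuous_on_fls_mult_const
          continuous_on_const continuous_on_component continuous_on_id)
    moreover have "e ** x = G2_elt r (a + x $ 2 $ 3) (b + x $ 1 $ 3 + a ^ r * x $ 2 $ 3)" if "x \<in> S" for x
    proof -
      have "e ** G2_elt r (x $ 2 $ 3) (x $ 1 $ 3) = G2_elt r (a + x $ 2 $ 3) (b + x $ 1 $ 3 + a ^ r * x $ 2 $ 3)"
        by (simp add: e mult)
      then show ?thesis using G2_elt_coordinates[of x r] that S by auto
    qed
    ultimately show "continuous_on S (\<lambda>x. f (integral_part x\<^sub>0) ** inv\<^bsub>GL\<^esub> (integral_part x\<^sub>0) ** x)"
      unfolding e_def[symmetric] by (simp cong: continuous_on_cong)
  qed
  define G' where "G' = {x \<in> G2 r. integral_part x \<in> \<Delta>\<^sub>1}"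
  define G'' where "G'' = {x \<in> G2 r. integral_part x \<in> \<Delta>\<^sub>2}"
  have va: "virtual_automorphism (G2_group r) (G2_topology r) G' G'' (tw \<phi>)"
  proof (rule virtual_automorphism_G2I[where \<Lambda>' = "tw \<psi>"])
    show "finite_index_subgroup G' (GL\<lparr>carrier := G2 r\<rparr>)"
      unfolding G'_def by (rule GL.finite_index_subgroup_vimage[OF subgroup_G2' subgroup_integral_points \<gamma>' \<Delta>1])
    show "finite_index_subgroup G'' (GL\<lparr>carrier := G2 r\<rparr>)"
      unfolding G''_def by (rule GL.finite_index_subgroup_vimage[OF subgroup_G2' subgroup_integral_points \<gamma>' \<Delta>2])
    show "openin (G2_topology r) G'" "openin (G2_topology r) G''"
      unfolding G'_def G''_def
      by (intro openin_locally_constant_vimage locally_constant_integral_part)+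
    show "continuous_on G' (tw \<phi>)" "continuous_on G'' (tw \<psi>)"
      using \<phi>_mem \<psi>_mem sub_G2 by (auto simp: G'_def G''_def intro!: cont)
    show "tw \<phi> (x ** y) = tw \<phi> x ** tw \<phi> y" if "x \<in> G'" "y \<in> G'" for x y
      using twist1(4) \<phi>_mult that by (simp add: G'_def)
    show "tw \<phi> x \<in> G''" "tw \<psi> (tw \<phi> x) = x" if "x \<in> G'" for x
      using twist1(1,2,3) \<phi>_mult \<phi>_mem that by (simp_all add: G'_def G''_def)
    show "tw \<psi> x \<in> G'" "tw \<phi> (tw \<psi> x) = x" if "x \<in> G''" for x
      using twist2(1,2,3) \<psi> \<psi>_mem that by (simp_all add: G'_def G''_def)
  qed
  have "tw \<phi> x = \<phi> x" if x: "x \<in> \<Delta>\<^sub>1" for x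
  proof -
    have "\<phi> x \<otimes>\<^bsub>GL\<^esub> inv\<^bsub>GL\<^esub> x \<otimes>\<^bsub>GL\<^esub> x = \<phi> x"
      using subgroup.mem_carrier[OF sub1(1) x] subgroup.mem_carrier[OF sub2(1) \<phi>_mem[OF x]]
      by (simp add: GL.m_assoc del: GL_mult)
    then show ?thesis using fix1[OF x] by (simp add: tw_def)
  qed
  moreover have "\<Delta>\<^sub>1 \<subseteq> G'" using fix1 sub_G2(1) by (auto simp: G'_def)
  ultimately show ?thesis using va by blast
qed

end

theorem corollary1p12:
  fixes p q r m s :: nat
    and \<Gamma> :: "('k::{field,finite} fls ^ 3 ^ 3) set"
  assumes "prime p"
    and "q = p ^ m" and "m > 0"
    and "r = p ^ s"
    and "CARD('k) = q"
    and "r \<noteq> 2"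
    and "arithmetic_in \<Gamma> (G2 r)"
    and "lattice_in \<Gamma> (G2_group r) (G2_topology r)"
  shows "automorphism_rigid \<Gamma> (G2_group r) (G2_topology r)"
proof -
  interpret char_power "TYPE('k)" p m s r
    by unfold_locales (use assms in auto)
  interpret GL: group "GL :: ('k fls ^ 3 ^ 3) monoid" by (rule group_GL)
  have "subgroup \<Gamma> (GL\<lparr>carrier := G2 r\<rparr>)" and com: "commensurable GL \<Gamma> \<Gamma>\<^sub>0"
    using assms(7) by (simp_all add: arithmetic_in_def)
  then have \<Gamma>: "subgroup \<Gamma> GL" using GL.incl_subgroup[OF subgroup_G2'] by blast
  show ?thesis
    unfolding automorphism_rigid_def
  proof (intro conjI allI impI)
    show "discrete_subgroup \<Gamma> (G2_group r) (G2_topology r)"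
      using assms(8) by (simp add: lattice_in_def)
    fix \<Gamma>\<^sub>1 \<Gamma>\<^sub>2 \<phi>
    assume "virtual_automorphism (G2_group r\<lparr>carrier := \<Gamma>\<rparr>) (discrete_topology \<Gamma>) \<Gamma>\<^sub>1 \<Gamma>\<^sub>2 \<phi>"
    then have \<Gamma>1: "finite_index_subgroup \<Gamma>\<^sub>1 (GL\<lparr>carrier := \<Gamma>\<rparr>)"
      and \<Gamma>2: "finite_index_subgroup \<Gamma>\<^sub>2 (GL\<lparr>carrier := \<Gamma>\<rparr>)"
      and \<phi>: "\<phi> \<in> iso (GL\<lparr>carrier := \<Gamma>\<^sub>1\<rparr>) (GL\<lparr>carrier := \<Gamma>\<^sub>2\<rparr>)"
      by (simp_all add: virtual_automorphism_def)
    obtain \<Delta>\<^sub>1 \<Delta>\<^sub>2 where \<Delta>: "finite_index_subgroup \<Delta>\<^sub>1 (GL\<lparr>carrier := \<Gamma>\<^sub>1\<rparr>)"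
      "finite_index_subgroup \<Delta>\<^sub>1 (GL\<lparr>carrier := \<Gamma>\<^sub>0\<rparr>)" "finite_index_subgroup \<Delta>\<^sub>2 (GL\<lparr>carrier := \<Gamma>\<^sub>0\<rparr>)"
      "\<phi> \<in> iso (GL\<lparr>carrier := \<Delta>\<^sub>1\<rparr>) (GL\<lparr>carrier := \<Delta>\<^sub>2\<rparr>)"
      by (rule GL.commensurable_restriction[OF \<Gamma> subgroup_integral_points com \<Gamma>1 \<Gamma>2 \<phi>])
    have \<Gamma>1_sub: "subgroup \<Gamma>\<^sub>1 GL" by (rule GL.finite_index_subgroupE[OF \<Gamma>1 \<Gamma>])
    have "\<exists>G' G'' \<Lambda> \<Delta>. virtual_automorphism (G2_group r) (G2_topology r) G' G'' \<Lambda> \<and>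
        finite_index_subgroup \<Delta> (GL\<lparr>carrier := \<Gamma>\<^sub>1\<rparr>) \<and> \<Delta> \<subseteq> G' \<and> (\<forall>x\<in>\<Delta>. \<Lambda> x = \<phi> x)"
    proof (cases "s = 0")
      case True
      then have "r = 1" using assms(4) by simp
      from commutative_isomorphism_extends[OF this \<Delta>(2-4)] show ?thesis using \<Delta>(1) by blast
    next
      case False
      then interpret lattice_isomorphism "TYPE('k)" p m s r \<Delta>\<^sub>1 \<Delta>\<^sub>2 \<phi>
        by unfold_locales (use \<Delta> in auto)
      obtain \<Phi> :: "'k fls \<Rightarrow> 'k fls" and a \<Delta> h where st:
        "\<And>x y. \<Phi> (x + y) = \<Phi> x + \<Phi> y" "\<And>x y. \<Phi> (x * y) = \<Phi> x * \<Phi> y" "bij \<Phi>"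
        "\<And>y. fls_subdegree (\<Phi> y) = fls_subdegree y" "a \<noteq> 0"
        "finite_index_subgroup \<Delta> (GL\<lparr>carrier := \<Delta>\<^sub>1\<rparr>)" "finite_index_add (y_poly ` \<Delta>)"
        "\<And>v w. v \<in> y_poly ` \<Delta> \<Longrightarrow> w \<in> y_poly ` \<Delta> \<Longrightarrow> h (v + w) = h v + h w"
        "\<And>x. x \<in> \<Delta> \<Longrightarrow> \<phi> x = G2_elt r (a * \<Phi> (x $ 2 $ 3)) (a ^ Suc r * \<Phi> (x $ 1 $ 3) + h (y_poly x))"
        by (rule structure_of_isomorphism) blast
      have "finite_index_subgroup \<Delta> (GL\<lparr>carrier := \<Gamma>\<^sub>1\<rparr>)"
        by (rule GL.finite_index_subgroup_trans[OF \<Gamma>1_sub \<Delta>(1) st(6)])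
      moreover have "\<Delta> \<subseteq> {x \<in> G2 r. y_poly x \<in> y_poly ` \<Delta>}"
      proof -
        have "\<Delta> \<subseteq> \<Delta>\<^sub>1"
          by (rule GL.finite_index_subgroupE[OF st(6) lattice_subgroup[OF \<Delta>(2)]])
        then show ?thesis using \<Delta>1_integral by auto
      qed
      moreover obtain G'' where "virtual_automorphism (G2_group r) (G2_topology r)
          {x \<in> G2 r. y_poly x \<in> y_poly ` \<Delta>} G''
          (\<lambda>x. G2_elt r (a * \<Phi> (x $ 2 $ 3)) (a ^ Suc r * \<Phi> (x $ 1 $ 3) + h (y_poly x)))"
        using semilinear_map_is_virtual_automorphism[OF st(1-5,7,8)] by blast
      ultimately show ?thesis
        by (intro exI conjI ballI) (assumption+, rule st(9)[symmetric])
    qed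
    then show "\<exists>G' G'' \<Lambda> \<Gamma>\<^sub>1'. virtual_automorphism (G2_group r) (G2_topology r) G' G'' \<Lambda> \<and>
        finite_index_subgroup \<Gamma>\<^sub>1' (G2_group r\<lparr>carrier := \<Gamma>\<^sub>1\<rparr>) \<and>
        \<Gamma>\<^sub>1' \<subseteq> G' \<and> (\<forall>x\<in>\<Gamma>\<^sub>1'. \<Lambda> x = \<phi> x)"
      by simp
  qed
qed

end
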